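(* Let $I,J\subseteq\{1,\dots,N-1\}$ be disjoint with $i-1,i+1\notin J$ for every $i\in I$ and $j-1,j+1\notin I$ for every $j\in J$. Let $\eta$ be a composition such that $\eta_j\neq\eta_{j'}$ whenever $j\ne j'$ belong to a common $\tilde J_s$, and let $a_\eta^{(I,J)}$ be the constant defined by $$\mathcal O_{I,J}E_\eta(z)=a_\eta^{(I,J)}\,S^{(I,J)}_{\eta^*}(z).$$ Then $$a_\eta^{(I,J)}={\det}_J(w_J)\,\mathcal M_{I,\eta}\,\frac{d'_\eta\, d'_{\eta^{(-,+)}}\, d_{\eta^{(-,+)}}}{d'_{\eta^{(0,+)}}\, d_{\eta^{(0,+)}}\, d'_{\eta^{(-,-)}}},$$ where $w_J\in W_J$ is such that $w_J\eta=\eta^{(0,+)}$.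
   Context: Fix $N\ge 1$ and a real parameter $\alpha>0$. A composition is $\eta=(\eta_1,\dots,\eta_N)$ with nonnegative integer entries; $|\eta|=\sum_j\eta_j$; $\eta^+$ is the partition obtained by sorting the entries of $\eta$ in weakly decreasing order. For compositions $\nu\ne\eta$ with $|\nu|=|\eta|$, write $\nu<\eta$ if $\sum_{j=1}^p\nu_j\le\sum_{j=1}^p\eta_j$ for all $p=1,\dots,N$; write $\nu\prec\eta$ if $\nu^+<\eta^+$, or if $\nu^+=\eta^+$ and $\nu<\eta$. Let $s_{jk}$ be the operator interchanging $z_j$ and $z_k$ in a function of $z=(z_1,\dots,z_N)$, and $s_j:=s_{j,j+1}$. The Cherednik operators are $$\xi_i=\alpha z_i\frac{\partial}{\partial z_i}+\sum_{p<i}\frac{z_i}{z_i-z_p}(1-s_{ip})+\sum_{p>i}\frac{z_p}{z_i-z_p}(1-s_{ip})+1-i ,\quad i=1,\dots,N.$$ The nonsymmetric Jack polynomial $E_\eta(z)=E_\eta(z;\alpha)$ is the unique polynomial of the form $z^\eta+\sum_{\nu\prec\eta}c_{\eta\nu}z^\nu$ with $\xi_iE_\eta=\bar\eta_iE_\eta$ for all $i$, where $\bar\eta_i:=\alpha\eta_i-\#\{k<i\mid\eta_k\ge\eta_i\}-\#\{k>i\mid\eta_k>\eta_i\}$. For a subset $K\subseteq\{1,\dots,N-1\}$, $W_K$ is the group generated by the transpositions $s_j$, $j\in K$, acting on compositions by $w(\lambda)=(\lambda_{w^{-1}(1)},\dots,\lambda_{w^{-1}(N)})$. Write $J=\bigcup_sJ_s$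 as the union of its maximal sets of consecutive integers and $\tilde J_s:=J_s\cup\{\max(J_s)+1\}$. For $w\in W_{I\cup J}$, $\det_J(w)=+1$ or $-1$ according to whether an expression of $w$ as a product of the generators $s_k$, $k\in I\cup J$, has an even or odd number of factors from $\{s_j\mid j\in J\}$. The operator $\mathcal O_{I,J}$ is defined linearly by $\mathcal O_{I,J}(z^\lambda)=\sum_{w\in W_{I\cup J}}\det_J(w)\,z^{w(\lambda)}$. For $\eta$ with $\eta_j\ne\eta_{j'}$ for all $j\ne j'$ in a common $\tilde J_s$, $\eta^*$ is the unique element of the orbit $W_{I\cup J}(\eta)$ with $\eta^*_i\ge\eta^*_{i+1}$ for all $i\in I$ and $\eta^*_j>\eta^*_{j+1}$ for all $j\in J$. For all such $\eta$ in a given orbit, $\mathcal O_{I,J}E_\eta$ is a scalar multiple of one and the same polynomial, $S^{(I,J)}_{\eta^*}(z)$ (the Jack polynomial with prescribed symmetry), normalized by $S^{(I,J)}_{\eta^*}(z)=z^{\eta^*}+\sum_{\nu\prec\eta^*}\tilde c_{\eta\nu}z^\nu$. It satisfies $s_iS^{(I,J)}_{\eta^*}=S^{(I,J)}_{\eta^*}$ ($i\in I$) and $s_jS^{(I,J)}_{\eta^*}=-S^{(I,J)}_{\eta^*}$ ($j\in J$). $\mathcal M_{I,\eta}:=\#\{\sigma\in W_I\mid\sigma(\eta)=\eta\}$. For $\epsilon_I,\epsilon_J\in\{+,0,-\}$, $\eta^{(\epsilon_I,\epsilon_J)}$ is the element $\mu$ of $W_{I\cup J}(\eta)$ such that: $\mu_i\ge\mu_{i+1}$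 for all $i\in I$ if $\epsilon_I=+$; $\mu_i\le\mu_{i+1}$ for all $i\in I$ if $\epsilon_I=-$; $\mu_i=\eta_i,\ \mu_{i+1}=\eta_{i+1}$ for all $i\in I$ if $\epsilon_I=0$; and $\mu_j>\mu_{j+1}$ for all $j\in J$ if $\epsilon_J=+$; $\mu_j<\mu_{j+1}$ for all $j\in J$ if $\epsilon_J=-$; $\mu_j=\eta_j,\ \mu_{j+1}=\eta_{j+1}$ for all $j\in J$ if $\epsilon_J=0$. For a composition $\eta$ put $$d_\eta=\prod_{(i,j)\in\eta}\big(\alpha(a(i,j)+1)+l(i,j)+1\big),\qquad d'_\eta=\prod_{(i,j)\in\eta}\big(\alpha(a(i,j)+1)+l(i,j)\big),$$ products over $1\le i\le N$, $1\le j\le\eta_i$, with $a(i,j)=\eta_i-j$ and $l(i,j)=\#\{k<i\mid j\le\eta_k+1\le\eta_i\}+\#\{k>i\mid j\le\eta_k\le\eta_i\}$. *)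

theory Defs
  imports Complex_Main "HOL-Library.Poly_Mapping" "HOL-Algebra.Sym_Groups"
begin

text \<open>
  Positions are numbered \<open>1, \<dots>, N\<close>.  A composition is the finitely supported exponent vector of the
  monomial \<open>z\<^sup>\<eta>\<close>, so that a real polynomial in \<open>z\<^sub>1, z\<^sub>2, \<dots>\<close> is a finitely supported function on
  exponent vectors, and the polynomials in \<open>z\<^sub>1, \<dots>, z\<^sub>N\<close> are those supported on \<open>compositions N\<close>.
\<close>

type_synonym exponents = "nat \<Rightarrow>\<^sub>0 nat"
type_synonym polynomial = "exponents \<Rightarrow>\<^sub>0 real"

definition compositions :: "nat \<Rightarrow> exponents set" where
  "compositions N = {\<eta>. Poly_Mapping.keys \<eta> \<subseteq> {1..N}}"

abbreviation part :: "exponents \<Rightarrow> nat \<Rightarrow> nat" where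
  "part \<eta> j \<equiv> Poly_Mapping.lookup \<eta> j"

definition weight :: "nat \<Rightarrow> exponents \<Rightarrow> nat" where
  "weight N \<eta> = (\<Sum>j=1..N. part \<eta> j)"

definition sorted_desc :: "nat \<Rightarrow> exponents \<Rightarrow> exponents" where
  "sorted_desc N \<eta> =
     (\<Sum>j=1..N. Poly_Mapping.single j (rev (sort (map (part \<eta>) [1..<Suc N])) ! (j - 1)))"

definition dom_less :: "nat \<Rightarrow> exponents \<Rightarrow> exponents \<Rightarrow> bool" where
  "dom_less N \<nu> \<eta> \<longleftrightarrow> \<nu> \<noteq> \<eta> \<and> weight N \<nu> = weight N \<eta> \<and>
     (\<forall>p\<in>{1..N}. (\<Sum>j=1..p. part \<nu> j) \<le> (\<Sum>j=1..p. part \<eta> j))"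

definition prec :: "nat \<Rightarrow> exponents \<Rightarrow> exponents \<Rightarrow> bool" where
  "prec N \<nu> \<eta> \<longleftrightarrow> \<nu> \<noteq> \<eta> \<and> weight N \<nu> = weight N \<eta> \<and>
     (dom_less N (sorted_desc N \<nu>) (sorted_desc N \<eta>) \<or>
      sorted_desc N \<nu> = sorted_desc N \<eta> \<and> dom_less N \<nu> \<eta>)"

definition term_poly :: "exponents \<Rightarrow> real \<Rightarrow> polynomial" where
  "term_poly \<eta> c = Poly_Mapping.single \<eta> c"

definition const_poly :: "real \<Rightarrow> polynomial" where
  "const_poly c = term_poly 0 c"

definition zvar :: "nat \<Rightarrow> polynomial" where
  "zvar i = term_poly (Poly_Mapping.single i 1) 1"

definition perm_exp :: "(nat \<Rightarrow> nat) \<Rightarrow> exponents \<Rightarrow> exponents" where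
  "perm_exp w \<eta> = Poly_Mapping.map_key (Hilbert_Choice.inv w) \<eta>"

definition perm_poly :: "(nat \<Rightarrow> nat) \<Rightarrow> polynomial \<Rightarrow> polynomial" where
  "perm_poly w f =
     (\<Sum>\<nu>\<in>Poly_Mapping.keys f. term_poly (perm_exp w \<nu>) (Poly_Mapping.lookup f \<nu>))"

definition partial_deriv :: "nat \<Rightarrow> polynomial \<Rightarrow> polynomial" where
  "partial_deriv i f =
     (\<Sum>\<nu>\<in>Poly_Mapping.keys f.
        term_poly (\<nu> - Poly_Mapping.single i 1) (real (part \<nu> i) * Poly_Mapping.lookup f \<nu>))"

text \<open>
  Only used when \<open>g \<noteq> 0\<close> divides \<open>f\<close>; the quotient is then unique since polynomials form an
  integral domain.
\<close>

definition exact_quot :: "polynomial \<Rightarrow> polynomial \<Rightarrow> polynomial" where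
  "exact_quot f g = (THE q. q * g = f)"

definition cherednik :: "nat \<Rightarrow> real \<Rightarrow> nat \<Rightarrow> polynomial \<Rightarrow> polynomial" where
  "cherednik N \<alpha> i f =
     const_poly \<alpha> * zvar i * partial_deriv i f
     + (\<Sum>p\<in>{1..<i}. exact_quot (zvar i * (f - perm_poly (transpose i p) f)) (zvar i - zvar p))
     + (\<Sum>p\<in>{i<..N}. exact_quot (zvar p * (f - perm_poly (transpose i p) f)) (zvar i - zvar p))
     + const_poly (1 - real i) * f"

definition eigenval :: "nat \<Rightarrow> real \<Rightarrow> exponents \<Rightarrow> nat \<Rightarrow> real" where
  "eigenval N \<alpha> \<eta> i =
     \<alpha> * real (part \<eta> i)
     - real (card {k\<in>{1..N}. k < i \<and> part \<eta> k \<ge> part \<eta> i})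
     - real (card {k\<in>{1..N}. k > i \<and> part \<eta> k > part \<eta> i})"

definition monic_triangular :: "nat \<Rightarrow> exponents \<Rightarrow> polynomial \<Rightarrow> bool" where
  "monic_triangular N \<eta> f \<longleftrightarrow>
     (\<exists>c. f = term_poly \<eta> 1 + (\<Sum>\<nu> | \<nu> \<in> compositions N \<and> prec N \<nu> \<eta>. term_poly \<nu> (c \<nu>)))"

definition nonsym_jack :: "nat \<Rightarrow> real \<Rightarrow> exponents \<Rightarrow> polynomial" where
  "nonsym_jack N \<alpha> \<eta> =
     (THE E. monic_triangular N \<eta> E \<and>
             (\<forall>i\<in>{1..N}. cherednik N \<alpha> i E = const_poly (eigenval N \<alpha> \<eta> i) * E))"

definition simple_transp :: "nat \<Rightarrow> nat \<Rightarrow> nat" where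
  "simple_transp j = transpose j (j + 1)"

definition W_group :: "nat \<Rightarrow> nat set \<Rightarrow> (nat \<Rightarrow> nat) set" where
  "W_group N K = generate (sym_group N) (simple_transp ` K)"

definition orbit :: "nat \<Rightarrow> nat set \<Rightarrow> exponents \<Rightarrow> exponents set" where
  "orbit N K \<eta> = (\<lambda>w. perm_exp w \<eta>) ` W_group N K"

definition word_prod :: "nat list \<Rightarrow> nat \<Rightarrow> nat" where
  "word_prod ks = foldr (\<circ>) (map simple_transp ks) id"

text \<open>
  For \<open>w \<in> W_group N (I \<union> J)\<close> with no element of \<open>I\<close> adjacent to an element of \<open>J\<close>, the parity below does
  not depend on the chosen word, because every braid relation involving both \<open>I\<close> and \<open>J\<close> is a
  commutation.
\<close>

definition det_J :: "nat set \<Rightarrow> nat set \<Rightarrow> (nat \<Rightarrow> nat) \<Rightarrow> real" where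
  "det_J I J w =
     (-1) ^ length (filter (\<lambda>k. k \<in> J) (SOME ks. set ks \<subseteq> I \<union> J \<and> word_prod ks = w))"

definition sym_op :: "nat \<Rightarrow> nat set \<Rightarrow> nat set \<Rightarrow> polynomial \<Rightarrow> polynomial" where
  "sym_op N I J f =
     (\<Sum>\<nu>\<in>Poly_Mapping.keys f.
        const_poly (Poly_Mapping.lookup f \<nu>) *
        (\<Sum>w\<in>W_group N (I \<union> J). const_poly (det_J I J w) * term_poly (perm_exp w \<nu>) 1))"

definition consecutive :: "nat set \<Rightarrow> bool" where
  "consecutive A \<longleftrightarrow> A \<noteq> {} \<and> (\<exists>a b. A = {a..b})"

definition max_runs :: "nat set \<Rightarrow> nat set set" where
  "max_runs J = {A. A \<subseteq> J \<and> consecutive A \<and>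
     (\<forall>B. B \<subseteq> J \<and> consecutive B \<and> A \<subseteq> B \<longrightarrow> B = A)}"

definition block :: "nat set \<Rightarrow> nat set" where
  "block A = A \<union> {Max A + 1}"

definition distinct_on_blocks :: "nat set \<Rightarrow> exponents \<Rightarrow> bool" where
  "distinct_on_blocks J \<eta> \<longleftrightarrow>
     (\<forall>A\<in>max_runs J. \<forall>j\<in>block A. \<forall>j'\<in>block A. j \<noteq> j' \<longrightarrow> part \<eta> j \<noteq> part \<eta> j')"

definition eta_star :: "nat \<Rightarrow> nat set \<Rightarrow> nat set \<Rightarrow> exponents \<Rightarrow> exponents" where
  "eta_star N I J \<eta> =
     (THE \<mu>. \<mu> \<in> orbit N (I \<union> J) \<eta> \<and>
             (\<forall>i\<in>I. part \<mu> i \<ge> part \<mu> (i + 1)) \<and> (\<forall>j\<in>J. part \<mu> j > part \<mu> (j + 1)))"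

definition sym_jack :: "nat \<Rightarrow> real \<Rightarrow> nat set \<Rightarrow> nat set \<Rightarrow> exponents \<Rightarrow> polynomial" where
  "sym_jack N \<alpha> I J \<kappa> =
     (THE S. monic_triangular N \<kappa> S \<and>
             (\<forall>\<mu>\<in>orbit N (I \<union> J) \<kappa>. distinct_on_blocks J \<mu> \<longrightarrow>
                (\<exists>c. sym_op N I J (nonsym_jack N \<alpha> \<mu>) = const_poly c * S)))"

definition a_const :: "nat \<Rightarrow> real \<Rightarrow> nat set \<Rightarrow> nat set \<Rightarrow> exponents \<Rightarrow> real" where
  "a_const N \<alpha> I J \<eta> =
     (THE a. sym_op N I J (nonsym_jack N \<alpha> \<eta>) = const_poly a * sym_jack N \<alpha> I J (eta_star N I J \<eta>))"

definition stab_card :: "nat \<Rightarrow> nat set \<Rightarrow> exponents \<Rightarrow> nat" where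
  "stab_card N I \<eta> = card {\<sigma> \<in> W_group N I. perm_exp \<sigma> \<eta> = \<eta>}"

datatype epsilon = Plus | Zero | Minus

definition rearr :: "nat \<Rightarrow> nat set \<Rightarrow> nat set \<Rightarrow> epsilon \<Rightarrow> epsilon \<Rightarrow> exponents \<Rightarrow> exponents" where
  "rearr N I J \<epsilon>\<^sub>I \<epsilon>\<^sub>J \<eta> =
     (THE \<mu>. \<mu> \<in> orbit N (I \<union> J) \<eta> \<and>
        (\<forall>i\<in>I. case \<epsilon>\<^sub>I of
            Plus \<Rightarrow> part \<mu> i \<ge> part \<mu> (i + 1)
          | Minus \<Rightarrow> part \<mu> i \<le> part \<mu> (i + 1)
          | Zero \<Rightarrow> part \<mu> i = part \<eta> i \<and> part \<mu> (i + 1) = part \<eta> (i + 1)) \<and>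
        (\<forall>j\<in>J. case \<epsilon>\<^sub>J of
            Plus \<Rightarrow> part \<mu> j > part \<mu> (j + 1)
          | Minus \<Rightarrow> part \<mu> j < part \<mu> (j + 1)
          | Zero \<Rightarrow> part \<mu> j = part \<eta> j \<and> part \<mu> (j + 1) = part \<eta> (j + 1)))"

definition arm :: "exponents \<Rightarrow> nat \<Rightarrow> nat \<Rightarrow> nat" where
  "arm \<eta> i j = part \<eta> i - j"

definition leg :: "nat \<Rightarrow> exponents \<Rightarrow> nat \<Rightarrow> nat \<Rightarrow> nat" where
  "leg N \<eta> i j =
     card {k\<in>{1..N}. k < i \<and> j \<le> part \<eta> k + 1 \<and> part \<eta> k + 1 \<le> part \<eta> i} +
     card {k\<in>{1..N}. k > i \<and> j \<le> part \<eta> k \<and> part \<eta> k \<le> part \<eta> i}"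

definition d_prod :: "nat \<Rightarrow> real \<Rightarrow> exponents \<Rightarrow> real" where
  "d_prod N \<alpha> \<eta> =
     (\<Prod>i=1..N. \<Prod>j=1..part \<eta> i. \<alpha> * (real (arm \<eta> i j) + 1) + real (leg N \<eta> i j) + 1)"

definition d'_prod :: "nat \<Rightarrow> real \<Rightarrow> exponents \<Rightarrow> real" where
  "d'_prod N \<alpha> \<eta> =
     (\<Prod>i=1..N. \<Prod>j=1..part \<eta> i. \<alpha> * (real (arm \<eta> i j) + 1) + real (leg N \<eta> i j))"

end

theory Submission
  imports Defs
begin

text \<open>
  The Cherednik operators are triangular for \<open>\<prec>\<close> with a separated joint spectrum, so a joint
  eigenvector is determined by its spectrum up to a scalar, and every maximal exponent of its support is
  the composition carrying that spectrum.  The degenerate Hecke relations and the raising operator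
  \<open>f \<mapsto> z\<^sub>N f(z\<^sub>N, z\<^sub>1, \<dots>, z\<^sub>N\<^sub>-\<^sub>1)\<close> carry joint eigenvectors to joint eigenvectors, which yields all
  \<open>E\<^sub>\<eta>\<close> from \<open>1\<close> and the rule \<open>s\<^sub>k E\<^sub>\<eta> = \<delta>\<^sup>-\<^sup>1 E\<^sub>\<eta> + E\<close> with \<open>E = E\<^bsub>s\<^sub>k \<eta>\<^esub>\<close> for \<open>\<eta>\<^sub>k < \<eta>\<^sub>k\<^sub>+\<^sub>1\<close>, \<open>\<delta>\<close> being the
  difference of the eigenvalues of \<open>\<xi>\<^sub>k\<close> and \<open>\<xi>\<^sub>k\<^sub>+\<^sub>1\<close>.  Applying \<open>\<O>\<close> to this rule shows that \<open>d\<^sub>\<eta> \<O> E\<^sub>\<eta>\<close> is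
  invariant under \<open>W\<^sub>I\<close> and that \<open>\<O> E\<^sub>\<eta> / d'\<^sub>\<eta>\<close> changes by the sign under \<open>W\<^sub>J\<close>.  Walking along
  \<open>\<eta>, \<eta>\<^sup>(\<^sup>0\<^sup>,\<^sup>+\<^sup>), \<eta>\<^sup>(\<^sup>-\<^sup>,\<^sup>+\<^sup>), \<eta>\<^sup>(\<^sup>-\<^sup>,\<^sup>-\<^sup>)\<close> reduces the claim to the last composition.  It is minimal in its
  orbit, so the coefficient of \<open>z\<close> to the power \<open>\<eta>\<^sup>*\<close> in its symmetrization is, up to sign, the order of the
  stabilizer.
\<close>

section \<open>Polynomials and divided differences\<close>

text \<open>No genericity of \<alpha> is assumed: for every \<alpha> > 0 the order of the
  eigenvalues reproduces the ranking of the entries, so spectra separate compositions. The hook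
  products enter through one box. When an entry a at position k is exchanged with a smaller entry b
  at k + 1, only the leg of the box in row k, column b + 1 changes. With \<delta> taken before the
  exchange, its factor goes from \<delta> to \<delta> + 1 in d and from \<delta> - 1 to \<delta> in
  d'. Hence the scalars 1 + 1/\<delta> on the symmetric side and 1 - 1/\<delta> on the antisymmetric
  side are ratios of d and of d' respectively, which is why d accompanies I and d' accompanies J.
  The first walk inside W_J gives the sign of w_J; the sign of the second one occurs again in the
  leading coefficient at the end and cancels. \<open>sym_jack\<close> and \<open>a_const\<close> are
  definite descriptions, so existence and uniqueness of S must be proved as well. Both rest on one
  nonzero leading coefficient, the signed stabilizer order at the increasing arrangement.\<close>

abbreviation coef :: "polynomial \<Rightarrow> exponents \<Rightarrow> real" where
  "coef f \<nu> \<equiv> Poly_Mapping.lookup f \<nu>"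

abbreviation esingle :: "nat \<Rightarrow> nat \<Rightarrow> exponents" where
  "esingle i a \<equiv> Poly_Mapping.single i a"

lemma part_perm_exp: "bij w \<Longrightarrow> part (perm_exp w \<eta>) i = part \<eta> (inv' w i)"
  by (simp add: perm_exp_def map_key.rep_eq bij_imp_bij_inv bij_is_inj)

lemma part_perm_exp': "bij w \<Longrightarrow> part (perm_exp w \<eta>) (w i) = part \<eta> i"
  by (simp add: part_perm_exp bij_is_inj)

lemma perm_exp_add: "bij w \<Longrightarrow> perm_exp w (\<mu> + \<nu>) = perm_exp w \<mu> + perm_exp w \<nu>"
  by (simp add: perm_exp_def map_key_plus bij_imp_bij_inv bij_is_inj)

lemma perm_exp_comp:
  assumes "bij v" "bij w"
  shows "perm_exp v (perm_exp w \<eta>) = perm_exp (v \<circ> w) \<eta>"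
  using assms by (intro poly_mapping_eqI) (simp add: part_perm_exp bij_comp o_inv_distrib)

lemma perm_exp_id [simp]: "perm_exp id \<eta> = \<eta>"
  by (intro poly_mapping_eqI) (simp add: part_perm_exp)

lemma perm_exp_single: "bij w \<Longrightarrow> perm_exp w (esingle i a) = esingle (w i) a"
  by (intro poly_mapping_eqI)
     (auto simp: part_perm_exp lookup_single when_def bij_inv_eq_iff bij_is_inj inv_f_f)

lemma perm_exp_inv_cancel: "bij w \<Longrightarrow> perm_exp (inv' w) (perm_exp w \<eta>) = \<eta>"
  by (simp add: perm_exp_comp bij_imp_bij_inv bij_is_inj)

lemma perm_exp_cancel_inv: "bij w \<Longrightarrow> perm_exp w (perm_exp (inv' w) \<eta>) = \<eta>"
  by (simp add: perm_exp_comp bij_imp_bij_inv bij_is_surj surj_iff[THEN iffD1])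

lemma perm_exp_eq_iff: "bij w \<Longrightarrow> perm_exp w \<mu> = \<nu> \<longleftrightarrow> \<mu> = perm_exp (inv' w) \<nu>"
  using perm_exp_inv_cancel perm_exp_cancel_inv by metis

lemma coef_term_poly: "coef (term_poly \<eta> c) \<nu> = (if \<nu> = \<eta> then c else 0)"
  by (auto simp: term_poly_def lookup_single when_def)

lemma term_poly_add: "term_poly \<eta> (a + b) = term_poly \<eta> a + term_poly \<eta> b"
  by (simp add: term_poly_def single_add)

lemma term_poly_0 [simp]: "term_poly \<eta> 0 = 0"
  by (simp add: term_poly_def)

lemma term_poly_uminus: "term_poly \<eta> (- a) = - term_poly \<eta> a"
  by (simp add: term_poly_def single_uminus)

lemma term_poly_mult: "term_poly \<mu> a * term_poly \<nu> b = term_poly (\<mu> + \<nu>) (a * b)"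
  by (simp add: term_poly_def mult_single)

lemma polynomial_eq_sum_terms: "f = (\<Sum>\<nu>\<in>Poly_Mapping.keys f. term_poly \<nu> (coef f \<nu>))"
  by (rule poly_mapping_eqI)
     (auto simp: lookup_sum coef_term_poly in_keys_iff sum.delta' if_distrib cong: if_cong)

lemma polynomial_induct [case_names zero add]:
  assumes "P 0" and "\<And>f \<nu> c. P f \<Longrightarrow> P (f + term_poly \<nu> c)"
  shows "P f"
proof -
  have "P (\<Sum>\<nu>\<in>A. term_poly \<nu> (coef f \<nu>))" if "finite A" for A
    using that
  proof (induction A)
    case (insert \<nu> A)
    then show ?case using assms(2)[OF insert.IH, of \<nu> "coef f \<nu>"] by (simp add: add.commute)
  qed (simp add: assms(1))
  from this[of "Poly_Mapping.keys f"] show ?thesis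
    using polynomial_eq_sum_terms[of f] by simp
qed

lemma additive_eqI:
  fixes F G :: "polynomial \<Rightarrow> polynomial"
  assumes "additive F" "additive G" "\<And>\<nu> c. F (term_poly \<nu> c) = G (term_poly \<nu> c)"
  shows "F f = G f"
  by (induction f rule: polynomial_induct)
     (simp_all add: additive.zero[OF assms(1)] additive.zero[OF assms(2)]
        additive.add[OF assms(1)] additive.add[OF assms(2)] assms(3))

text \<open>A sum over the keys of \<open>f\<close> is not visibly additive, since cancellation can
  shrink the key set of \<open>f + g\<close>. Additivity of \<open>h \<nu>\<close> forces
  \<open>h \<nu> 0 = 0\<close>, which makes lost keys harmless.\<close>

lemma additive_sum_keys:
  fixes h :: "exponents \<Rightarrow> real \<Rightarrow> polynomial"
  assumes "\<And>\<nu> a b. h \<nu> (a + b) = h \<nu> a + h \<nu> b"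
  shows "additive (\<lambda>f. \<Sum>\<nu>\<in>Poly_Mapping.keys f. h \<nu> (coef f \<nu>))"
proof -
  have "h \<nu> 0 = 0" for \<nu>
    using assms[of \<nu> 0 0] by simp
  then show ?thesis
    by (intro additive.intro setsum_keys_plus_distrib) (simp_all add: assms)
qed

lemma sum_keys_term:
  fixes h :: "exponents \<Rightarrow> real \<Rightarrow> polynomial"
  assumes "h \<nu> 0 = 0"
  shows "(\<Sum>\<mu>\<in>Poly_Mapping.keys (term_poly \<nu> c). h \<mu> (coef (term_poly \<nu> c) \<mu>)) = h \<nu> c"
  using assms by (simp add: term_poly_def)

lemma additive_mult_left: "additive (\<lambda>f::polynomial. g * f)"
  by (simp add: additive_def distrib_left)

lemma additive_compose: "additive F \<Longrightarrow> additive G \<Longrightarrow> additive (\<lambda>f. F (G f))"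
  by (simp add: additive_def)

lemma additive_plus: "additive F \<Longrightarrow> additive G \<Longrightarrow> additive (\<lambda>f. F f + G f)"
  by (simp add: additive_def)

lemma additive_sum: "(\<And>x. x \<in> A \<Longrightarrow> additive (F x)) \<Longrightarrow> additive (\<lambda>f. \<Sum>x\<in>A. F x f)"
  by (simp add: additive_def sum.distrib)

lemma additive_ident: "additive (\<lambda>f. f)"
  by (simp add: additive_def)

lemma const_poly_add: "const_poly (a + b) = const_poly a + const_poly b"
  by (simp add: const_poly_def term_poly_add)

lemma const_poly_mult: "const_poly (a * b) = const_poly a * const_poly b"
  by (simp add: const_poly_def term_poly_mult)

lemma const_poly_uminus: "const_poly (- a) = - const_poly a"
  by (simp add: const_poly_def term_poly_uminus)

lemma const_poly_diff: "const_poly (a - b) = const_poly a - const_poly b"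
  using const_poly_add[of a "- b"] by (simp add: const_poly_uminus)

lemma const_poly_0 [simp]: "const_poly 0 = 0"
  by (simp add: const_poly_def)

lemma const_poly_1 [simp]: "const_poly 1 = 1"
  by (simp add: const_poly_def term_poly_def)

lemma const_poly_term: "const_poly a * term_poly \<nu> b = term_poly \<nu> (a * b)"
  by (simp add: const_poly_def term_poly_mult)

lemma coef_const_mult [simp]: "coef (const_poly a * f) \<nu> = a * coef f \<nu>"
  by (induction f rule: polynomial_induct)
     (simp_all add: distrib_left lookup_add const_poly_term coef_term_poly)

lemma zvar_mult_term: "zvar i * term_poly \<nu> c = term_poly (\<nu> + esingle i 1) c"
  by (simp add: zvar_def term_poly_mult add.commute)

lemma additive_perm_poly: "additive (perm_poly w)"
  unfolding perm_poly_def by (rule additive_sum_keys) (rule term_poly_add)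

lemmas perm_poly_add = additive.add[OF additive_perm_poly]
lemmas perm_poly_diff = additive.diff[OF additive_perm_poly]
lemmas perm_poly_0 [simp] = additive.zero[OF additive_perm_poly]
lemmas perm_poly_sum = additive.sum[OF additive_perm_poly]

lemma perm_poly_term [simp]: "perm_poly w (term_poly \<nu> c) = term_poly (perm_exp w \<nu>) c"
  unfolding perm_poly_def by (rule sum_keys_term) simp

lemma perm_poly_mult:
  assumes "bij w"
  shows "perm_poly w (f * g) = perm_poly w f * perm_poly w g"
proof (induction f rule: polynomial_induct)
  case (add f \<nu> c)
  have "perm_poly w (term_poly \<nu> c * g) = perm_poly w (term_poly \<nu> c) * perm_poly w g"
    by (induction g rule: polynomial_induct)
       (simp_all add: distrib_left perm_poly_add term_poly_mult perm_exp_add assms)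
  then show ?case by (simp add: distrib_right perm_poly_add add)
qed simp

lemma perm_poly_const [simp]: "bij w \<Longrightarrow> perm_poly w (const_poly c) = const_poly c"
  unfolding const_poly_def perm_poly_term
  by (simp add: perm_exp_def bij_imp_bij_inv bij_is_inj)

lemma perm_poly_zvar [simp]: "bij w \<Longrightarrow> perm_poly w (zvar i) = zvar (w i)"
  by (simp add: zvar_def perm_exp_single)

lemma perm_poly_comp: "bij v \<Longrightarrow> bij w \<Longrightarrow> perm_poly v (perm_poly w f) = perm_poly (v \<circ> w) f"
  by (rule additive_eqI[OF additive_compose[OF additive_perm_poly additive_perm_poly] additive_perm_poly])
     (simp add: perm_exp_comp)

lemma perm_poly_id [simp]: "perm_poly id f = f"
  by (rule additive_eqI[OF additive_perm_poly additive_ident]) simp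

lemma coef_perm_poly:
  assumes "bij w"
  shows "coef (perm_poly w f) \<nu> = coef f (perm_exp (inv' w) \<nu>)"
  by (induction f rule: polynomial_induct)
     (auto simp: perm_poly_add lookup_add coef_term_poly perm_exp_inv_cancel perm_exp_cancel_inv assms)

text \<open>Unlike \<open>partial_deriv\<close>, this degree operator is diagonal on monomials; the
  truncated subtraction of exponents matters only once, in \<open>euler_term\<close>.\<close>

definition euler :: "nat \<Rightarrow> polynomial \<Rightarrow> polynomial" where
  "euler i f = zvar i * partial_deriv i f"

lemma additive_partial_deriv: "additive (partial_deriv i)"
  unfolding partial_deriv_def
  by (rule additive_sum_keys) (simp add: distrib_left term_poly_add)

lemma additive_euler: "additive (euler i)"
  unfolding euler_def by (intro additive_compose[OF additive_mult_left] additive_partial_deriv)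

lemma euler_term: "euler i (term_poly \<nu> c) = term_poly \<nu> (real (part \<nu> i) * c)"
proof -
  have "partial_deriv i (term_poly \<nu> c) = term_poly (\<nu> - esingle i 1) (real (part \<nu> i) * c)"
    unfolding partial_deriv_def by (rule sum_keys_term) simp
  moreover have "\<nu> - esingle i 1 + esingle i 1 = \<nu>" if "part \<nu> i \<noteq> 0"
    using that by (intro poly_mapping_eqI) (auto simp: lookup_add lookup_minus lookup_single when_def)
  ultimately show ?thesis
    by (cases "part \<nu> i = 0") (simp_all add: euler_def zvar_mult_term)
qed

lemma coef_euler: "coef (euler i f) \<nu> = real (part \<nu> i) * coef f \<nu>"
  by (induction f rule: polynomial_induct)
     (simp_all add: additive.zero[OF additive_euler] additive.add[OF additive_euler] lookup_add
        euler_term coef_term_poly distrib_left)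

lemma euler_perm: "bij w \<Longrightarrow> euler (w i) (perm_poly w f) = perm_poly w (euler i f)"
  by (rule poly_mapping_eqI)
     (simp add: coef_euler coef_perm_poly part_perm_exp bij_imp_bij_inv inv_inv_eq)

lemma euler_zvar_mult: "euler i (zvar j * f) = zvar j * (euler i f + (if i = j then f else 0))"
proof (induction f rule: polynomial_induct)
  case (add f \<nu> c)
  have "euler i (zvar j * term_poly \<nu> c) =
      zvar j * (euler i (term_poly \<nu> c) + (if i = j then term_poly \<nu> c else 0))"
    by (simp add: zvar_mult_term euler_term lookup_add lookup_single when_def distrib_left
        distrib_right term_poly_add)
  with add show ?case
    by (simp add: additive.add[OF additive_euler] distrib_left)
qed (simp add: additive.zero[OF additive_euler])

lemma zvar_eq_iff [simp]: "zvar i = zvar j \<longleftrightarrow> i = j"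
proof
  assume "zvar i = zvar j"
  then have "coef (zvar i) (esingle i 1) = coef (zvar j) (esingle i 1)" by simp
  then have "esingle i 1 = esingle j (1::nat)"
    by (auto simp: zvar_def coef_term_poly split: if_splits)
  then have "part (esingle i 1) i = part (esingle j 1) i" by simp
  then show "i = j" by (auto simp: lookup_single when_def split: if_splits)
qed simp

section \<open>Divided differences\<close>

lemma exact_quot_eq: "g \<noteq> 0 \<Longrightarrow> q * g = f \<Longrightarrow> exact_quot f g = q"
  unfolding exact_quot_def by (rule the_equality) auto

text \<open>The prefactors z_i and z_p of the Cherednik operator are kept outside the quotient, so
  that both of its sums use the same divided difference.\<close>

definition divdiff :: "nat \<Rightarrow> nat \<Rightarrow> polynomial \<Rightarrow> polynomial" where
  "divdiff i p f = exact_quot (f - perm_poly (transpose i p) f) (zvar i - zvar p)"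

text \<open>Splitting off the exponents at i and p reduces questions about one transposition to
  monomials in two variables times a fixed factor.\<close>

lemma swap_exp_decomp:
  fixes \<nu> :: exponents
  assumes "i \<noteq> p"
  obtains \<rho> where "\<nu> = \<rho> + esingle i (part \<nu> i) + esingle p (part \<nu> p)"
    "\<And>x y. perm_exp (transpose i p) (\<rho> + esingle i x + esingle p y) = \<rho> + esingle i y + esingle p x"
    "part \<rho> i = 0" "part \<rho> p = 0"
proof
  define \<rho> where "\<rho> = \<nu> - esingle i (part \<nu> i) - esingle p (part \<nu> p)"
  have *: "part \<rho> k = (if k = i \<or> k = p then 0 else part \<nu> k)" for k
    by (auto simp: \<rho>_def lookup_minus lookup_single when_def)
  show "\<nu> = \<rho> + esingle i (part \<nu> i) + esingle p (part \<nu> p)"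
    using assms by (intro poly_mapping_eqI) (auto simp: lookup_add * lookup_single when_def)
  show "perm_exp (transpose i p) (\<rho> + esingle i x + esingle p y) = \<rho> + esingle i y + esingle p x" for x y
    using assms by (intro poly_mapping_eqI)
      (auto simp: lookup_add * lookup_single when_def part_perm_exp transpose_def)
  show "part \<rho> i = 0" "part \<rho> p = 0" by (simp_all add: *)
qed

definition mono2 :: "exponents \<Rightarrow> nat \<Rightarrow> nat \<Rightarrow> nat \<Rightarrow> nat \<Rightarrow> polynomial" where
  "mono2 \<rho> i p x y = term_poly (\<rho> + esingle i x + esingle p y) 1"

lemma mono2_zvar:
  "mono2 \<rho> i p x y * zvar i = mono2 \<rho> i p (Suc x) y"
  "mono2 \<rho> i p x y * zvar p = mono2 \<rho> i p x (Suc y)"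
proof -
  have "\<rho> + esingle i x + esingle p y + esingle i 1 = \<rho> + esingle i (Suc x) + esingle p y"
    "\<rho> + esingle i x + esingle p y + esingle p 1 = \<rho> + esingle i x + esingle p (Suc y)"
    by (intro poly_mapping_eqI; auto simp: lookup_add lookup_single when_def)+
  then show "mono2 \<rho> i p x y * zvar i = mono2 \<rho> i p (Suc x) y"
    "mono2 \<rho> i p x y * zvar p = mono2 \<rho> i p x (Suc y)"
    by (simp_all add: mono2_def mult.commute[of _ "zvar _"] zvar_mult_term)
qed

text \<open>The finite geometric sum for (x^a y^b - x^b y^a) / (x - y): multiplying by x and by y
  gives neighbouring terms, so the product telescopes.\<close>

lemma mono2_quot:
  assumes "b \<le> a"
  shows "(\<Sum>k<a - b. mono2 \<rho> i p (a - Suc k) (b + k)) * (zvar i - zvar p) =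
    mono2 \<rho> i p a b - mono2 \<rho> i p b a"
proof -
  have "(\<Sum>k<a - b. mono2 \<rho> i p (a - Suc k) (b + k)) * (zvar i - zvar p) =
      (\<Sum>k<a - b. mono2 \<rho> i p (a - k) (b + k) - mono2 \<rho> i p (a - Suc k) (b + Suc k))"
    unfolding sum_distrib_right
    by (rule sum.cong) (auto simp: Suc_diff_Suc right_diff_distrib mono2_zvar)
  also have "\<dots> = mono2 \<rho> i p a b - mono2 \<rho> i p b a"
    using assms by (subst sum_lessThan_telescope') simp
  finally show ?thesis .
qed

lemma divdiff_exists:
  assumes "i \<noteq> p"
  shows "\<exists>q. q * (zvar i - zvar p) = f - perm_poly (transpose i p) f"
proof (induction f rule: polynomial_induct)
  case (add f \<nu> c)
  then obtain q where q: "q * (zvar i - zvar p) = f - perm_poly (transpose i p) f" by blast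
  obtain \<rho> where \<rho>: "\<nu> = \<rho> + esingle i (part \<nu> i) + esingle p (part \<nu> p)"
    "\<And>x y. perm_exp (transpose i p) (\<rho> + esingle i x + esingle p y) = \<rho> + esingle i y + esingle p x"
    using swap_exp_decomp[OF assms] by metis
  have m: "term_poly \<nu> 1 = mono2 \<rho> i p (part \<nu> i) (part \<nu> p)"
    using \<rho>(1) by (simp add: mono2_def)
  have m': "term_poly (perm_exp (transpose i p) \<nu>) 1 = mono2 \<rho> i p (part \<nu> p) (part \<nu> i)"
    by (subst \<rho>(1), subst \<rho>(2)) (simp add: mono2_def)
  have "\<exists>r. r * (zvar i - zvar p) = term_poly \<nu> 1 - term_poly (perm_exp (transpose i p) \<nu>) 1"
  proof (cases "part \<nu> p \<le> part \<nu> i")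
    case True
    then show ?thesis unfolding m m' using mono2_quot by blast
  next
    case False
    then have "part \<nu> i \<le> part \<nu> p" by simp
    then have "(- (\<Sum>k<part \<nu> p - part \<nu> i. mono2 \<rho> i p (part \<nu> p - Suc k) (part \<nu> i + k))) *
        (zvar i - zvar p) = term_poly \<nu> 1 - term_poly (perm_exp (transpose i p) \<nu>) 1"
      unfolding m m' mult_minus_left by (subst mono2_quot) simp_all
    then show ?thesis by blast
  qed
  then obtain r where r: "r * (zvar i - zvar p) = term_poly \<nu> 1 - term_poly (perm_exp (transpose i p) \<nu>) 1"
    by blast
  have "(q + const_poly c * r) * (zvar i - zvar p) =
      (f - perm_poly (transpose i p) f) + const_poly c * (term_poly \<nu> 1 - term_poly (perm_exp (transpose i p) \<nu>) 1)"
    using q r by (simp add: distrib_right mult.assoc)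
  also have "\<dots> = f + term_poly \<nu> c - perm_poly (transpose i p) (f + term_poly \<nu> c)"
    by (simp add: perm_poly_add right_diff_distrib const_poly_term)
  finally show ?case by blast
qed (auto intro: exI[of _ 0])

lemma divdiff_mult:
  assumes "i \<noteq> p"
  shows "divdiff i p f * (zvar i - zvar p) = f - perm_poly (transpose i p) f"
proof -
  obtain q where "q * (zvar i - zvar p) = f - perm_poly (transpose i p) f"
    using divdiff_exists[OF assms] by blast
  then show ?thesis
    unfolding divdiff_def using assms by (subst exact_quot_eq) auto
qed

lemma divdiff_eqI:
  assumes "i \<noteq> p" "q * (zvar i - zvar p) = f - perm_poly (transpose i p) f"
  shows "divdiff i p f = q"
  unfolding divdiff_def using assms by (intro exact_quot_eq) auto

lemma additive_divdiff: "i \<noteq> p \<Longrightarrow> additive (divdiff i p)"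
  by (rule additive.intro, rule divdiff_eqI) (simp_all add: distrib_right divdiff_mult perm_poly_add)

lemma divdiff_const_mult: "i \<noteq> p \<Longrightarrow> divdiff i p (const_poly c * f) = const_poly c * divdiff i p f"
  by (rule divdiff_eqI) (simp_all only: mult.assoc divdiff_mult perm_poly_mult perm_poly_const
      right_diff_distrib[of "const_poly c"] bij_transpose not_False_eq_True)

lemma divdiff_perm:
  assumes "bij w" "i \<noteq> p"
  shows "divdiff (w i) (w p) (perm_poly w f) = perm_poly w (divdiff i p f)"
proof (rule divdiff_eqI)
  show "w i \<noteq> w p" using assms by (metis bij_def injD)
  have "transpose (w i) (w p) \<circ> w = w \<circ> transpose i p"
    using assms(1) by (auto simp: fun_eq_iff transpose_def bij_is_inj inj_eq)
  then have "perm_poly (transpose (w i) (w p)) (perm_poly w f) = perm_poly w (perm_poly (transpose i p) f)"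
    using assms by (simp add: perm_poly_comp)
  moreover have "perm_poly w (divdiff i p f) * (zvar (w i) - zvar (w p)) =
      perm_poly w (divdiff i p f * (zvar i - zvar p))"
    using assms by (simp add: perm_poly_mult perm_poly_diff)
  ultimately show "perm_poly w (divdiff i p f) * (zvar (w i) - zvar (w p)) =
      perm_poly w f - perm_poly (transpose (w i) (w p)) (perm_poly w f)"
    using assms by (simp add: divdiff_mult perm_poly_diff)
qed

lemma cherednik_alt:
  "cherednik N \<alpha> i f = const_poly \<alpha> * euler i f
     + (\<Sum>p\<in>{1..<i}. zvar i * divdiff i p f) + (\<Sum>p\<in>{i<..N}. zvar p * divdiff i p f)
     + const_poly (1 - real i) * f"
proof -
  have "exact_quot (zvar k * (f - perm_poly (transpose i p) f)) (zvar i - zvar p) = zvar k * divdiff i p f"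
    if "i \<noteq> p" for k p
    using that by (intro exact_quot_eq) (simp_all add: mult.assoc divdiff_mult)
  then show ?thesis
    by (simp add: cherednik_def euler_def mult.assoc)
qed

lemma additive_cherednik: "additive (cherednik N \<alpha> i)"
  unfolding cherednik_alt[abs_def]
  by (intro additive_plus additive_sum additive_compose[OF additive_mult_left] additive_euler
      additive_divdiff additive_ident) auto

lemma cherednik_const_mult: "cherednik N \<alpha> i (const_poly c * f) = const_poly c * cherednik N \<alpha> i f"
proof -
  have "euler i (const_poly c * f) = const_poly c * euler i f"
    by (rule poly_mapping_eqI) (simp add: coef_euler)
  then show ?thesis
    unfolding cherednik_alt
    by (simp add: divdiff_const_mult distrib_left sum_distrib_left mult.left_commute)
qed

section \<open>Relations between Cherednik operators, transpositions and raising\<close>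

text \<open>The two sums carry different prefactors, so \<open>w\<close> must preserve the indices
  below i and those above i separately; it then merely relabels the summands of each sum.\<close>

lemma cherednik_perm_fixed:
  assumes w: "w permutes {1..N}" and "w i = i" "w ` {1..<i} = {1..<i}" "w ` {i<..N} = {i<..N}"
  shows "cherednik N \<alpha> i (perm_poly w f) = perm_poly w (cherednik N \<alpha> i f)"
proof -
  have b: "bij w" using w by (rule permutes_bij)
  have inj: "inj_on w A" for A using b by (meson bij_is_inj inj_on_subset subset_UNIV)
  have d: "divdiff i (w p) (perm_poly w f) = perm_poly w (divdiff i p f)" if "i \<noteq> p" for p
    using divdiff_perm[OF b that, of f] assms(2) by simp
  have "(\<Sum>p\<in>{1..<i}. zvar i * divdiff i p (perm_poly w f)) =
      (\<Sum>p\<in>{1..<i}. zvar i * divdiff i (w p) (perm_poly w f))"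
    by (subst assms(3)[symmetric]) (simp add: sum.reindex inj)
  also have "\<dots> = perm_poly w (\<Sum>p\<in>{1..<i}. zvar i * divdiff i p f)"
    by (simp add: perm_poly_sum perm_poly_mult b assms(2) d)
  finally have 1: "(\<Sum>p\<in>{1..<i}. zvar i * divdiff i p (perm_poly w f)) = \<dots>" .
  have "(\<Sum>p\<in>{i<..N}. zvar p * divdiff i p (perm_poly w f)) =
      (\<Sum>p\<in>{i<..N}. zvar (w p) * divdiff i (w p) (perm_poly w f))"
    by (subst assms(4)[symmetric]) (simp add: sum.reindex inj)
  also have "\<dots> = perm_poly w (\<Sum>p\<in>{i<..N}. zvar p * divdiff i p f)"
    by (simp add: perm_poly_sum perm_poly_mult b d)
  finally have 2: "(\<Sum>p\<in>{i<..N}. zvar p * divdiff i p (perm_poly w f)) = \<dots>" .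
  have "euler i (perm_poly w f) = perm_poly w (euler i f)"
    using euler_perm[OF b, of i f] assms(2) by simp
  with 1 2 show ?thesis
    unfolding cherednik_alt by (simp add: perm_poly_add perm_poly_mult b)
qed

section \<open>Degenerate Hecke relations\<close>

lemma simple_transp_simps [simp]:
  "simple_transp k k = Suc k" "simple_transp k (Suc k) = k"
  "simple_transp k \<circ> simple_transp k = id" "bij (simple_transp k)"
  by (simp_all add: simple_transp_def)

lemma simple_transp_apply: "simple_transp k x = (if x = k then Suc k else if x = Suc k then k else x)"
  by (auto simp: simple_transp_def transpose_def)

lemma simple_transp_twice [simp]: "simple_transp k (simple_transp k x) = x"
  by (simp add: simple_transp_def)

lemma inv_simple_transp [simp]: "inv' (simple_transp k) = simple_transp k"
  by (rule inv_equality) simp_all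

lemma simple_transp_permutes: "1 \<le> k \<Longrightarrow> k < N \<Longrightarrow> simple_transp k permutes {1..N}"
  unfolding simple_transp_def by (rule permutes_swap_id) auto

lemma perm_poly_simple_transp_twice [simp]:
  "perm_poly (simple_transp k) (perm_poly (simple_transp k) f) = f"
  by (simp add: perm_poly_comp)

lemma cherednik_simple_other:
  assumes "1 \<le> k" "k < N" "i \<noteq> k" "i \<noteq> Suc k"
  shows "cherednik N \<alpha> i (perm_poly (simple_transp k) f) =
    perm_poly (simple_transp k) (cherednik N \<alpha> i f)"
proof -
  have im: "simple_transp k ` A = A" if "k \<in> A \<longleftrightarrow> Suc k \<in> A" for A
    unfolding simple_transp_def using that by (simp add: transpose_image_eq)
  show ?thesis
    using assms by (intro cherednik_perm_fixed im simple_transp_permutes) (auto simp: simple_transp_apply)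
qed

text \<open>Conjugation turns the summand p = k on the left of position k + 1 into a summand p = k +
  1 with prefactor z_k, where the operator at k has prefactor z_{k+1}. The difference of prefactors
  cancels the denominator and leaves f - s_k f, while the constants 1 - k and -k differ by a further
  s_k f.\<close>

lemma cherednik_simple_lower:
  assumes "1 \<le> k" "k < N"
  shows "cherednik N \<alpha> k (perm_poly (simple_transp k) f) =
    perm_poly (simple_transp k) (cherednik N \<alpha> (Suc k) f) + f"
proof -
  let ?s = "simple_transp k"
  let ?g = "perm_poly ?s f"
  have e: "perm_poly ?s (euler (Suc k) f) = euler k ?g"
    using euler_perm[of ?s "Suc k" f] by simp
  have d: "perm_poly ?s (divdiff (Suc k) p f) = divdiff k (?s p) ?g" if "p \<noteq> Suc k" for p
    using divdiff_perm[of ?s "Suc k" p f] that by simp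
  have "(\<Sum>p\<in>{1..<Suc k}. zvar (Suc k) * divdiff (Suc k) p f) =
      (\<Sum>p\<in>{1..<k}. zvar (Suc k) * divdiff (Suc k) p f) + zvar (Suc k) * divdiff (Suc k) k f"
    using assms by (simp add: atLeastLessThanSuc add.commute)
  then have l: "perm_poly ?s (\<Sum>p\<in>{1..<Suc k}. zvar (Suc k) * divdiff (Suc k) p f) =
      (\<Sum>p\<in>{1..<k}. zvar k * divdiff k p ?g) + zvar k * divdiff k (Suc k) ?g"
    using d[of k] d
    by (auto simp: perm_poly_add perm_poly_sum perm_poly_mult simple_transp_apply intro!: sum.cong)
  have r: "perm_poly ?s (\<Sum>p\<in>{Suc k<..N}. zvar p * divdiff (Suc k) p f) =
      (\<Sum>p\<in>{Suc k<..N}. zvar p * divdiff k p ?g)"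
    using d by (auto simp: perm_poly_add perm_poly_sum perm_poly_mult simple_transp_apply intro!: sum.cong)
  have "{k<..N} = insert (Suc k) {Suc k<..N}"
    using assms by auto
  then have r': "(\<Sum>p\<in>{k<..N}. zvar p * divdiff k p ?g) =
      zvar (Suc k) * divdiff k (Suc k) ?g + (\<Sum>p\<in>{Suc k<..N}. zvar p * divdiff k p ?g)"
    by simp
  have q: "divdiff k (Suc k) ?g * (zvar k - zvar (Suc k)) = ?g - f"
    by (subst divdiff_mult) (simp_all flip: Suc_eq_plus1 add: simple_transp_def perm_poly_comp)
  have c: "const_poly (1 - real k) = const_poly (1 - real (Suc k)) + 1"
    by (simp flip: const_poly_1 const_poly_add)
  have "cherednik N \<alpha> k ?g - perm_poly ?s (cherednik N \<alpha> (Suc k) f) =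
      ?g - divdiff k (Suc k) ?g * (zvar k - zvar (Suc k))"
    unfolding cherednik_alt perm_poly_add r l perm_poly_mult[OF simple_transp_simps(4)] e r'
      perm_poly_const[OF simple_transp_simps(4)] c
    by (simp add: algebra_simps)
  then show ?thesis unfolding q by (simp add: algebra_simps)
qed

lemma cherednik_simple_upper:
  assumes "1 \<le> k" "k < N"
  shows "cherednik N \<alpha> (Suc k) (perm_poly (simple_transp k) f) =
    perm_poly (simple_transp k) (cherednik N \<alpha> k f) - f"
  using cherednik_simple_lower[OF assms, of \<alpha> "perm_poly (simple_transp k) f"]
  by (simp add: perm_poly_add)

section \<open>The raising operator\<close>

text \<open>The bounds make it fix everything outside \<open>{1..N}\<close>, also for N = 0, so that
  \<open>cyc_permutes\<close> holds unconditionally.\<close>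

definition cyc :: "nat \<Rightarrow> nat \<Rightarrow> nat" where
  "cyc N i = (if i = 1 \<and> 1 \<le> N then N else if 1 < i \<and> i \<le> N then i - 1 else i)"

lemma cyc_permutes: "cyc N permutes {1..N}"
proof (rule bij_imp_permutes)
  show "bij_betw (cyc N) {1..N} {1..N}"
    by (rule bij_betw_byWitness[where f' = "\<lambda>i. if i = N then 1 else i + 1"]) (auto simp: cyc_def)
qed (auto simp: cyc_def)

lemma bij_cyc [simp]: "bij (cyc N)"
  using cyc_permutes by (rule permutes_bij)

definition raise_poly :: "nat \<Rightarrow> polynomial \<Rightarrow> polynomial" where
  "raise_poly N f = zvar N * perm_poly (cyc N) f"

text \<open>Shifting positions down by one sends the operator at i + 1 to the one at i, except that
  the summand p = 1 on the left becomes the summand p = N on the right. Only there does the factor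
  z_N interact with the divided difference.\<close>

lemma cherednik_raise_lower:
  assumes "1 \<le> i" "i < N"
  shows "cherednik N \<alpha> i (raise_poly N f) = raise_poly N (cherednik N \<alpha> (Suc i) f)"
proof -
  let ?g = "perm_poly (cyc N) f"
  have ci: "cyc N (Suc i) = i" using assms by (simp add: cyc_def)
  have d: "perm_poly (cyc N) (divdiff (Suc i) p f) = divdiff i (cyc N p) ?g" if "p \<noteq> Suc i" for p
    using divdiff_perm[of "cyc N" "Suc i" p f] that by (simp add: ci)
  have e: "perm_poly (cyc N) (euler (Suc i) f) = euler i ?g"
    using euler_perm[of "cyc N" "Suc i" f] by (simp add: ci)
  \<comment> \<open>The index 1 is split off because it is the one that the cycle sends to the other
    side of i.\<close>
  have im1: "{1..<Suc i} = insert 1 (Suc ` {1..<i})"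
    using assms by (auto simp: image_Suc_atLeastLessThan simp del: image_Suc_atLeastLessThan)
       (metis Suc_diff_1 Suc_le_eq atLeastLessThan_iff diff_is_0_eq image_eqI less_Suc_eq_le not_less_eq_eq not_gr0)
  have l: "perm_poly (cyc N) (\<Sum>p\<in>{1..<Suc i}. zvar (Suc i) * divdiff (Suc i) p f) =
      zvar i * divdiff i N ?g + (\<Sum>p\<in>{1..<i}. zvar i * divdiff i p ?g)"
  proof -
    have "perm_poly (cyc N) (\<Sum>p\<in>{1..<Suc i}. zvar (Suc i) * divdiff (Suc i) p f) =
        (\<Sum>p\<in>{1..<Suc i}. zvar i * divdiff i (cyc N p) ?g)"
      using d by (auto simp: perm_poly_sum perm_poly_mult ci simp del: sum.op_ivl_Suc intro!: sum.cong)
    also have "\<dots> = zvar i * divdiff i (cyc N 1) ?g + (\<Sum>p\<in>{1..<i}. zvar i * divdiff i (cyc N (Suc p)) ?g)"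
      unfolding im1 by (subst sum.insert) (auto simp: sum.reindex simp del: image_Suc_atLeastLessThan)
    also have "\<dots> = zvar i * divdiff i N ?g + (\<Sum>p\<in>{1..<i}. zvar i * divdiff i p ?g)"
      using assms by (auto simp: cyc_def intro!: sum.cong)
    finally show ?thesis .
  qed
  have r: "perm_poly (cyc N) (\<Sum>p\<in>{Suc i<..N}. zvar p * divdiff (Suc i) p f) =
      (\<Sum>p\<in>{i<..<N}. zvar p * divdiff i p ?g)"
  proof -
    have "perm_poly (cyc N) (\<Sum>p\<in>{Suc i<..N}. zvar p * divdiff (Suc i) p f) =
        (\<Sum>p\<in>{Suc i<..N}. zvar (cyc N p) * divdiff i (cyc N p) ?g)"
      using d by (auto simp: perm_poly_sum perm_poly_mult intro!: sum.cong)
    also have "\<dots> = (\<Sum>p\<in>{i<..<N}. zvar p * divdiff i p ?g)"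
      by (rule sum.reindex_bij_witness[of _ Suc "\<lambda>p. p - 1"]) (auto simp: cyc_def)
    finally show ?thesis .
  qed
  \<comment> \<open>The product rule leaves -g; multiplied by the prefactor z_N it makes up for the
    difference between the constants 1 - i and -i.\<close>
  have dN: "divdiff i N (zvar N * ?g) = zvar i * divdiff i N ?g - ?g"
  proof (rule divdiff_eqI)
    have "(zvar i * divdiff i N ?g - ?g) * (zvar i - zvar N) =
        zvar i * (divdiff i N ?g * (zvar i - zvar N)) - ?g * (zvar i - zvar N)"
      by (simp only: left_diff_distrib mult.assoc)
    also have "\<dots> = zvar N * ?g - perm_poly (transpose i N) (zvar N * ?g)"
      using assms by (simp add: divdiff_mult perm_poly_mult) (simp add: algebra_simps)
    finally show "(zvar i * divdiff i N ?g - ?g) * (zvar i - zvar N) = \<dots>" .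
  qed (use assms in simp)
  have dp: "divdiff i p (zvar N * ?g) = zvar N * divdiff i p ?g" if "p \<noteq> i" "p \<noteq> N" for p
    using that assms by (intro divdiff_eqI)
      (simp_all add: mult.assoc divdiff_mult perm_poly_mult transpose_def right_diff_distrib[of "zvar N" ?g])
  have "{i<..N} = insert N {i<..<N}" using assms by auto
  then have r': "(\<Sum>p\<in>{i<..N}. zvar p * divdiff i p (zvar N * ?g)) =
      zvar N * (zvar i * divdiff i N ?g - ?g) + zvar N * (\<Sum>p\<in>{i<..<N}. zvar p * divdiff i p ?g)"
    using dp dN by (auto simp: sum_distrib_left mult.left_commute[of "zvar N"] intro!: sum.cong)
  have l': "(\<Sum>p\<in>{1..<i}. zvar i * divdiff i p (zvar N * ?g)) =
      zvar N * (\<Sum>p\<in>{1..<i}. zvar i * divdiff i p ?g)"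
    using dp assms by (auto simp: sum_distrib_left mult.left_commute[of "zvar N"] intro!: sum.cong)
  have e': "euler i (zvar N * ?g) = zvar N * euler i ?g"
    using assms by (simp add: euler_zvar_mult)
  have c: "const_poly (1 - real i) = const_poly (1 - real (Suc i)) + 1"
    by (simp flip: const_poly_1 const_poly_add)
  show ?thesis
    unfolding raise_poly_def cherednik_alt perm_poly_add r l r' l' perm_poly_mult[OF bij_cyc] e e'
      perm_poly_const[OF bij_cyc] c
    by (simp add: algebra_simps)
qed

text \<open>All N - 1 summands change from the right side of position 1 to the left side of position
  N. The product rule yields one extra g for each of them, which together cancel the constant 1 - N;
  the Euler operator counts the new factor z_N and contributes \<alpha>.\<close>

lemma cherednik_raise_top:
  assumes "1 \<le> N"
  shows "cherednik N \<alpha> N (raise_poly N f) = raise_poly N (cherednik N \<alpha> 1 f + const_poly \<alpha> * f)"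
proof -
  let ?g = "perm_poly (cyc N) f"
  have c1: "cyc N 1 = N" using assms by (simp add: cyc_def)
  have d: "perm_poly (cyc N) (divdiff 1 p f) = divdiff N (cyc N p) ?g" if "p \<noteq> 1" for p
    using divdiff_perm[of "cyc N" 1 p f] that c1 by simp
  have e: "perm_poly (cyc N) (euler 1 f) = euler N ?g"
    using euler_perm[of "cyc N" 1 f] c1 by simp
  have r: "perm_poly (cyc N) (\<Sum>p\<in>{1<..N}. zvar p * divdiff 1 p f) =
      (\<Sum>p\<in>{1..<N}. zvar p * divdiff N p ?g)"
  proof -
    have "perm_poly (cyc N) (\<Sum>p\<in>{1<..N}. zvar p * divdiff 1 p f) =
        (\<Sum>p\<in>{1<..N}. zvar (cyc N p) * divdiff N (cyc N p) ?g)"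
      using d by (auto simp: perm_poly_sum perm_poly_mult intro!: sum.cong)
    also have "\<dots> = (\<Sum>p\<in>{1..<N}. zvar p * divdiff N p ?g)"
      by (rule sum.reindex_bij_witness[of _ Suc "\<lambda>p. p - 1"]) (auto simp: cyc_def)
    finally show ?thesis .
  qed
  have dp: "divdiff N p (zvar N * ?g) = zvar p * divdiff N p ?g + ?g" if "p \<noteq> N" for p
  proof (rule divdiff_eqI)
    have "(zvar p * divdiff N p ?g + ?g) * (zvar N - zvar p) =
        zvar p * (divdiff N p ?g * (zvar N - zvar p)) + ?g * (zvar N - zvar p)"
      by (simp only: distrib_right mult.assoc)
    also have "\<dots> = zvar N * ?g - perm_poly (transpose N p) (zvar N * ?g)"
      using that by (simp add: divdiff_mult perm_poly_mult) (simp add: algebra_simps)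
    finally show "(zvar p * divdiff N p ?g + ?g) * (zvar N - zvar p) = \<dots>" .
  qed (use that in simp)
  have l: "(\<Sum>p\<in>{1..<N}. zvar N * divdiff N p (zvar N * ?g)) =
      zvar N * (\<Sum>p\<in>{1..<N}. zvar p * divdiff N p ?g) + const_poly (real N - 1) * (zvar N * ?g)"
  proof -
    have "(\<Sum>p\<in>{1..<N}. zvar N * divdiff N p (zvar N * ?g)) =
        (\<Sum>p\<in>{1..<N}. zvar N * (zvar p * divdiff N p ?g) + zvar N * ?g)"
      by (rule sum.cong) (auto simp: dp distrib_left)
    moreover have "of_nat (N - 1) = const_poly (real N - 1)"
    proof -
      have "of_nat n = const_poly (real n)" for n
        by (induction n) (simp_all add: const_poly_add)
      then show ?thesis using assms by (simp add: of_nat_diff)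
    qed
    ultimately show ?thesis by (simp add: sum.distrib sum_distrib_left)
  qed
  have c: "const_poly (1 - real N) = - const_poly (real N - 1)"
    by (simp flip: const_poly_uminus)
  show ?thesis
    unfolding raise_poly_def cherednik_alt perm_poly_add r l perm_poly_mult[OF bij_cyc] e c
      perm_poly_const[OF bij_cyc]
    by (simp add: euler_zvar_mult algebra_simps)
qed

section \<open>Triangularity\<close>

text \<open>Elements outside the intersection can be paired off, with c between the two values.
  Every comparison of partial sums below is an instance: sorting, a single swap, and the action of a
  parabolic subgroup.\<close>

lemma sum_le_threshold:
  fixes f :: "'a \<Rightarrow> 'b::linordered_semidom"
  assumes "finite S" "finite T" "card S = card T"
    and "\<And>x. x \<in> S - T \<Longrightarrow> f x \<le> c" "\<And>y. y \<in> T - S \<Longrightarrow> c \<le> f y"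
  shows "sum f S \<le> sum f T"
proof -
  have "card (S - T) = card (T - S)"
    using card_Int_Diff[OF assms(1), of T] card_Int_Diff[OF assms(2), of S] assms(3)
    by (simp add: Int_commute)
  then have "sum f (S - T) \<le> sum f (T - S)"
    using sum_bounded_above[of "S - T" f c] sum_bounded_below[of "T - S" c f] assms(4,5)
    by (metis order_trans)
  then show ?thesis
    using sum.Int_Diff[OF assms(1), of f T] sum.Int_Diff[OF assms(2), of f S]
    by (simp add: Int_commute)
qed

section \<open>Compositions and their sorted rearrangements\<close>

lemma part_outside: "\<eta> \<in> compositions N \<Longrightarrow> j \<notin> {1..N} \<Longrightarrow> part \<eta> j = 0"
  unfolding compositions_def by (auto simp: subset_iff in_keys_iff simp del: atLeastAtMost_iff)

lemma compositionsI: "(\<And>j. j \<notin> {1..N} \<Longrightarrow> part \<eta> j = 0) \<Longrightarrow> \<eta> \<in> compositions N"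
  unfolding compositions_def by (auto simp: in_keys_iff simp del: atLeastAtMost_iff)

lemma compositions_eqI:
  assumes "\<mu> \<in> compositions N" "\<nu> \<in> compositions N" "\<And>j. j \<in> {1..N} \<Longrightarrow> part \<mu> j = part \<nu> j"
  shows "\<mu> = \<nu>"
  using assms part_outside by (intro poly_mapping_eqI) metis

lemma perm_exp_compositions:
  assumes "w permutes {1..N}" "\<eta> \<in> compositions N"
  shows "perm_exp w \<eta> \<in> compositions N"
proof (rule compositionsI)
  fix j assume "j \<notin> {1..N}"
  then show "part (perm_exp w \<eta>) j = 0"
    using part_outside[OF assms(2)] permutes_not_in[OF permutes_inv[OF assms(1)]]
    by (simp add: part_perm_exp permutes_bij[OF assms(1)])
qed

lemma sum_perm_exp:
  assumes "w permutes {1..N}"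
  shows "(\<Sum>j=1..N. g (part (perm_exp w \<eta>) j)) = (\<Sum>j=1..N. g (part \<eta> j))"
proof -
  have "(\<Sum>j=1..N. g (part \<eta> j)) = (\<Sum>j=1..N. g (part \<eta> (inv' w j)))"
    by (rule sum.permute[OF permutes_inv[OF assms], unfolded o_def])
  then show ?thesis by (simp add: part_perm_exp permutes_bij[OF assms])
qed

lemma weight_perm_exp: "w permutes {1..N} \<Longrightarrow> weight N (perm_exp w \<eta>) = weight N \<eta>"
  unfolding weight_def using sum_perm_exp[where g = "\<lambda>x. x"] by simp

lemma part_sorted_desc:
  "part (sorted_desc N \<eta>) j =
    (if j \<in> {1..N} then rev (sort (map (part \<eta>) [1..<Suc N])) ! (j - 1) else 0)"
  unfolding sorted_desc_def lookup_sum by (simp add: lookup_single when_def)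

lemma sorted_desc_compositions: "sorted_desc N \<eta> \<in> compositions N"
  by (rule compositionsI) (simp only: part_sorted_desc if_False)

lemma sorted_desc_antimono:
  assumes "1 \<le> i" "i \<le> j" "j \<le> N"
  shows "part (sorted_desc N \<eta>) j \<le> part (sorted_desc N \<eta>) i"
  using assms by (auto simp: part_sorted_desc rev_nth simp del: upt_Suc intro!: sorted_nth_mono)

text \<open>Equality of multisets gives a permutation of list indices 0, ..., N - 1; the shift by
  one turns it into a permutation of positions.\<close>

lemma sorted_desc_bij:
  obtains \<pi> where "bij_betw \<pi> {1..N} {1..N}"
    "\<And>j. j \<in> {1..N} \<Longrightarrow> part (sorted_desc N \<eta>) j = part \<eta> (\<pi> j)"
proof -
  let ?xs = "map (part \<eta>) [1..<Suc N]"
  let ?ys = "rev (sort ?xs)"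
  have "mset ?ys = mset ?xs" by simp
  then obtain p where p: "p permutes {..<length ?xs}" "permute_list p ?xs = ?ys"
    by (rule mset_eq_permutation)
  have len: "length ?xs = N" by simp
  have pN: "p permutes {..<N}" using p(1) by (simp only: len)
  have pl: "p j < N" if "j < N" for j
    using permutes_in_image[OF pN, of j] that by simp
  define \<pi> where "\<pi> j = Suc (p (j - 1))" for j
  show ?thesis
  proof
    show "bij_betw \<pi> {1..N} {1..N}"
    proof (rule bij_betw_byWitness[where f' = "\<lambda>j. Suc (inv' p (j - 1))"])
      have "inv' p j < N" if "j < N" for j
        using permutes_in_image[OF permutes_inv[OF pN], of j] that by simp
      then show "\<pi> ` {1..N} \<subseteq> {1..N}" "(\<lambda>j. Suc (inv' p (j - 1))) ` {1..N} \<subseteq> {1..N}"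
        using pl by (auto simp: \<pi>_def Suc_le_eq)
    qed (auto simp: \<pi>_def permutes_inverses[OF pN])
    fix j assume j: "j \<in> {1..N}"
    then have "part (sorted_desc N \<eta>) j = ?ys ! (j - 1)"
      by (simp add: part_sorted_desc del: upt_Suc)
    also have "\<dots> = ?xs ! p (j - 1)"
      unfolding p(2)[symmetric] using j p(1) by (subst permute_list_nth) (auto simp del: upt_Suc)
    also have "\<dots> = part \<eta> (\<pi> j)"
      using pl[of "j - 1"] j by (auto simp: \<pi>_def simp del: upt_Suc)
    finally show "part (sorted_desc N \<eta>) j = part \<eta> (\<pi> j)" .
  qed
qed

lemma sorted_desc_perm_exp:
  assumes "w permutes {1..N}"
  shows "sorted_desc N (perm_exp w \<eta>) = sorted_desc N \<eta>"
proof -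
  have ms: "mset (map g [1..<Suc N]) = image_mset g (mset_set {1..N})" for g :: "nat \<Rightarrow> nat"
    by (simp del: upt_Suc add: atLeastLessThanSuc_atLeastAtMost)
  have "image_mset (part (perm_exp w \<eta>)) (mset_set {1..N}) =
      image_mset (part \<eta>) (image_mset (inv' w) (mset_set {1..N}))"
    by (simp add: multiset.map_comp part_perm_exp permutes_bij[OF assms] o_def)
  also have "image_mset (inv' w) (mset_set {1..N}) = mset_set {1..N}"
    using permutes_inv[OF assms] by (rule permutes_image_mset)
  finally have "mset (map (part (perm_exp w \<eta>)) [1..<Suc N]) = mset (map (part \<eta>) [1..<Suc N])"
    by (simp only: ms)
  then have "sort (map (part (perm_exp w \<eta>)) [1..<Suc N]) = sort (map (part \<eta>) [1..<Suc N])"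
    by (intro properties_for_sort) simp_all
  then show ?thesis unfolding sorted_desc_def by (simp only:)
qed

lemma sum_sorted_desc: "(\<Sum>j=1..N. g (part (sorted_desc N \<eta>) j)) = (\<Sum>j=1..N. g (part \<eta> j))"
proof -
  obtain \<pi> where \<pi>: "bij_betw \<pi> {1..N} {1..N}"
    "\<And>j. j \<in> {1..N} \<Longrightarrow> part (sorted_desc N \<eta>) j = part \<eta> (\<pi> j)"
    using sorted_desc_bij[of N \<eta>] by metis
  have "(\<Sum>j=1..N. g (part (sorted_desc N \<eta>) j)) = (\<Sum>j=1..N. g (part \<eta> (\<pi> j)))"
    using \<pi>(2) by simp
  also have "\<dots> = (\<Sum>j=1..N. g (part \<eta> j))"
    by (rule sum.reindex_bij_betw[OF \<pi>(1)])
  finally show ?thesis .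
qed

text \<open>Pulled back along the sorting bijection, T becomes a set of as many positions of the
  sorted vector; the threshold is its entry at position \<open>card T\<close>.\<close>

lemma sum_subset_le_sorted_desc:
  assumes "T \<subseteq> {1..N}"
  shows "(\<Sum>j\<in>T. part \<eta> j) \<le> (\<Sum>j=1..card T. part (sorted_desc N \<eta>) j)"
proof -
  obtain \<pi> where \<pi>: "bij_betw \<pi> {1..N} {1..N}"
    "\<And>j. j \<in> {1..N} \<Longrightarrow> part (sorted_desc N \<eta>) j = part \<eta> (\<pi> j)"
    using sorted_desc_bij[of N \<eta>] by metis
  define S where "S = {j\<in>{1..N}. \<pi> j \<in> T}"
  have bS: "bij_betw \<pi> S T"
  proof (rule bij_betw_imageI)
    show "inj_on \<pi> S"
      using \<pi>(1) unfolding bij_betw_def S_def by (auto intro: inj_on_subset)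
    show "\<pi> ` S = T"
    proof (intro equalityI subsetI)
      fix y assume "y \<in> T"
      moreover from this have "y \<in> \<pi> ` {1..N}"
        using assms bij_betw_imp_surj_on[OF \<pi>(1)] by (simp only: subsetD)
      ultimately show "y \<in> \<pi> ` S" by (auto simp: S_def)
    qed (auto simp: S_def)
  qed
  have cS: "card S = card T" using bij_betw_same_card[OF bS] .
  have cT: "card T \<le> N" using card_mono[OF _ assms] by simp
  have "(\<Sum>j\<in>T. part \<eta> j) = (\<Sum>j\<in>S. part \<eta> (\<pi> j))"
    by (rule sum.reindex_bij_betw[OF bS, symmetric])
  also have "\<dots> = (\<Sum>j\<in>S. part (sorted_desc N \<eta>) j)"
    using \<pi>(2) by (auto simp: S_def intro!: sum.cong)
  also have "\<dots> \<le> (\<Sum>j=1..card T. part (sorted_desc N \<eta>) j)"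
  proof (cases "card T = 0")
    case True
    then have "S = {}" using cS by (simp add: S_def)
    then show ?thesis by simp
  next
    case False
    have card: "card S = card {1..card T}" by (simp add: cS)
    show ?thesis
      by (rule sum_le_threshold[OF _ _ card, where c = "part (sorted_desc N \<eta>) (card T)"])
         (use False cT in \<open>auto simp: S_def intro!: sorted_desc_antimono\<close>)
  qed
  finally show ?thesis .
qed

section \<open>The orders on compositions\<close>

lemma dom_less_antisym:
  assumes "dom_less N \<mu> \<nu>" "dom_less N \<nu> \<mu>" "\<mu> \<in> compositions N" "\<nu> \<in> compositions N"
  shows False
proof -
  have eq: "(\<Sum>j=1..p. part \<mu> j) = (\<Sum>j=1..p. part \<nu> j)" if "p \<le> N" for p
    using that assms(1,2) unfolding dom_less_def by (cases "p = 0") (auto intro!: antisym)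
  have "part \<mu> j = part \<nu> j" if j: "j \<in> {1..N}" for j
  proof -
    obtain k where k: "j = Suc k" using j by (cases j) auto
    show ?thesis using eq[of k] eq[of j] j by (simp add: k)
  qed
  then have "\<mu> = \<nu>" by (rule compositions_eqI[OF assms(3,4)])
  then show False using assms(1) by (simp add: dom_less_def)
qed

lemma dom_less_trans:
  assumes "dom_less N \<mu> \<nu>" "dom_less N \<nu> \<kappa>" "\<mu> \<in> compositions N" "\<nu> \<in> compositions N"
  shows "dom_less N \<mu> \<kappa>"
proof -
  have "\<mu> \<noteq> \<kappa>" using dom_less_antisym assms by blast
  moreover have "(\<Sum>j=1..p. part \<mu> j) \<le> (\<Sum>j=1..p. part \<kappa> j)" if "p \<in> {1..N}" for p
    using assms(1,2) that unfolding dom_less_def by (meson order_trans)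
  ultimately show ?thesis using assms(1,2) unfolding dom_less_def by simp
qed

lemma prec_trans:
  assumes "prec N \<mu> \<nu>" "prec N \<nu> \<kappa>" "\<mu> \<in> compositions N" "\<nu> \<in> compositions N"
  shows "prec N \<mu> \<kappa>"
proof -
  note c = sorted_desc_compositions
  consider "dom_less N (sorted_desc N \<mu>) (sorted_desc N \<kappa>)"
    | "sorted_desc N \<mu> = sorted_desc N \<kappa>" "dom_less N \<mu> \<kappa>"
    using assms dom_less_trans[of N "sorted_desc N \<mu>" "sorted_desc N \<nu>" "sorted_desc N \<kappa>", OF _ _ c c]
      dom_less_trans[of N \<mu> \<nu> \<kappa>]
    unfolding prec_def by metis
  then show ?thesis
    using assms(1,2) unfolding prec_def by cases (auto simp: dom_less_def)
qed

lemma not_prec_self: "\<not> prec N \<mu> \<mu>"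
  by (simp add: prec_def)

text \<open>Replacing two entries by a strictly more balanced pair with the same sum lowers the
  sorted partition, so the first clause of the order applies whatever the positions i and p
  are.\<close>

lemma prec_between:
  assumes "i \<in> {1..N}" "p \<in> {1..N}" "i \<noteq> p"
    and same: "\<And>k. k \<noteq> i \<Longrightarrow> k \<noteq> p \<Longrightarrow> part \<nu> k = part \<eta> k"
    and sum: "part \<nu> i + part \<nu> p = part \<eta> i + part \<eta> p"
    and less: "part \<nu> i < max (part \<eta> i) (part \<eta> p)" "part \<nu> p < max (part \<eta> i) (part \<eta> p)"
  shows "prec N \<nu> \<eta>"
proof -
  let ?R = "{1..N} - {i, p}"
  have split: "(\<Sum>j=1..N. g j) = g i + g p + (\<Sum>j\<in>?R. g j)" for g :: "nat \<Rightarrow> nat"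
    using assms(1-3) sum.subset_diff[of "{i, p}" "{1..N}" g] by simp
  have R: "(\<Sum>j\<in>?R. g (part \<nu> j)) = (\<Sum>j\<in>?R. g (part \<eta> j))" for g :: "nat \<Rightarrow> nat"
    using same by (intro sum.cong) auto
  have wt: "weight N \<nu> = weight N \<eta>"
    unfolding weight_def using split[of "part \<nu>"] split[of "part \<eta>"] R[of "\<lambda>x. x"] sum by simp
  \<comment> \<open>The difference of the two sides is 2 (a - x) (a - y).\<close>
  have sq: "x * x + y * y < a * a + b * b" if xy: "x + y = a + b" "x < a" "y < a" for x y a b :: nat
  proof -
    obtain d where d: "a = Suc (x + d)" using less_imp_Suc_add[OF xy(2)] by blast
    obtain e where e: "a = Suc (y + e)" using less_imp_Suc_add[OF xy(3)] by blast
    have "y = b + Suc d" "x = b + Suc e" using xy(1) d e by auto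
    then show ?thesis using d by (simp add: algebra_simps)
  qed
  have "part \<nu> i * part \<nu> i + part \<nu> p * part \<nu> p < part \<eta> i * part \<eta> i + part \<eta> p * part \<eta> p"
  proof (cases "part \<eta> p \<le> part \<eta> i")
    case True then show ?thesis using sq[OF sum] less by (simp add: max_def)
  next
    case False then show ?thesis using sq[of "part \<nu> i" "part \<nu> p" "part \<eta> p" "part \<eta> i"] less sum by (simp add: max_def)
  qed
  then have "(\<Sum>j=1..N. part \<nu> j * part \<nu> j) < (\<Sum>j=1..N. part \<eta> j * part \<eta> j)"
    using split[of "\<lambda>j. part \<nu> j * part \<nu> j"] split[of "\<lambda>j. part \<eta> j * part \<eta> j"] R[of "\<lambda>x. x * x"]
    by simp
  \<comment> \<open>The sum of squares does not depend on the arrangement, so its strict decrease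
    distinguishes the two partitions.\<close>
  then have ne: "sorted_desc N \<nu> \<noteq> sorted_desc N \<eta>"
    using sum_sorted_desc[of "\<lambda>x. x * x" N \<nu>] sum_sorted_desc[of "\<lambda>x. x * x" N \<eta>] by auto
  \<comment> \<open>A partial sum of the sorted vector is a maximum over sets of positions. It is
    enough to match each set with one of equal size; a set meeting i, p in one point is changed to
    contain the position \<open>m\<close> of the larger entry instead.\<close>
  have top: "\<exists>T'. T' \<subseteq> {1..N} \<and> card T' = card T \<and> (\<Sum>j\<in>T. part \<nu> j) \<le> (\<Sum>j\<in>T'. part \<eta> j)"
    if T: "T \<subseteq> {1..N}" for T
  proof -
    have fin: "finite T" using T finite_subset by blast
    define m where "m = (if part \<eta> p \<le> part \<eta> i then i else p)"
    have m: "part \<eta> m = max (part \<eta> i) (part \<eta> p)" "m \<in> {1..N}"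
      using assms(1,2) by (auto simp: m_def)
    have rest: "(\<Sum>j\<in>T - {i, p}. part \<nu> j) = (\<Sum>j\<in>T - {i, p}. part \<eta> j)"
      using same by (intro sum.cong) auto
    consider "i \<in> T" "p \<in> T" | "i \<notin> T" "p \<notin> T" | q where "q \<in> {i, p}" "T \<inter> {i, p} = {q}"
      by blast
    then show ?thesis
    proof cases
      case 1
      then have "T = insert i (insert p (T - {i, p}))" by auto
      then have "(\<Sum>j\<in>T. g j) = g i + g p + (\<Sum>j\<in>T - {i, p}. g j)" for g :: "nat \<Rightarrow> nat"
        using fin assms(3) sum.subset_diff[of "{i, p}" T g] 1 by simp
      then show ?thesis using T rest sum by (metis order_refl)
    next
      case 2
      then have "T - {i, p} = T" by auto
      then show ?thesis using T rest by (metis order_refl)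
    next
      case (3 q)
      let ?T' = "insert m (T - {i, p})"
      have Tq: "T = insert q (T - {i, p})" using 3 by auto
      have mi: "m \<in> {i, p}" by (auto simp: m_def)
      have "card ?T' = Suc (card (T - {i, p}))" "card (insert q (T - {i, p})) = Suc (card (T - {i, p}))"
        using fin mi 3 by (auto simp: card_insert_if simp del: card_Diff_insert)
      then have "card ?T' = card T" using Tq by simp
      moreover have "(\<Sum>j\<in>T. part \<nu> j) = part \<nu> q + (\<Sum>j\<in>T - {i, p}. part \<nu> j)"
        using fin 3 by (subst Tq, subst sum.insert) auto
      moreover have "(\<Sum>j\<in>?T'. part \<eta> j) = part \<eta> m + (\<Sum>j\<in>T - {i, p}. part \<eta> j)"
        using fin mi by (subst sum.insert) auto
      moreover have "part \<nu> q \<le> part \<eta> m" using 3 less m by auto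
      ultimately show ?thesis using T m rest by (intro exI[of _ ?T']) auto
    qed
  qed
  obtain \<pi> where \<pi>: "bij_betw \<pi> {1..N} {1..N}"
    "\<And>j. j \<in> {1..N} \<Longrightarrow> part (sorted_desc N \<nu>) j = part \<nu> (\<pi> j)"
    using sorted_desc_bij[of N \<nu>] by metis
  have "(\<Sum>j=1..q. part (sorted_desc N \<nu>) j) \<le> (\<Sum>j=1..q. part (sorted_desc N \<eta>) j)"
    if q: "q \<in> {1..N}" for q
  proof -
    have sub: "{1..q} \<subseteq> {1..N}" using q by auto
    then have inj: "inj_on \<pi> {1..q}" using \<pi>(1) by (meson bij_betw_def inj_on_subset)
    have "\<pi> ` {1..q} \<subseteq> {1..N}" using \<pi>(1) sub unfolding bij_betw_def by blast
    from top[OF this] obtain T' where T': "T' \<subseteq> {1..N}" "card T' = q"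
      "(\<Sum>j\<in>\<pi> ` {1..q}. part \<nu> j) \<le> (\<Sum>j\<in>T'. part \<eta> j)"
      using card_image[OF inj] by auto
    have "(\<Sum>j=1..q. part (sorted_desc N \<nu>) j) = (\<Sum>j\<in>\<pi> ` {1..q}. part \<nu> j)"
      unfolding sum.reindex[OF inj] using \<pi>(2) sub by (intro sum.cong) auto
    also have "\<dots> \<le> (\<Sum>j\<in>T'. part \<eta> j)" by (rule T'(3))
    also have "\<dots> \<le> (\<Sum>j=1..q. part (sorted_desc N \<eta>) j)"
      using sum_subset_le_sorted_desc[OF T'(1), of \<eta>] T'(2) by simp
    finally show ?thesis .
  qed
  moreover have "weight N (sorted_desc N \<kappa>) = weight N \<kappa>" for \<kappa>
    unfolding weight_def using sum_sorted_desc[of "\<lambda>x. x"] .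
  ultimately have "dom_less N (sorted_desc N \<nu>) (sorted_desc N \<eta>)"
    using ne wt unfolding dom_less_def by auto
  then show ?thesis using ne wt unfolding prec_def by auto
qed

lemma transpose_permutes: "i \<in> {1..N} \<Longrightarrow> p \<in> {1..N} \<Longrightarrow> transpose i p permutes {1..N::nat}"
  by (rule permutes_swap_id)

text \<open>Moving the smaller entry to the left can only lower prefix sums and keeps the sorted
  partition, so the second clause of the order applies.\<close>

lemma prec_swap:
  assumes "1 \<le> i" "i < p" "p \<le> N" "part \<eta> p < part \<eta> i"
  shows "prec N (perm_exp (transpose i p) \<eta>) \<eta>"
proof -
  let ?s = "transpose i p"
  let ?\<nu> = "perm_exp ?s \<eta>"
  have s: "?s permutes {1..N}" using assms by (intro transpose_permutes) auto
  have "inv' ?s = ?s" by (rule inv_equality) simp_all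
  then have part: "part ?\<nu> j = part \<eta> (?s j)" for j by (simp add: part_perm_exp)
  have "part ?\<nu> i \<noteq> part \<eta> i" using assms by (simp add: part)
  then have ne: "?\<nu> \<noteq> \<eta>" by metis
  have "(\<Sum>j=1..q. part ?\<nu> j) \<le> (\<Sum>j=1..q. part \<eta> j)" for q
  proof -
    have inj: "inj_on ?s {1..q}" by (meson bij_is_inj bij_transpose inj_on_subset subset_UNIV)
    have "(\<Sum>j=1..q. part ?\<nu> j) = (\<Sum>j\<in>?s ` {1..q}. part \<eta> j)"
      by (subst sum.reindex[OF inj]) (simp add: part)
    also have "\<dots> \<le> (\<Sum>j=1..q. part \<eta> j)"
      by (rule sum_le_threshold[where c = "part \<eta> i", OF _ _ card_image[OF inj]])
         (use assms in \<open>auto simp: transpose_def image_iff split: if_splits\<close>)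
    finally show ?thesis .
  qed
  then show ?thesis
    using ne sorted_desc_perm_exp[OF s] weight_perm_exp[OF s] unfolding prec_def dom_less_def by auto
qed

section \<open>Leading terms of the Cherednik operators\<close>

definition lower :: "nat \<Rightarrow> exponents \<Rightarrow> polynomial \<Rightarrow> bool" where
  "lower N \<eta> f \<longleftrightarrow> Poly_Mapping.keys f \<subseteq> {\<nu> \<in> compositions N. prec N \<nu> \<eta>}"

lemma lower_0: "lower N \<eta> 0"
  by (simp add: lower_def)

lemma lower_add: "lower N \<eta> f \<Longrightarrow> lower N \<eta> g \<Longrightarrow> lower N \<eta> (f + g)"
  unfolding lower_def using Poly_Mapping.keys_add[of f g] by blast

lemma lower_minus: "lower N \<eta> f \<Longrightarrow> lower N \<eta> (- f)"
  unfolding lower_def by simp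

lemma lower_sum: "(\<And>x. x \<in> A \<Longrightarrow> lower N \<eta> (F x)) \<Longrightarrow> lower N \<eta> (sum F A)"
  by (induction A rule: infinite_finite_induct) (auto simp: lower_0 lower_add)

lemma lower_term: "\<nu> \<in> compositions N \<Longrightarrow> prec N \<nu> \<eta> \<Longrightarrow> lower N \<eta> (term_poly \<nu> c)"
  unfolding lower_def by (auto simp: in_keys_iff coef_term_poly split: if_splits)

text \<open>The monomials of a divided difference are of two kinds: balanced ones, smaller by
  \<open>prec_between\<close>, and the one with both exponents exchanged, which is smaller only if
  the exchange moves the smaller entry to the left.\<close>

lemma lower_mono2:
  assumes ip: "i \<in> {1..N}" "p \<in> {1..N}" "i \<noteq> p"
    and \<eta>: "\<eta> \<in> compositions N" "\<eta> = \<rho> + esingle i a + esingle p b" "part \<rho> i = 0" "part \<rho> p = 0"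
    and xy: "x + y = a + b"
      "x < max a b \<and> y < max a b \<or> x = b \<and> y = a \<and> (p < i \<and> a < b \<or> i < p \<and> b < a)"
  shows "lower N \<eta> (mono2 \<rho> i p x y)"
proof -
  let ?\<nu> = "\<rho> + esingle i x + esingle p y"
  have \<nu>: "part ?\<nu> k = (if k = i then x else if k = p then y else part \<eta> k)" for k
    using ip \<eta> by (auto simp: lookup_add lookup_single when_def)
  have \<eta>ip: "part \<eta> i = a" "part \<eta> p = b"
    using ip \<eta> by (auto simp: lookup_add lookup_single when_def)
  have "?\<nu> \<in> compositions N"
    using ip part_outside[OF \<eta>(1)] by (intro compositionsI) (auto simp: \<nu>)
  moreover have "prec N ?\<nu> \<eta>"
    using xy(2)
  proof
    assume "x < max a b \<and> y < max a b"
    then show ?thesis using ip xy(1) \<eta>ip by (intro prec_between[of i N p]) (auto simp: \<nu>)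
  next
    assume *: "x = b \<and> y = a \<and> (p < i \<and> a < b \<or> i < p \<and> b < a)"
    have inv: "inv' (transpose i p) = transpose i p" by (rule inv_equality) simp_all
    have "?\<nu> = perm_exp (transpose i p) \<eta>"
    proof (rule poly_mapping_eqI)
      fix k
      show "part ?\<nu> k = part (perm_exp (transpose i p) \<eta>) k"
        unfolding \<nu> using ip * by (simp add: part_perm_exp inv \<eta>ip transpose_def)
    qed
    moreover have "prec N (perm_exp (transpose i p) \<eta>) \<eta>"
      using * ip \<eta>ip prec_swap[of i p N \<eta>] prec_swap[of p i N \<eta>] by (auto simp: transpose_commute)
    ultimately show ?thesis by simp
  qed
  ultimately show ?thesis unfolding mono2_def by (rule lower_term)
qed

lemma divdiff_term:
  assumes "i \<noteq> p" "\<eta> = \<rho> + esingle i a + esingle p b"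
    and "\<And>x y. perm_exp (transpose i p) (\<rho> + esingle i x + esingle p y) = \<rho> + esingle i y + esingle p x"
  shows "b \<le> a \<Longrightarrow> divdiff i p (term_poly \<eta> 1) = (\<Sum>k<a - b. mono2 \<rho> i p (a - Suc k) (b + k))"
    and "a \<le> b \<Longrightarrow> divdiff i p (term_poly \<eta> 1) = - (\<Sum>k<b - a. mono2 \<rho> i p (b - Suc k) (a + k))"
proof -
  have m: "term_poly \<eta> 1 - perm_poly (transpose i p) (term_poly \<eta> 1) = mono2 \<rho> i p a b - mono2 \<rho> i p b a"
    by (simp add: assms(2,3) mono2_def)
  show "divdiff i p (term_poly \<eta> 1) = (\<Sum>k<a - b. mono2 \<rho> i p (a - Suc k) (b + k))" if "b \<le> a"
    using assms(1) that by (intro divdiff_eqI) (simp_all only: m mono2_quot not_False_eq_True)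
  show "divdiff i p (term_poly \<eta> 1) = - (\<Sum>k<b - a. mono2 \<rho> i p (b - Suc k) (a + k))" if "a \<le> b"
    using assms(1) that
    by (intro divdiff_eqI) (simp_all only: m mono2_quot mult_minus_left minus_diff_eq not_False_eq_True)
qed

text \<open>Multiplication by z_i makes the exponent at i run from the larger entry down to one
  above the smaller entry. The first monomial is \<eta> itself if \<eta>_p < \<eta>_i; if \<eta>_i <
  \<eta>_p it is the exchanged one, and p < i makes that one smaller.\<close>

lemma lower_divdiff_left:
  assumes "1 \<le> p" "p < i" "i \<le> N" "\<eta> \<in> compositions N"
  shows "lower N \<eta> (zvar i * divdiff i p (term_poly \<eta> 1) - term_poly \<eta> (if part \<eta> p < part \<eta> i then 1 else 0))"
proof -
  have ip: "i \<noteq> p" "i \<in> {1..N}" "p \<in> {1..N}" using assms by auto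
  define a b where "a = part \<eta> i" and "b = part \<eta> p"
  obtain \<rho> where \<rho>: "\<eta> = \<rho> + esingle i a + esingle p b"
    "\<And>x y. perm_exp (transpose i p) (\<rho> + esingle i x + esingle p y) = \<rho> + esingle i y + esingle p x"
    "part \<rho> i = 0" "part \<rho> p = 0"
    using swap_exp_decomp[OF ip(1), of \<eta>] unfolding a_def b_def by metis
  have low: "lower N \<eta> (mono2 \<rho> i p x y)"
    if "x + y = a + b" "x < max a b \<and> y < max a b \<or> x = b \<and> y = a \<and> a < b" for x y
    using that assms ip by (intro lower_mono2[OF ip(2,3,1) assms(4) \<rho>(1,3,4)]) auto
  show ?thesis
  proof (cases "b < a")
    case True
    then obtain m where m: "a - b = Suc m" by (metis Suc_diff_Suc)
    have "zvar i * divdiff i p (term_poly \<eta> 1) = (\<Sum>k<a - b. mono2 \<rho> i p (a - k) (b + k))"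
      unfolding divdiff_term(1)[OF ip(1) \<rho>(1,2) less_imp_le[OF True]]
      by (auto simp: sum_distrib_left mult.commute[of "zvar i"] mono2_zvar Suc_diff_Suc intro!: sum.cong)
    also have "\<dots> = mono2 \<rho> i p a b + (\<Sum>k<m. mono2 \<rho> i p (a - Suc k) (b + Suc k))"
      unfolding m by (subst sum.lessThan_Suc_shift) simp
    finally have "zvar i * divdiff i p (term_poly \<eta> 1) - mono2 \<rho> i p a b =
        (\<Sum>k<m. mono2 \<rho> i p (a - Suc k) (b + Suc k))" by simp
    moreover have "lower N \<eta> (\<Sum>k<m. mono2 \<rho> i p (a - Suc k) (b + Suc k))"
      using m by (intro lower_sum low) auto
    moreover have "mono2 \<rho> i p a b = term_poly \<eta> 1" by (simp add: mono2_def \<rho>(1))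
    ultimately show ?thesis using True by (simp add: a_def b_def)
  next
    case False
    then have "a \<le> b" by simp
    have "zvar i * divdiff i p (term_poly \<eta> 1) = - (\<Sum>k<b - a. mono2 \<rho> i p (b - k) (a + k))"
      unfolding divdiff_term(2)[OF ip(1) \<rho>(1,2) \<open>a \<le> b\<close>]
      by (auto simp: sum_distrib_left mult.commute[of "zvar i"] mono2_zvar Suc_diff_Suc intro!: sum.cong)
    moreover have "lower N \<eta> (\<Sum>k<b - a. mono2 \<rho> i p (b - k) (a + k))"
      by (rule lower_sum, rule low) auto
    ultimately show ?thesis using False by (simp add: a_def b_def lower_minus)
  qed
qed

text \<open>Here z_p raises the exponent at p, so the last monomial of the sum is the critical one:
  \<eta> itself, with coefficient -1, if \<eta>_i < \<eta>_p, and the exchanged monomial if \<eta>_p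
  < \<eta>_i.\<close>

lemma lower_divdiff_right:
  assumes "1 \<le> i" "i < p" "p \<le> N" "\<eta> \<in> compositions N"
  shows "lower N \<eta> (zvar p * divdiff i p (term_poly \<eta> 1) + term_poly \<eta> (if part \<eta> i < part \<eta> p then 1 else 0))"
proof -
  have ip: "i \<noteq> p" "i \<in> {1..N}" "p \<in> {1..N}" using assms by auto
  define a b where "a = part \<eta> i" and "b = part \<eta> p"
  obtain \<rho> where \<rho>: "\<eta> = \<rho> + esingle i a + esingle p b"
    "\<And>x y. perm_exp (transpose i p) (\<rho> + esingle i x + esingle p y) = \<rho> + esingle i y + esingle p x"
    "part \<rho> i = 0" "part \<rho> p = 0"
    using swap_exp_decomp[OF ip(1), of \<eta>] unfolding a_def b_def by metis
  have low: "lower N \<eta> (mono2 \<rho> i p x y)"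
    if "x + y = a + b" "x < max a b \<and> y < max a b \<or> x = b \<and> y = a \<and> b < a" for x y
    using that assms ip by (intro lower_mono2[OF ip(2,3,1) assms(4) \<rho>(1,3,4)]) auto
  show ?thesis
  proof (cases "a < b")
    case True
    then obtain m where m: "b - a = Suc m" by (metis Suc_diff_Suc)
    have "zvar p * divdiff i p (term_poly \<eta> 1) = - (\<Sum>k<b - a. mono2 \<rho> i p (b - Suc k) (a + Suc k))"
      unfolding divdiff_term(2)[OF ip(1) \<rho>(1,2) less_imp_le[OF True]]
      by (auto simp: sum_distrib_left mult.commute[of "zvar p"] mono2_zvar intro!: sum.cong)
    also have "\<dots> = - (\<Sum>k<m. mono2 \<rho> i p (b - Suc k) (a + Suc k)) - mono2 \<rho> i p (b - Suc m) (a + Suc m)"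
      unfolding m by simp
    also have "mono2 \<rho> i p (b - Suc m) (a + Suc m) = term_poly \<eta> 1"
      using True by (simp add: m[symmetric] mono2_def \<rho>(1))
    finally have "zvar p * divdiff i p (term_poly \<eta> 1) + term_poly \<eta> 1 =
        - (\<Sum>k<m. mono2 \<rho> i p (b - Suc k) (a + Suc k))" by simp
    moreover have "lower N \<eta> (\<Sum>k<m. mono2 \<rho> i p (b - Suc k) (a + Suc k))"
      using m by (intro lower_sum low) auto
    ultimately show ?thesis using True by (simp add: a_def b_def lower_minus)
  next
    case False
    then have "b \<le> a" by simp
    have "zvar p * divdiff i p (term_poly \<eta> 1) = (\<Sum>k<a - b. mono2 \<rho> i p (a - Suc k) (b + Suc k))"
      unfolding divdiff_term(1)[OF ip(1) \<rho>(1,2) \<open>b \<le> a\<close>]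
      by (auto simp: sum_distrib_left mult.commute[of "zvar p"] mono2_zvar intro!: sum.cong)
    moreover have "lower N \<eta> (\<Sum>k<a - b. mono2 \<rho> i p (a - Suc k) (b + Suc k))"
      by (rule lower_sum, rule low) auto
    ultimately show ?thesis using False by (simp add: a_def b_def)
  qed
qed

text \<open>Positions p < i with smaller entry contribute 1 to the diagonal and positions p > i with
  larger entry contribute -1. Adding 1 - i replaces the first count by minus its complement among
  the i - 1 positions on the left, which is the form in \<open>eigenval\<close>.\<close>

lemma lower_cherednik_term:
  assumes "i \<in> {1..N}" "\<eta> \<in> compositions N"
  shows "lower N \<eta> (cherednik N \<alpha> i (term_poly \<eta> 1) - term_poly \<eta> (eigenval N \<alpha> \<eta> i))"
proof -
  let ?t = "term_poly \<eta> 1"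
  let ?l = "\<lambda>p. if part \<eta> p < part \<eta> i then 1 else (0::real)"
  let ?r = "\<lambda>p. if part \<eta> i < part \<eta> p then 1 else (0::real)"
  have eq: "{k\<in>{1..N}. k < i \<and> part \<eta> k \<ge> part \<eta> i} = {1..<i} - {p\<in>{1..<i}. part \<eta> p < part \<eta> i}"
    using assms by auto
  have sub: "{p\<in>{1..<i}. part \<eta> p < part \<eta> i} \<subseteq> {1..<i}" by auto
  have "real (card {k\<in>{1..N}. k < i \<and> part \<eta> k \<ge> part \<eta> i}) =
      real (card {1..<i}) - real (card {p\<in>{1..<i}. part \<eta> p < part \<eta> i})"
    unfolding eq card_Diff_subset[OF finite_subset[OF sub finite_atLeastLessThan] sub]
    by (rule of_nat_diff[OF card_mono[OF finite_atLeastLessThan sub]])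
  then have L: "(\<Sum>p\<in>{1..<i}. ?l p) = real i - 1 - real (card {k\<in>{1..N}. k < i \<and> part \<eta> k \<ge> part \<eta> i})"
    using assms by (simp add: sum.If_cases Int_def of_nat_diff)
  have "{k\<in>{1..N}. k > i \<and> part \<eta> k > part \<eta> i} = {i<..N} \<inter> {p. part \<eta> i < part \<eta> p}" by auto
  then have R: "(\<Sum>p\<in>{i<..N}. ?r p) = real (card {k\<in>{1..N}. k > i \<and> part \<eta> k > part \<eta> i})"
    by (simp add: sum.If_cases)
  have E: "eigenval N \<alpha> \<eta> i = \<alpha> * real (part \<eta> i) + (\<Sum>p\<in>{1..<i}. ?l p) - (\<Sum>p\<in>{i<..N}. ?r p) + (1 - real i)"
    unfolding L R eigenval_def by simp
  have ts: "term_poly \<eta> (sum g A) = (\<Sum>p\<in>A. term_poly \<eta> (g p))" for g and A :: "nat set"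
    by (induction A rule: infinite_finite_induct) (simp_all add: term_poly_add)
  have td: "term_poly \<eta> (x - y) = term_poly \<eta> x - term_poly \<eta> y" for x y
    using term_poly_add[of \<eta> x "- y"] by (simp add: term_poly_uminus)
  have "cherednik N \<alpha> i ?t - term_poly \<eta> (eigenval N \<alpha> \<eta> i) =
      (\<Sum>p\<in>{1..<i}. zvar i * divdiff i p ?t - term_poly \<eta> (?l p)) +
      (\<Sum>p\<in>{i<..N}. zvar p * divdiff i p ?t + term_poly \<eta> (?r p))"
    unfolding E cherednik_alt term_poly_add td ts euler_term const_poly_term sum_subtractf sum.distrib
    by (simp add: td)
  also have "lower N \<eta> \<dots>"
    using assms by (intro lower_add lower_sum lower_divdiff_left lower_divdiff_right) auto
  finally show ?thesis .
qed

section \<open>Nonsymmetric Jack polynomials\<close>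

text \<open>
  The set has \<open>r - 1\<close> elements when \<open>\<eta>\<^sub>i\<close> is the \<open>r\<close>-th entry in the stable decreasing sort of \<open>\<eta>\<close>.
\<close>
definition preceding :: "nat \<Rightarrow> exponents \<Rightarrow> nat \<Rightarrow> nat set" where
  "preceding N \<eta> i = {m\<in>{1..N}. part \<eta> m > part \<eta> i \<or> part \<eta> m = part \<eta> i \<and> m < i}"

lemma finite_preceding [simp]: "finite (preceding N \<eta> i)"
  by (simp add: preceding_def)

lemma eigenval_preceding: "eigenval N \<alpha> \<eta> i = \<alpha> * real (part \<eta> i) - real (card (preceding N \<eta> i))"
proof -
  have eq: "preceding N \<eta> i = {k\<in>{1..N}. k < i \<and> part \<eta> k \<ge> part \<eta> i} \<union> {k\<in>{1..N}. k > i \<and> part \<eta> k > part \<eta> i}"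
    by (auto simp: preceding_def) (metis linorder_neqE_nat less_irrefl)
  have "card (preceding N \<eta> i) =
      card {k\<in>{1..N}. k < i \<and> part \<eta> k \<ge> part \<eta> i} + card {k\<in>{1..N}. k > i \<and> part \<eta> k > part \<eta> i}"
    unfolding eq by (rule card_Un_disjoint) auto
  then show ?thesis by (simp add: eigenval_def)
qed

lemma card_preceding_less:
  assumes "k \<in> preceding N \<eta> i"
  shows "card (preceding N \<eta> k) < card (preceding N \<eta> i)"
proof (rule psubset_card_mono)
  have "k \<notin> preceding N \<eta> k" by (simp add: preceding_def)
  then show "preceding N \<eta> k \<subset> preceding N \<eta> i"
    using assms unfolding preceding_def by fastforce
qed simp

lemma eigenval_gap:
  assumes "\<alpha> > 0" "k \<in> {1..N}" "part \<eta> i < part \<eta> k"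
  shows "eigenval N \<alpha> \<eta> i + \<alpha> + 1 \<le> eigenval N \<alpha> \<eta> k"
proof -
  have "card (preceding N \<eta> k) + 1 \<le> card (preceding N \<eta> i)"
    using card_preceding_less[of k N \<eta> i] assms by (auto simp: preceding_def)
  then have "real (card (preceding N \<eta> k)) + 1 \<le> real (card (preceding N \<eta> i))" by linarith
  moreover have "\<alpha> * (real (part \<eta> i) + 1) \<le> \<alpha> * real (part \<eta> k)"
    using assms by (intro mult_left_mono) auto
  ultimately show ?thesis by (simp add: eigenval_preceding algebra_simps)
qed

text \<open>The relation behind \<open>preceding\<close> is a strict total order on positions, and
  going up in it raises the rank term strictly while \<alpha> times the entry does not fall.\<close>

lemma eigenval_less_iff:
  assumes "\<alpha> > 0" "i \<in> {1..N}" "k \<in> {1..N}"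
  shows "eigenval N \<alpha> \<eta> i < eigenval N \<alpha> \<eta> k \<longleftrightarrow> k \<in> preceding N \<eta> i"
proof -
  have *: "eigenval N \<alpha> \<eta> a < eigenval N \<alpha> \<eta> b" if "b \<in> preceding N \<eta> a" for a b
  proof -
    have "part \<eta> a \<le> part \<eta> b" using that by (auto simp: preceding_def)
    then have "\<alpha> * real (part \<eta> a) \<le> \<alpha> * real (part \<eta> b)" using assms(1) by simp
    then show ?thesis using card_preceding_less[OF that] by (simp add: eigenval_preceding)
  qed
  have "k \<in> preceding N \<eta> i \<or> k = i \<or> i \<in> preceding N \<eta> k"
    using assms by (auto simp: preceding_def)
  then show ?thesis using *[of k i] *[of i k] by auto
qed

lemma preceding_eigenval:
  assumes "\<alpha> > 0" "i \<in> {1..N}"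
  shows "preceding N \<eta> i = {k\<in>{1..N}. eigenval N \<alpha> \<eta> i < eigenval N \<alpha> \<eta> k}"
  using eigenval_less_iff[OF assms] by (auto simp: preceding_def)

text \<open>The order of the eigenvalues determines all ranks, and rank plus eigenvalue determines
  \<alpha> times the entry. The permutation \<open>w\<close> is there for spectra known only up to
  an exchange, as in \<open>jack_poly_simple_equal\<close>.\<close>

lemma part_eq_of_eigenval_eq:
  assumes "\<alpha> > 0" "w permutes {1..N}"
    and e: "\<And>i. i \<in> {1..N} \<Longrightarrow> eigenval N \<alpha> \<mu> i = eigenval N \<alpha> \<eta> (w i)"
    and i: "i \<in> {1..N}"
  shows "part \<mu> i = part \<eta> (w i)"
proof -
  have wi: "w k \<in> {1..N} \<longleftrightarrow> k \<in> {1..N}" for k using permutes_in_image[OF assms(2)] .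
  have inj: "inj_on w A" for A using permutes_inj[OF assms(2)] by (rule inj_on_subset) simp
  have "preceding N \<eta> (w i) = w ` preceding N \<mu> i"
  proof (intro equalityI subsetI)
    fix m assume m: "m \<in> preceding N \<eta> (w i)"
    then have mN: "m \<in> {1..N}" by (simp add: preceding_def)
    have "m = w (inv' w m)" by (simp add: permutes_inverses[OF assms(2)])
    then show "m \<in> w ` preceding N \<mu> i"
      using m mN i wi[of "inv' w m"] e
      unfolding preceding_eigenval[OF assms(1) i] preceding_eigenval[OF assms(1) iffD2[OF wi i]]
      by (intro image_eqI[of _ _ "inv' w m"]) simp_all
  next
    fix m assume "m \<in> w ` preceding N \<mu> i"
    then show "m \<in> preceding N \<eta> (w i)"
      using e i wi
      unfolding preceding_eigenval[OF assms(1) i] preceding_eigenval[OF assms(1) iffD2[OF wi i]]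
      by (auto simp del: atLeastAtMost_iff)
  qed
  then have "card (preceding N \<eta> (w i)) = card (preceding N \<mu> i)" by (simp add: card_image[OF inj])
  then show ?thesis using e[OF i] assms(1) by (simp add: eigenval_preceding)
qed

lemma card_preceding_cong:
  assumes "w permutes {1..N}"
    and "\<And>m. m \<in> {1..N} \<Longrightarrow> w m \<in> preceding N \<mu> (w i) \<longleftrightarrow> m \<in> preceding N \<eta> i"
  shows "card (preceding N \<mu> (w i)) = card (preceding N \<eta> i)"
proof -
  have wi: "w k \<in> {1..N} \<longleftrightarrow> k \<in> {1..N}" for k using permutes_in_image[OF assms(1)] .
  have inj: "inj_on w A" for A using permutes_inj[OF assms(1)] by (rule inj_on_subset) simp
  have sub: "preceding N \<eta> i \<subseteq> {1..N}" "preceding N \<mu> (w i) \<subseteq> {1..N}" by (auto simp: preceding_def)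
  have "preceding N \<mu> (w i) = w ` preceding N \<eta> i"
  proof (intro equalityI subsetI)
    fix m assume m: "m \<in> preceding N \<mu> (w i)"
    have mw: "m = w (inv' w m)" by (simp add: permutes_inverses[OF assms(1)])
    then have "inv' w m \<in> {1..N}" using m sub(2) wi by (metis subsetD)
    then show "m \<in> w ` preceding N \<eta> i"
      using m mw assms(2)[of "inv' w m"] by (intro image_eqI[of _ _ "inv' w m"]) simp_all
  next
    fix m assume "m \<in> w ` preceding N \<eta> i"
    then show "m \<in> preceding N \<mu> (w i)" using assms(2) sub(1) by blast
  qed
  then show ?thesis by (simp add: card_image[OF inj])
qed

lemma part_simple: "part (perm_exp (simple_transp k) \<eta>) i = part \<eta> (simple_transp k i)"
  by (simp add: part_perm_exp)

text \<open>Ties must be excluded: for equal neighbours the composition is fixed by the exchange,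
  while the eigenvalues at k and k + 1 differ by 1.\<close>

lemma eigenval_simple:
  assumes "1 \<le> k" "k < N" "part \<eta> k \<noteq> part \<eta> (Suc k)"
  shows "eigenval N \<alpha> (perm_exp (simple_transp k) \<eta>) i = eigenval N \<alpha> \<eta> (simple_transp k i)"
proof -
  let ?s = "simple_transp k"
  have s: "?s permutes {1..N}" using assms by (intro simple_transp_permutes)
  have "card (preceding N (perm_exp ?s \<eta>) (?s (?s i))) = card (preceding N \<eta> (?s i))"
  proof (rule card_preceding_cong[OF s])
    fix m assume m: "m \<in> {1..N}"
    then have "?s m \<in> {1..N}" using permutes_in_image[OF s] by blast
    then show "?s m \<in> preceding N (perm_exp ?s \<eta>) (?s (?s i)) \<longleftrightarrow> m \<in> preceding N \<eta> (?s i)"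
      using assms m by (simp add: preceding_def part_simple) (auto simp: simple_transp_apply)
  qed
  then show ?thesis by (simp add: eigenval_preceding part_simple)
qed

text \<open>For N at least 1 the entries are (\<eta>_2, ..., \<eta>_N, \<eta>_1 + 1), the exponent
  of the image of the monomial under \<open>raise_poly\<close>.\<close>

definition raise_exp :: "nat \<Rightarrow> exponents \<Rightarrow> exponents" where
  "raise_exp N \<eta> = perm_exp (cyc N) \<eta> + esingle N 1"

lemma part_raise_exp:
  "part (raise_exp N \<eta>) (cyc N i) = part \<eta> i + (if cyc N i = N then 1 else 0)"
  by (simp add: raise_exp_def lookup_add lookup_single when_def part_perm_exp')

lemma cyc_in: "cyc N i \<in> {1..N} \<longleftrightarrow> i \<in> {1..N}"
  using permutes_in_image[OF cyc_permutes] .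

text \<open>Ranks are unchanged. The entry moved from first to last place loses its ties by position
  but is now larger by one; entries equal to its new value preceded it before by size and now
  precede it by position.\<close>

lemma eigenval_raise:
  assumes "i \<in> {1..N}"
  shows "eigenval N \<alpha> (raise_exp N \<eta>) (cyc N i) = eigenval N \<alpha> \<eta> i + (if i = 1 then \<alpha> else 0)"
proof -
  have cN: "cyc N j = N \<longleftrightarrow> j = 1" if "j \<in> {1..N}" for j
    using that by (auto simp: cyc_def)
  have "card (preceding N (raise_exp N \<eta>) (cyc N i)) = card (preceding N \<eta> i)"
  proof (rule card_preceding_cong[OF cyc_permutes])
    fix m assume m: "m \<in> {1..N}"
    show "cyc N m \<in> preceding N (raise_exp N \<eta>) (cyc N i) \<longleftrightarrow> m \<in> preceding N \<eta> i"
      unfolding preceding_def mem_Collect_eq cyc_in part_raise_exp cN[OF m] cN[OF assms]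
      using m assms by (auto simp: cyc_def)
  qed
  then show ?thesis
    by (simp add: eigenval_preceding part_raise_exp cN[OF assms] distrib_left)
qed

lemma weight_add: "weight N (\<mu> + \<nu>) = weight N \<mu> + weight N \<nu>"
  by (simp add: weight_def lookup_add sum.distrib)

lemma weight_raise: "1 \<le> N \<Longrightarrow> weight N (raise_exp N \<eta>) = Suc (weight N \<eta>)"
  unfolding raise_exp_def weight_add weight_perm_exp[OF cyc_permutes]
  by (simp add: weight_def lookup_single when_def)

lemma raise_exp_surj:
  assumes "1 \<le> N" "\<eta> \<in> compositions N" "part \<eta> N > 0"
  obtains \<eta>' where "\<eta>' \<in> compositions N" "\<eta> = raise_exp N \<eta>'"
proof
  let ?\<mu> = "\<eta> - esingle N 1"
  have "?\<mu> \<in> compositions N"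
    using part_outside[OF assms(2)] by (intro compositionsI) (auto simp: lookup_minus)
  then show "perm_exp (inv' (cyc N)) ?\<mu> \<in> compositions N"
    by (rule perm_exp_compositions[OF permutes_inv[OF cyc_permutes]])
  have "\<eta> = ?\<mu> + esingle N 1"
    using assms(3) by (intro poly_mapping_eqI) (auto simp: lookup_add lookup_minus lookup_single when_def)
  then show "\<eta> = raise_exp N (perm_exp (inv' (cyc N)) ?\<mu>)"
    by (simp add: raise_exp_def perm_exp_cancel_inv)
qed

section \<open>Joint eigenvectors and their supports\<close>

text \<open>The spectrum \<open>e\<close> is an arbitrary function, because transpositions produce
  permuted spectra before it is known whether any composition carries them.\<close>

definition joint_eigen :: "nat \<Rightarrow> real \<Rightarrow> (nat \<Rightarrow> real) \<Rightarrow> polynomial \<Rightarrow> bool" where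
  "joint_eigen N \<alpha> e f \<longleftrightarrow> Poly_Mapping.keys f \<subseteq> compositions N \<and>
     (\<forall>i\<in>{1..N}. cherednik N \<alpha> i f = const_poly (e i) * f)"

text \<open>By triangularity a key \<nu> different from \<mu> can contribute at \<mu> only if \<mu>
  is smaller than \<nu>, which maximality excludes; the diagonal term remains.\<close>

lemma coef_cherednik_maximal:
  assumes f: "Poly_Mapping.keys f \<subseteq> compositions N" and i: "i \<in> {1..N}"
    and max: "\<And>\<nu>. \<nu> \<in> Poly_Mapping.keys f \<Longrightarrow> \<not> prec N \<mu> \<nu>"
  shows "coef (cherednik N \<alpha> i f) \<mu> = eigenval N \<alpha> \<mu> i * coef f \<mu>"
proof -
  have c: "coef (cherednik N \<alpha> i (term_poly \<nu> 1)) \<mu> = (if \<mu> = \<nu> then eigenval N \<alpha> \<mu> i else 0)"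
    if "\<nu> \<in> Poly_Mapping.keys f" for \<nu>
  proof -
    have "\<mu> \<notin> Poly_Mapping.keys (cherednik N \<alpha> i (term_poly \<nu> 1) - term_poly \<nu> (eigenval N \<alpha> \<nu> i))"
      using lower_cherednik_term[OF i, of \<nu> \<alpha>] that f max[OF that] unfolding lower_def by blast
    then show ?thesis by (auto simp: in_keys_iff lookup_minus coef_term_poly)
  qed
  have "f = (\<Sum>\<nu>\<in>Poly_Mapping.keys f. const_poly (coef f \<nu>) * term_poly \<nu> 1)"
    by (subst polynomial_eq_sum_terms) (simp add: const_poly_term)
  then have "cherednik N \<alpha> i f = (\<Sum>\<nu>\<in>Poly_Mapping.keys f. const_poly (coef f \<nu>) * cherednik N \<alpha> i (term_poly \<nu> 1))"
    using additive.sum[OF additive_cherednik, of N \<alpha> i "\<lambda>\<nu>. const_poly (coef f \<nu>) * term_poly \<nu> 1"]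
    by (simp only: cherednik_const_mult) metis
  then have "coef (cherednik N \<alpha> i f) \<mu> =
      (\<Sum>\<nu>\<in>Poly_Mapping.keys f. coef f \<nu> * (if \<mu> = \<nu> then eigenval N \<alpha> \<mu> i else 0))"
    by (simp add: lookup_sum c)
  also have "\<dots> = (\<Sum>\<nu>\<in>Poly_Mapping.keys f. if \<mu> = \<nu> then eigenval N \<alpha> \<mu> i * coef f \<mu> else 0)"
    by (rule sum.cong) auto
  also have "\<dots> = eigenval N \<alpha> \<mu> i * coef f \<mu>"
    by (auto simp: sum.delta in_keys_iff)
  finally show ?thesis .
qed

text \<open>
  This replaces any direct estimate of the support of \<open>s\<^sub>k f\<close>: the dominance order is not preserved when
  \<open>s\<^sub>k\<close> is applied to both sides, so triangularity has to be recovered from the spectrum.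
\<close>
lemma joint_eigen_dominated:
  assumes "joint_eigen N \<alpha> e f" "\<nu> \<in> Poly_Mapping.keys f"
  obtains \<mu> where "\<mu> \<in> Poly_Mapping.keys f" "\<nu> = \<mu> \<or> prec N \<nu> \<mu>"
    "\<And>i. i \<in> {1..N} \<Longrightarrow> eigenval N \<alpha> \<mu> i = e i"
proof -
  let ?A = "{\<mu> \<in> Poly_Mapping.keys f. \<nu> = \<mu> \<or> prec N \<nu> \<mu>}"
  have f: "Poly_Mapping.keys f \<subseteq> compositions N" using assms(1) by (simp add: joint_eigen_def)
  have tr: "transp_on ?A (prec N)"
    using f prec_trans by (intro transp_onI) blast
  have as: "asymp_on ?A (prec N)"
    using f prec_trans not_prec_self by (intro asymp_onI) blast
  have "finite ?A" "?A \<noteq> {}" using assms(2) by auto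
  then obtain \<mu> where \<mu>: "\<mu> \<in> ?A" "\<And>\<kappa>. \<kappa> \<in> ?A \<Longrightarrow> \<kappa> \<noteq> \<mu> \<Longrightarrow> \<not> prec N \<mu> \<kappa>"
    using Finite_Set.bex_max_element[OF _ as tr] by blast
  have max: "\<not> prec N \<mu> \<kappa>" if "\<kappa> \<in> Poly_Mapping.keys f" for \<kappa>
    using \<mu> that prec_trans[of N \<nu> \<mu> \<kappa>] not_prec_self f assms(2) by blast
  show ?thesis
  proof
    fix i assume i: "i \<in> {1..N}"
    have "eigenval N \<alpha> \<mu> i * coef f \<mu> = e i * coef f \<mu>"
      using coef_cherednik_maximal[OF f i max, of \<alpha>] assms(1) i by (auto simp: joint_eigen_def)
    then show "eigenval N \<alpha> \<mu> i = e i" using \<mu>(1) by (simp add: in_keys_iff)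
  qed (use \<mu> in auto)
qed

lemma joint_eigen_support:
  assumes "\<alpha> > 0" "\<eta> \<in> compositions N" "joint_eigen N \<alpha> (eigenval N \<alpha> \<eta>) f" "\<nu> \<in> Poly_Mapping.keys f"
  shows "\<eta> \<in> Poly_Mapping.keys f" "\<nu> = \<eta> \<or> prec N \<nu> \<eta>"
proof -
  obtain \<mu> where \<mu>: "\<mu> \<in> Poly_Mapping.keys f" "\<nu> = \<mu> \<or> prec N \<nu> \<mu>"
    "\<And>i. i \<in> {1..N} \<Longrightarrow> eigenval N \<alpha> \<mu> i = eigenval N \<alpha> \<eta> i"
    using joint_eigen_dominated[OF assms(3,4)] by metis
  have "\<mu> = \<eta>"
    using \<mu>(1) assms part_eq_of_eigenval_eq[OF assms(1) permutes_id, of N \<mu> \<eta>] \<mu>(3)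
    by (intro compositions_eqI[of _ N]) (auto simp: joint_eigen_def)
  then show "\<eta> \<in> Poly_Mapping.keys f" "\<nu> = \<eta> \<or> prec N \<nu> \<eta>" using \<mu> by auto
qed

lemma keys_const_mult: "Poly_Mapping.keys (const_poly c * f) \<subseteq> Poly_Mapping.keys f"
  by (auto simp: in_keys_iff)

lemma joint_eigen_diff_mult:
  assumes "joint_eigen N \<alpha> e f" "joint_eigen N \<alpha> e g"
  shows "joint_eigen N \<alpha> e (f - const_poly c * g)"
proof -
  have "Poly_Mapping.keys (f - const_poly c * g) \<subseteq> compositions N"
    using assms keys_diff[of f "const_poly c * g"] keys_const_mult[of c g] unfolding joint_eigen_def by blast
  then show ?thesis
    using assms unfolding joint_eigen_def
    by (simp add: additive.diff[OF additive_cherednik] cherednik_const_mult right_diff_distrib mult.left_commute)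
qed

text \<open>Triangularity is a consequence of the spectrum (\<open>jack_poly_iff\<close>), so a
  constructed polynomial has to be checked only for the eigenvalue equations and one
  coefficient.\<close>

definition jack_poly :: "nat \<Rightarrow> real \<Rightarrow> exponents \<Rightarrow> polynomial \<Rightarrow> bool" where
  "jack_poly N \<alpha> \<eta> f \<longleftrightarrow> joint_eigen N \<alpha> (eigenval N \<alpha> \<eta>) f \<and> coef f \<eta> = 1"

text \<open>The difference has coefficient 0 at \<eta>, whereas a nonzero joint eigenvector with
  this spectrum must contain \<eta> in its support.\<close>

lemma joint_eigen_unique:
  assumes "\<alpha> > 0" "\<eta> \<in> compositions N" "jack_poly N \<alpha> \<eta> f" "joint_eigen N \<alpha> (eigenval N \<alpha> \<eta>) g"
  shows "g = const_poly (coef g \<eta>) * f"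
proof (rule ccontr)
  let ?h = "g - const_poly (coef g \<eta>) * f"
  assume "g \<noteq> const_poly (coef g \<eta>) * f"
  then have "?h \<noteq> 0" by simp
  then obtain \<nu> where "\<nu> \<in> Poly_Mapping.keys ?h" by (metis keys_eq_empty equals0I)
  then have "\<eta> \<in> Poly_Mapping.keys ?h"
    using assms by (intro joint_eigen_support(1)[OF assms(1,2)] joint_eigen_diff_mult) (auto simp: jack_poly_def)
  then show False using assms(3) by (simp add: jack_poly_def in_keys_iff lookup_minus)
qed

lemma keys_perm_poly:
  assumes "w permutes {1..N}" "Poly_Mapping.keys f \<subseteq> compositions N"
  shows "Poly_Mapping.keys (perm_poly w f) \<subseteq> compositions N"
proof
  fix \<nu> assume "\<nu> \<in> Poly_Mapping.keys (perm_poly w f)"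
  then have "perm_exp (inv' w) \<nu> \<in> compositions N"
    using assms by (auto simp: in_keys_iff coef_perm_poly permutes_bij)
  then show "\<nu> \<in> compositions N"
    using perm_exp_compositions[OF assms(1)] perm_exp_cancel_inv[OF permutes_bij[OF assms(1)]] by metis
qed

text \<open>The standard intertwiner: the inverse eigenvalue difference is the coefficient that
  absorbs the inhomogeneous terms f and -f of the two Hecke relations at k and k + 1.\<close>

lemma joint_eigen_simple:
  assumes "joint_eigen N \<alpha> e f" "1 \<le> k" "k < N" "e k \<noteq> e (Suc k)"
  shows "joint_eigen N \<alpha> (e \<circ> simple_transp k)
    (perm_poly (simple_transp k) f - const_poly (1 / (e k - e (Suc k))) * f)"
proof -
  let ?s = "simple_transp k"
  define c where "c = 1 / (e k - e (Suc k))"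
  define g where "g = perm_poly ?s f - const_poly c * f"
  have f: "Poly_Mapping.keys f \<subseteq> compositions N"
    "\<And>i. i \<in> {1..N} \<Longrightarrow> cherednik N \<alpha> i f = const_poly (e i) * f"
    using assms(1) by (auto simp: joint_eigen_def)
  have s: "?s permutes {1..N}" using assms by (intro simple_transp_permutes)
  have "Poly_Mapping.keys g \<subseteq> compositions N"
    using f(1) keys_perm_poly[OF s f(1)] keys_diff[of "perm_poly ?s f" "const_poly c * f"]
      keys_const_mult[of c f] unfolding g_def by blast
  moreover have "cherednik N \<alpha> i g = const_poly (e (?s i)) * g" if i: "i \<in> {1..N}" for i
  proof -
    have cg: "cherednik N \<alpha> i g = cherednik N \<alpha> i (perm_poly ?s f) - const_poly (c * e i) * f"
      using f(2)[OF i] unfolding g_def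
      by (simp add: additive.diff[OF additive_cherednik] cherednik_const_mult const_poly_mult mult.assoc)
    have c1: "c * e k = 1 + c * e (Suc k)"
      using assms(4) by (simp add: c_def field_simps)
    consider "i = k" | "i = Suc k" | "i \<noteq> k" "i \<noteq> Suc k" by blast
    then show ?thesis
    proof cases
      case 1
      have "cherednik N \<alpha> i (perm_poly ?s f) = const_poly (e (Suc k)) * perm_poly ?s f + f"
        using assms f(2)[of "Suc k"] by (simp add: 1 cherednik_simple_lower perm_poly_mult)
      then show ?thesis
        unfolding cg unfolding 1 c1 by (simp add: g_def const_poly_add const_poly_mult algebra_simps)
    next
      case 2
      have "cherednik N \<alpha> i (perm_poly ?s f) = const_poly (e k) * perm_poly ?s f - f"
        using assms f(2)[of k] by (simp add: 2 cherednik_simple_upper perm_poly_mult)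
      moreover have c2: "c * e (Suc k) = c * e k - 1" using c1 by simp
      ultimately show ?thesis
        unfolding cg unfolding 2 c2 by (simp add: g_def const_poly_diff const_poly_mult algebra_simps)
    next
      case 3
      have "cherednik N \<alpha> i (perm_poly ?s f) = const_poly (e i) * perm_poly ?s f"
        using assms f(2)[OF i] 3 by (simp add: cherednik_simple_other perm_poly_mult)
      then show ?thesis
        using 3 unfolding cg by (simp add: g_def const_poly_mult simple_transp_apply algebra_simps)
    qed
  qed
  ultimately show ?thesis unfolding joint_eigen_def g_def c_def by simp
qed

lemma jack_poly_simple:
  assumes "\<alpha> > 0" "\<eta> \<in> compositions N" "1 \<le> k" "k < N" "part \<eta> k < part \<eta> (Suc k)"
    and "jack_poly N \<alpha> \<eta> f"
  shows "jack_poly N \<alpha> (perm_exp (simple_transp k) \<eta>)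
    (perm_poly (simple_transp k) f - const_poly (1 / (eigenval N \<alpha> \<eta> k - eigenval N \<alpha> \<eta> (Suc k))) * f)"
    (is "jack_poly N \<alpha> ?s\<eta> ?g")
proof -
  have f: "joint_eigen N \<alpha> (eigenval N \<alpha> \<eta>) f" "coef f \<eta> = 1"
    using assms(6) by (auto simp: jack_poly_def)
  have s: "simple_transp k permutes {1..N}" using assms by (intro simple_transp_permutes)
  have ss: "perm_exp (simple_transp k) ?s\<eta> = \<eta>" by (simp add: perm_exp_comp)
  have s\<eta>: "?s\<eta> \<in> compositions N" by (rule perm_exp_compositions[OF s assms(2)])
  have "eigenval N \<alpha> \<eta> k \<noteq> eigenval N \<alpha> \<eta> (Suc k)"
    using eigenval_gap[OF assms(1) _ assms(5), of N] assms by simp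
  from joint_eigen_simple[OF f(1) assms(3,4) this]
  have "joint_eigen N \<alpha> (eigenval N \<alpha> \<eta> \<circ> simple_transp k) ?g" .
  moreover have "eigenval N \<alpha> \<eta> \<circ> simple_transp k = eigenval N \<alpha> ?s\<eta>"
    using assms by (auto simp: eigenval_simple)
  \<comment> \<open>The transposed \<open>f\<close> already has coefficient 1 at the exchanged
    composition. The subtracted multiple must contribute nothing there, and it does not because the
    exchanged composition is larger than \<eta>.\<close>
  moreover have "coef f ?s\<eta> = 0"
  proof (rule ccontr)
    assume "coef f ?s\<eta> \<noteq> 0"
    then have "?s\<eta> = \<eta> \<or> prec N ?s\<eta> \<eta>"
      using joint_eigen_support(2)[OF assms(1,2) f(1), of ?s\<eta>] by (simp add: in_keys_iff)
    moreover have "?s\<eta> \<noteq> \<eta>"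
      using assms(5) part_simple[of k \<eta> k] by auto
    moreover have "prec N (perm_exp (transpose k (Suc k)) ?s\<eta>) ?s\<eta>"
      using assms by (intro prec_swap) (auto simp: part_simple)
    then have "prec N \<eta> ?s\<eta>" using ss by (simp add: simple_transp_def)
    ultimately show False using prec_trans[OF _ _ assms(2) s\<eta>] not_prec_self by blast
  qed
  ultimately show ?thesis
    using f(2) by (simp add: jack_poly_def lookup_minus coef_perm_poly ss)
qed

text \<open>The eigenvalue difference is 1, so s_k f - f is a joint eigenvector for the exchanged
  spectrum, or 0. A composition with that spectrum would have the entries of s_k \<eta> = \<eta>,
  whose own spectrum is not exchanged.\<close>

lemma jack_poly_simple_equal:
  assumes "\<alpha> > 0" "\<eta> \<in> compositions N" "1 \<le> k" "k < N" "part \<eta> k = part \<eta> (Suc k)"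
    and "jack_poly N \<alpha> \<eta> f"
  shows "perm_poly (simple_transp k) f = f"
proof (rule ccontr)
  let ?s = "simple_transp k"
  assume ne: "perm_poly ?s f \<noteq> f"
  have s: "?s permutes {1..N}" using assms by (intro simple_transp_permutes)
  have "preceding N \<eta> (Suc k) = insert k (preceding N \<eta> k)"
    using assms by (auto simp: preceding_def)
  moreover have "k \<notin> preceding N \<eta> k" by (simp add: preceding_def)
  ultimately have gap: "eigenval N \<alpha> \<eta> k - eigenval N \<alpha> \<eta> (Suc k) = 1"
    using assms(5) by (simp add: eigenval_preceding)
  have f: "joint_eigen N \<alpha> (eigenval N \<alpha> \<eta>) f" using assms(6) by (auto simp: jack_poly_def)
  have eig: "joint_eigen N \<alpha> (eigenval N \<alpha> \<eta> \<circ> ?s) (perm_poly ?s f - f)"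
    using joint_eigen_simple[OF f assms(3,4)] gap by simp
  obtain \<nu> where "\<nu> \<in> Poly_Mapping.keys (perm_poly ?s f - f)"
    using ne by (metis keys_eq_empty equals0I eq_iff_diff_eq_0)
  then obtain \<mu> where \<mu>: "\<mu> \<in> Poly_Mapping.keys (perm_poly ?s f - f)"
    "\<And>i. i \<in> {1..N} \<Longrightarrow> eigenval N \<alpha> \<mu> i = (eigenval N \<alpha> \<eta> \<circ> ?s) i"
    using joint_eigen_dominated[OF eig] by metis
  have "part \<mu> i = part \<eta> (?s i)" if "i \<in> {1..N}" for i
    using \<mu>(2) by (intro part_eq_of_eigenval_eq[OF assms(1) s _ that]) simp
  moreover have "part \<eta> (?s i) = part \<eta> i" for i
    using assms(5) by (simp add: simple_transp_apply)
  ultimately have "\<mu> = \<eta>"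
    using \<mu>(1) eig assms(2) by (intro compositions_eqI[of _ N]) (auto simp: joint_eigen_def)
  then show False using \<mu>(2)[of k] gap assms by simp
qed

lemma jack_poly_0: "jack_poly N \<alpha> 0 1"
proof -
  have "divdiff i p 1 = 0" if "i \<noteq> p" for i p
    using that perm_poly_const[of "transpose i p" 1] by (intro divdiff_eqI) simp_all
  moreover have "euler i 1 = 0" for i
    using euler_term[of i 0 1] by (simp add: term_poly_def)
  ultimately have "cherednik N \<alpha> i 1 = const_poly (1 - real i)" for i
    by (simp add: cherednik_alt)
  moreover have "eigenval N \<alpha> 0 i = 1 - real i" if "i \<in> {1..N}" for i
  proof -
    have "{k. Suc 0 \<le> k \<and> k \<le> N \<and> k < i} = {1..<i}" using that by auto
    then show ?thesis using that by (simp add: eigenval_def of_nat_diff)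
  qed
  moreover have "Poly_Mapping.keys (1::polynomial) \<subseteq> compositions N"
    by (auto simp: in_keys_iff lookup_one when_def compositions_def split: if_splits)
  ultimately show ?thesis
    unfolding jack_poly_def joint_eigen_def by simp
qed

lemma jack_poly_raise:
  assumes "1 \<le> N" "jack_poly N \<alpha> \<eta> f"
  shows "jack_poly N \<alpha> (raise_exp N \<eta>) (raise_poly N f)"
proof -
  have f: "Poly_Mapping.keys f \<subseteq> compositions N" "coef f \<eta> = 1"
    "\<And>i. i \<in> {1..N} \<Longrightarrow> cherednik N \<alpha> i f = const_poly (eigenval N \<alpha> \<eta> i) * f"
    using assms by (auto simp: jack_poly_def joint_eigen_def)
  have coef_z: "coef (zvar N * g) (\<nu> + esingle N 1) = coef g \<nu>" for g \<nu>
    by (induction g rule: polynomial_induct)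
       (simp_all add: distrib_left lookup_add zvar_mult_term coef_term_poly)
  have keys_z: "Poly_Mapping.keys (zvar N * g) \<subseteq> (\<lambda>\<nu>. \<nu> + esingle N 1) ` Poly_Mapping.keys g" for g
    using keys_mult[of "zvar N" g] by (auto simp: zvar_def term_poly_def add.commute)
  have "\<nu> \<in> compositions N" if "\<nu> \<in> Poly_Mapping.keys (raise_poly N f)" for \<nu>
  proof -
    have "Poly_Mapping.keys (raise_poly N f) \<subseteq> (\<lambda>\<nu>. \<nu> + esingle N 1) ` compositions N"
      unfolding raise_poly_def
      by (rule order_trans[OF keys_z image_mono[OF keys_perm_poly[OF cyc_permutes f(1)]]])
    from subsetD[OF this that] obtain \<mu> where "\<nu> = \<mu> + esingle N 1" "\<mu> \<in> compositions N"
      by (rule imageE)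
    then show ?thesis
      using part_outside[of \<mu> N] assms(1)
      by (intro compositionsI) (auto simp: lookup_add lookup_single when_def)
  qed
  moreover have "coef (raise_poly N f) (raise_exp N \<eta>) = 1"
    unfolding raise_poly_def raise_exp_def coef_z using f(2) by (simp add: coef_perm_poly perm_exp_inv_cancel)
  moreover have "cherednik N \<alpha> i (raise_poly N f) = const_poly (eigenval N \<alpha> (raise_exp N \<eta>) i) * raise_poly N f"
    if i: "i \<in> {1..N}" for i
  proof -
    have r: "raise_poly N (const_poly c * f) = const_poly c * raise_poly N f" for c
      by (simp add: raise_poly_def perm_poly_mult mult.left_commute)
    show ?thesis
    proof (cases "i = N")
      case True
      have "cyc N 1 = N" using assms(1) by (simp add: cyc_def)
      then have e: "eigenval N \<alpha> (raise_exp N \<eta>) N = eigenval N \<alpha> \<eta> 1 + \<alpha>"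
        using eigenval_raise[of 1 N \<alpha> \<eta>] assms(1) by simp
      have "cherednik N \<alpha> 1 f + const_poly \<alpha> * f = const_poly (eigenval N \<alpha> \<eta> 1 + \<alpha>) * f"
        using f(3)[of 1] assms(1) by (simp add: const_poly_add distrib_right)
      then show ?thesis
        unfolding True cherednik_raise_top[OF assms(1)] e by (simp only: r)
    next
      case False
      then have iN: "1 \<le> i" "i < N" using i by auto
      then have "cyc N (Suc i) = i" by (simp add: cyc_def)
      then have e: "eigenval N \<alpha> (raise_exp N \<eta>) i = eigenval N \<alpha> \<eta> (Suc i)"
        using eigenval_raise[of "Suc i" N \<alpha> \<eta>] iN by simp
      show ?thesis
        using f(3)[of "Suc i"] iN by (simp add: cherednik_raise_lower e r)
    qed
  qed
  ultimately show ?thesis unfolding jack_poly_def joint_eigen_def by blast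
qed

text \<open>A composition whose last entry is positive is a raise of one of smaller weight.
  Otherwise the last positive entry is moved to the right by transpositions, which never meet
  anything but zeros.\<close>

lemma jack_poly_exists:
  assumes "1 \<le> N" "\<alpha> > 0"
  shows "\<eta> \<in> compositions N \<Longrightarrow> \<exists>f. jack_poly N \<alpha> \<eta> f"
proof (induction "weight N \<eta>" arbitrary: \<eta> rule: less_induct)
  case less
  \<comment> \<open>Here \<open>l\<close> is the last position with a positive entry. Exchanging it
    with the zero at l + 1 yields an ascent, the only situation in which
    \<open>jack_poly_simple\<close> applies, and applying it there leads back to \<mu>.\<close>
  have step: "\<exists>f. jack_poly N \<alpha> \<mu> f"
    if "\<mu> \<in> compositions N" "weight N \<mu> = weight N \<eta>" "l \<in> {1..N}" "part \<mu> l > 0" "\<forall>j\<in>{l<..N}. part \<mu> j = 0"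
    for \<mu> l
    using that
  proof (induction "N - l" arbitrary: \<mu> l)
    case 0
    then have "l = N" by simp
    then obtain \<mu>' where \<mu>': "\<mu>' \<in> compositions N" "\<mu> = raise_exp N \<mu>'"
      using raise_exp_surj[OF assms(1) 0(2)] 0 by metis
    then have "weight N \<mu>' < weight N \<eta>" using 0(3) weight_raise[OF assms(1)] by simp
    then show ?case using less(1)[OF _ \<mu>'(1)] jack_poly_raise[OF assms(1)] \<mu>'(2) by blast
  next
    case (Suc n)
    let ?\<mu>' = "perm_exp (simple_transp l) \<mu>"
    have l: "1 \<le> l" "l < N" using Suc by auto
    then have s: "simple_transp l permutes {1..N}" by (rule simple_transp_permutes)
    have "part \<mu> (Suc l) = 0" using Suc l by auto
    then have p: "part ?\<mu>' l = 0" "part ?\<mu>' (Suc l) > 0" using Suc by (simp_all add: part_simple)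
    have c: "?\<mu>' \<in> compositions N" by (rule perm_exp_compositions[OF s Suc(3)])
    have "\<exists>f. jack_poly N \<alpha> ?\<mu>' f"
      using Suc(2) l p c Suc(4) Suc(7) weight_perm_exp[OF s]
      by (intro Suc(1)[of "Suc l"]) (auto simp: part_simple simple_transp_apply)
    then have "\<exists>f. jack_poly N \<alpha> (perm_exp (simple_transp l) ?\<mu>') f"
      using jack_poly_simple[OF assms(2) c l, of] p by fastforce
    then show ?case by (simp add: perm_exp_comp)
  qed
  show ?case
  proof (cases "\<eta> = 0")
    case True
    then show ?thesis using jack_poly_0 by blast
  next
    case False
    let ?L = "{j\<in>{1..N}. part \<eta> j > 0}"
    have "?L \<noteq> {}"
    proof
      assume "?L = {}"
      then have "part \<eta> j = part 0 j" if "j \<in> {1..N}" for j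
        using that by (simp add: set_eq_iff)
      then have "\<eta> = 0"
        by (intro compositions_eqI[OF less(2), of 0]) (simp_all add: compositions_def)
      with False show False ..
    qed
    then have "Max ?L \<in> ?L" by (intro Max_in) auto
    moreover have "\<forall>j\<in>{Max ?L<..N}. part \<eta> j = 0"
    proof (rule ballI, rule ccontr)
      fix j assume j: "j \<in> {Max ?L<..N}" "part \<eta> j \<noteq> 0"
      then have "j \<in> ?L" by auto
      then have "j \<le> Max ?L" by (intro Max_ge) auto
      then show False using j by simp
    qed
    ultimately show ?thesis using step[OF less(2) refl, of "Max ?L"] by blast
  qed
qed

text \<open>Needed for the sum in \<open>monic_triangular\<close>, which would be 0 over an infinite
  index set.\<close>

lemma finite_compositions_weight: "finite {\<nu> \<in> compositions N. weight N \<nu> = n}"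
proof (rule finite_imageD)
  have "part \<nu> j \<le> n" if "weight N \<nu> = n" "j \<in> {1..N}" for \<nu> j
    using that member_le_sum[of j "{1..N}" "part \<nu>"] by (simp add: weight_def)
  then have "Poly_Mapping.lookup ` {\<nu> \<in> compositions N. weight N \<nu> = n} \<subseteq>
      {g. \<forall>j. (j \<in> {1..N} \<longrightarrow> g j \<in> {..n}) \<and> (j \<notin> {1..N} \<longrightarrow> g j = 0)}"
    using part_outside by (auto simp del: atLeastAtMost_iff)
  then show "finite (Poly_Mapping.lookup ` {\<nu> \<in> compositions N. weight N \<nu> = n})"
    by (rule finite_subset) (rule finite_set_of_finite_funs; simp)
qed (simp add: inj_on_def poly_mapping_eqI)

lemma monic_triangular_iff:
  "monic_triangular N \<eta> f \<longleftrightarrow>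
    coef f \<eta> = 1 \<and> (\<forall>\<nu>\<in>Poly_Mapping.keys f. \<nu> = \<eta> \<or> \<nu> \<in> compositions N \<and> prec N \<nu> \<eta>)"
proof -
  let ?L = "{\<nu>. \<nu> \<in> compositions N \<and> prec N \<nu> \<eta>}"
  have fin: "finite ?L"
    by (rule finite_subset[OF _ finite_compositions_weight[of N "weight N \<eta>"]]) (auto simp: prec_def)
  have co: "coef (term_poly \<eta> 1 + (\<Sum>\<nu>\<in>?L. term_poly \<nu> (c \<nu>))) \<nu> =
      (if \<nu> = \<eta> then 1 else if \<nu> \<in> ?L then c \<nu> else 0)" for c \<nu>
    using fin not_prec_self by (simp add: lookup_add lookup_sum coef_term_poly sum.delta')
  show ?thesis
  proof
    assume "monic_triangular N \<eta> f"
    then obtain c where f: "f = term_poly \<eta> 1 + (\<Sum>\<nu>\<in>?L. term_poly \<nu> (c \<nu>))"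
      unfolding monic_triangular_def by blast
    show "coef f \<eta> = 1 \<and> (\<forall>\<nu>\<in>Poly_Mapping.keys f. \<nu> = \<eta> \<or> \<nu> \<in> compositions N \<and> prec N \<nu> \<eta>)"
      unfolding f in_keys_iff Ball_def co by auto
  next
    assume *: "coef f \<eta> = 1 \<and> (\<forall>\<nu>\<in>Poly_Mapping.keys f. \<nu> = \<eta> \<or> \<nu> \<in> compositions N \<and> prec N \<nu> \<eta>)"
    have "f = term_poly \<eta> 1 + (\<Sum>\<nu>\<in>?L. term_poly \<nu> (coef f \<nu>))"
      by (rule poly_mapping_eqI) (use * in \<open>auto simp: co in_keys_iff\<close>)
    then show "monic_triangular N \<eta> f" unfolding monic_triangular_def by blast
  qed
qed

lemma jack_poly_iff:
  assumes "\<alpha> > 0" "\<eta> \<in> compositions N"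
  shows "jack_poly N \<alpha> \<eta> f \<longleftrightarrow> monic_triangular N \<eta> f \<and>
    (\<forall>i\<in>{1..N}. cherednik N \<alpha> i f = const_poly (eigenval N \<alpha> \<eta> i) * f)"
proof
  assume f: "jack_poly N \<alpha> \<eta> f"
  then show "monic_triangular N \<eta> f \<and>
      (\<forall>i\<in>{1..N}. cherednik N \<alpha> i f = const_poly (eigenval N \<alpha> \<eta> i) * f)"
    using joint_eigen_support(2)[OF assms, of f]
    unfolding monic_triangular_iff jack_poly_def joint_eigen_def by (meson subsetD)
next
  assume "monic_triangular N \<eta> f \<and>
      (\<forall>i\<in>{1..N}. cherednik N \<alpha> i f = const_poly (eigenval N \<alpha> \<eta> i) * f)"
  then show "jack_poly N \<alpha> \<eta> f"
    using assms(2) unfolding monic_triangular_iff jack_poly_def joint_eigen_def by (metis subsetI)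
qed

lemma nonsym_jack_eq:
  assumes "\<alpha> > 0" "\<eta> \<in> compositions N" "jack_poly N \<alpha> \<eta> f"
  shows "nonsym_jack N \<alpha> \<eta> = f"
  unfolding nonsym_jack_def jack_poly_iff[OF assms(1,2), symmetric]
proof (rule the_equality)
  fix g assume "jack_poly N \<alpha> \<eta> g"
  then show "g = f" using joint_eigen_unique[OF assms, of g] by (simp add: jack_poly_def)
qed (rule assms(3))

lemma jack_poly_nonsym_jack:
  assumes "1 \<le> N" "\<alpha> > 0" "\<eta> \<in> compositions N"
  shows "jack_poly N \<alpha> \<eta> (nonsym_jack N \<alpha> \<eta>)"
  using jack_poly_exists[OF assms] nonsym_jack_eq[OF assms(2,3)] by metis

section \<open>Parabolic subgroups and rearrangements\<close>

lemma word_prod_simps [simp]: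
  "word_prod [] = id" "word_prod (k # ks) = simple_transp k \<circ> word_prod ks"
  by (simp_all add: word_prod_def)

lemma word_prod_append: "word_prod (as @ bs) = word_prod as \<circ> word_prod bs"
  by (induction as) (simp_all add: comp_assoc)

lemma simple_transp_permutes_subset:
  "K \<subseteq> {1..N - 1} \<Longrightarrow> k \<in> K \<Longrightarrow> simple_transp k permutes {1..N}"
  using subsetD[of K "{1..N - 1}" k] by (intro simple_transp_permutes) auto

text \<open>The generators are involutions, so words without inverses already form a group.\<close>

lemma W_group_iff_word:
  assumes "K \<subseteq> {1..N - 1}"
  shows "w \<in> W_group N K \<longleftrightarrow> (\<exists>ks. set ks \<subseteq> K \<and> w = word_prod ks)"
proof
  assume "w \<in> W_group N K"
  then show "\<exists>ks. set ks \<subseteq> K \<and> w = word_prod ks"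
    unfolding W_group_def
  proof induction
    case one
    show ?case by (rule exI[of _ "[]"]) (simp add: sym_group_def)
  next
    case (incl h)
    then obtain k where "k \<in> K" "h = simple_transp k" by blast
    then show ?case by (intro exI[of _ "[k]"]) simp
  next
    case (inv h)
    then obtain k where "k \<in> K" "h = simple_transp k" by blast
    then show ?case
      using simple_transp_permutes_subset[OF assms, of k]
      by (intro exI[of _ "[k]"]) (simp add: sym_group_carrier)
  next
    case (eng g h)
    then obtain as bs where "set as \<subseteq> K" "g = word_prod as" "set bs \<subseteq> K" "h = word_prod bs" by blast
    then show ?case by (intro exI[of _ "as @ bs"]) (simp add: sym_group_mult word_prod_append)
  qed
next
  assume "\<exists>ks. set ks \<subseteq> K \<and> w = word_prod ks"
  then obtain ks where ks: "set ks \<subseteq> K" "w = word_prod ks" by blast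
  have "word_prod ks \<in> W_group N K"
    using ks(1)
  proof (induction ks)
    case Nil
    show "word_prod [] \<in> W_group N K"
      using generate.one[of "sym_group N" "simple_transp ` K"] by (simp add: W_group_def sym_group_def)
  next
    case (Cons k ks)
    then show "word_prod (k # ks) \<in> W_group N K"
      using generate.eng[OF generate.incl, of "simple_transp k" "simple_transp ` K" "word_prod ks" "sym_group N"]
      by (simp add: W_group_def sym_group_mult)
  qed
  then show "w \<in> W_group N K" using ks by simp
qed

lemma W_group_induct [consumes 2, case_names id step]:
  assumes "K \<subseteq> {1..N - 1}" "w \<in> W_group N K" "P id"
    and "\<And>k w. k \<in> K \<Longrightarrow> w \<in> W_group N K \<Longrightarrow> P w \<Longrightarrow> P (simple_transp k \<circ> w)"
  shows "P w"
proof -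
  have "P (word_prod ks)" if "set ks \<subseteq> K" for ks
    using that assms(3,4) W_group_iff_word[OF assms(1)] by (induction ks) auto
  then show ?thesis using assms(2) W_group_iff_word[OF assms(1)] by auto
qed

lemma id_in_W: "K \<subseteq> {1..N - 1} \<Longrightarrow> id \<in> W_group N K"
  unfolding W_group_iff_word by (rule exI[of _ "[]"]) simp

lemma simple_in_W: "K \<subseteq> {1..N - 1} \<Longrightarrow> k \<in> K \<Longrightarrow> simple_transp k \<in> W_group N K"
  unfolding W_group_iff_word by (rule exI[of _ "[k]"]) simp

lemma comp_in_W:
  assumes "K \<subseteq> {1..N - 1}" "v \<in> W_group N K" "w \<in> W_group N K"
  shows "v \<circ> w \<in> W_group N K"
  using assms(2,3) unfolding W_group_iff_word[OF assms(1)] by (metis set_append word_prod_append Un_least)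

lemma W_permutes:
  assumes "K \<subseteq> {1..N - 1}" "w \<in> W_group N K"
  shows "w permutes {1..N}"
  using assms
proof (induction rule: W_group_induct)
  case id
  show ?case by (rule permutes_id)
next
  case (step k w)
  show ?case
    by (rule permutes_compose[OF step(3) simple_transp_permutes_subset[OF assms(1) step(1)]])
qed

lemma inv_in_W:
  assumes "K \<subseteq> {1..N - 1}" "w \<in> W_group N K"
  shows "inv' w \<in> W_group N K"
  using assms
proof (induction rule: W_group_induct)
  case id
  show "inv' id \<in> W_group N K" using id_in_W[OF assms(1)] by simp
next
  case (step k w)
  have "inv' (simple_transp k \<circ> w) = inv' w \<circ> simple_transp k"
    using permutes_bij[OF W_permutes[OF assms(1) step(2)]] by (simp add: o_inv_distrib)
  then show "inv' (simple_transp k \<circ> w) \<in> W_group N K"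
    using comp_in_W[OF assms(1) step(3) simple_in_W[OF assms(1) step(1)]] by simp
qed

lemma W_mono: "K \<subseteq> L \<Longrightarrow> L \<subseteq> {1..N - 1} \<Longrightarrow> w \<in> W_group N K \<Longrightarrow> w \<in> W_group N L"
  by (subst (asm) W_group_iff_word) (auto simp: W_group_iff_word)

lemma finite_W: "K \<subseteq> {1..N - 1} \<Longrightarrow> finite (W_group N K)"
  using W_permutes by (intro finite_subset[OF _ finite_permutations[of "{1..N}"]]) auto

lemma W_bij: "K \<subseteq> {1..N - 1} \<Longrightarrow> w \<in> W_group N K \<Longrightarrow> bij w"
  using W_permutes permutes_bij by blast

section \<open>Sorting within orbits of a parabolic subgroup\<close>

text \<open>No generator crosses the cut between q and q + 1.\<close>

lemma W_image_atMost:
  assumes "K \<subseteq> {1..N - 1}" "w \<in> W_group N K" "q \<notin> K"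
  shows "w ` {1..q} = {1..q}"
  using assms(1,2)
proof (induction rule: W_group_induct)
  case (step k w)
  have "simple_transp k ` {1..q} = {1..q}"
    unfolding simple_transp_def
    by (rule transpose_image_eq) (use step(1) assms(1,3) in \<open>auto simp: le_less Suc_le_eq less_Suc_eq\<close>)
  then show "(simple_transp k \<circ> w) ` {1..q} = {1..q}" using step(3) by (simp only: image_comp[symmetric])
qed simp

lemma antimono_chain:
  fixes f :: "nat \<Rightarrow> 'b::linorder"
  assumes "y \<le> p" "\<And>q. y \<le> q \<Longrightarrow> q < p \<Longrightarrow> f (Suc q) \<le> f q"
  shows "f p \<le> f y"
  using assms by (induction p rule: dec_induct) (auto intro: order_trans less_SucI)

text \<open>If some x > p lies in the image of \<open>{1..p}\<close>, then no cut can separate p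
  from x, so \<open>f\<close> decreases all the way from p to x; likewise for positions that the
  image misses. Thus f p is a threshold. The value type is general because \<open>f\<close> is later
  a natural part, a negated part, or a twisted part.\<close>

lemma W_partial_sum_le:
  fixes f :: "nat \<Rightarrow> 'b::linordered_semidom"
  assumes K: "K \<subseteq> {1..N - 1}" and w: "w \<in> W_group N K" and f: "\<And>k. k \<in> K \<Longrightarrow> f (Suc k) \<le> f k"
  shows "(\<Sum>j=1..p. f (w j)) \<le> (\<Sum>j=1..p. f j)"
proof -
  have inj: "inj_on w A" for A
    using W_bij[OF K w] by (meson bij_is_inj inj_on_subset subset_UNIV)
  have "(\<Sum>j=1..p. f (w j)) = sum f (w ` {1..p})" by (simp add: sum.reindex[OF inj])
  also have "\<dots> \<le> sum f {1..p}"
  proof (rule sum_le_threshold[OF _ _ card_image[OF inj], where c = "f p"])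
    fix x assume x: "x \<in> w ` {1..p} - {1..p}"
    have qK: "q \<in> K" if "p \<le> q" "q < x" for q
    proof (rule ccontr)
      assume "q \<notin> K"
      from W_image_atMost[OF K w this] have "w ` {1..p} \<subseteq> {1..q}"
        using image_mono[of "{1..p}" "{1..q}" w] that(1) by auto
      then show False using x that(2) by auto
    qed
    \<comment> \<open>Position 0 lies outside \<open>{1..p}\<close> but below p; it is ruled out
      because \<open>w\<close> fixes it.\<close>
    have "x \<noteq> 0"
    proof
      assume "x = 0"
      then obtain t where t: "t \<in> {1..p}" "w t = 0" using x by auto
      have "w 0 = 0" using permutes_not_in[OF W_permutes[OF K w], of 0] by simp
      then have "t = 0" using t(2) injD[OF permutes_inj[OF W_permutes[OF K w]], of t 0] by simp
      then show False using t(1) by simp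
    qed
    then have "p \<le> x" using x by simp
    then show "f x \<le> f p" by (rule antimono_chain) (use f qK in blast)
  next
    fix y assume y: "y \<in> {1..p} - w ` {1..p}"
    have qK: "q \<in> K" if "y \<le> q" "q < p" for q
    proof (rule ccontr)
      assume "q \<notin> K"
      from W_image_atMost[OF K w this] have "{1..q} \<subseteq> w ` {1..p}"
        using image_mono[of "{1..q}" "{1..p}" w] that(2) by auto
      then show False using y that(1) by auto
    qed
    have "y \<le> p" using y by simp
    then show "f p \<le> f y" by (rule antimono_chain) (use f qK in blast)
  qed simp_all
  finally show ?thesis .
qed

text \<open>The partial sum bound for \<open>w\<close>, and for its inverse applied to
  \<open>f \<circ> w\<close>, gives equality of all partial sums, and these determine the
  values.\<close>

lemma W_sorted_unique:
  fixes f :: "nat \<Rightarrow> 'b::linordered_semidom"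
  assumes K: "K \<subseteq> {1..N - 1}" and w: "w \<in> W_group N K"
    and f: "\<And>k. k \<in> K \<Longrightarrow> f (Suc k) \<le> f k" "\<And>k. k \<in> K \<Longrightarrow> f (w (Suc k)) \<le> f (w k)"
  shows "f (w j) = f j"
proof -
  have p: "w permutes {1..N}" by (rule W_permutes[OF K w])
  have eq: "(\<Sum>j=1..p. f (w j)) = (\<Sum>j=1..p. f j)" for p
  proof (rule antisym)
    show "(\<Sum>j=1..p. f (w j)) \<le> (\<Sum>j=1..p. f j)" by (rule W_partial_sum_le[OF K w]) (rule f(1))
    show "(\<Sum>j=1..p. f j) \<le> (\<Sum>j=1..p. f (w j))"
      using W_partial_sum_le[OF K inv_in_W[OF K w], of "f \<circ> w" p] f(2)
      by (simp add: permutes_inverses[OF p])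
  qed
  show ?thesis
  proof (cases j)
    case 0
    then show ?thesis using permutes_not_in[OF p, of 0] by simp
  next
    case (Suc i)
    then show ?thesis using eq[of i] eq[of "Suc i"] by simp
  qed
qed

text \<open>A minimizer of the position-weighted sum H is sorted: composing with s_k changes H by
  f(w k) - f(w(k + 1)), which minimality makes nonnegative. Integer values allow sorting upwards by
  negation.\<close>

lemma W_sort_exists:
  fixes f :: "nat \<Rightarrow> int"
  assumes K: "K \<subseteq> {1..N - 1}"
  obtains w where "w \<in> W_group N K" "\<And>k. k \<in> K \<Longrightarrow> f (w (Suc k)) \<le> f (w k)"
proof -
  define H where "H w = (\<Sum>j=1..N. int j * f (w j))" for w
  obtain w where w: "w \<in> W_group N K" "\<And>v. v \<in> W_group N K \<Longrightarrow> H w \<le> H v"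
    using ex_min_if_finite[of "H ` W_group N K"] finite_W[OF K] id_in_W[OF K]
    by (metis (no_types, lifting) finite_imageI image_iff empty_iff linorder_not_less)
  have "f (w (Suc k)) \<le> f (w k)" if k: "k \<in> K" for k
  proof -
    let ?s = "simple_transp k"
    have s: "?s permutes {1..N}" by (rule simple_transp_permutes_subset[OF K k])
    have kN: "{k, Suc k} \<subseteq> {1..N}" using subsetD[OF K k] by auto
    have "H (w \<circ> ?s) = (\<Sum>j=1..N. int (?s j) * f (w j))"
      unfolding H_def by (subst sum.permute[OF s]) (simp add: o_def)
    then have "H (w \<circ> ?s) - H w = (\<Sum>j=1..N. (int (?s j) - int j) * f (w j))"
      by (simp add: H_def sum_subtractf left_diff_distrib)
    also have "\<dots> = (\<Sum>j\<in>{k, Suc k}. (int (?s j) - int j) * f (w j))"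
      by (rule sum.mono_neutral_right) (use kN in \<open>auto simp: simple_transp_apply\<close>)
    also have "\<dots> = f (w k) - f (w (Suc k))" by simp
    finally show ?thesis using w(2)[OF comp_in_W[OF K w(1) simple_in_W[OF K k]]] by simp
  qed
  with w(1) show ?thesis by (rule that)
qed

lemma W_perm_exp_sort:
  assumes K: "K \<subseteq> {1..N - 1}"
  obtains w where "w \<in> W_group N K"
    "\<And>k. k \<in> K \<Longrightarrow> part (perm_exp w \<eta>) (Suc k) \<le> part (perm_exp w \<eta>) k"
proof -
  obtain v where v: "v \<in> W_group N K" "\<And>k. k \<in> K \<Longrightarrow> int (part \<eta> (v (Suc k))) \<le> int (part \<eta> (v k))"
    using W_sort_exists[OF K, of "\<lambda>x. int (part \<eta> x)"] by blast
  show ?thesis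
    using v W_bij[OF K v(1)]
    by (intro that[OF inv_in_W[OF K v(1)]]) (simp add: part_perm_exp bij_imp_bij_inv inv_inv_eq)
qed

lemma W_perm_exp_sort_up:
  assumes K: "K \<subseteq> {1..N - 1}"
  obtains w where "w \<in> W_group N K"
    "\<And>k. k \<in> K \<Longrightarrow> part (perm_exp w \<eta>) k \<le> part (perm_exp w \<eta>) (Suc k)"
proof -
  obtain v where v: "v \<in> W_group N K" "\<And>k. k \<in> K \<Longrightarrow> - int (part \<eta> (v (Suc k))) \<le> - int (part \<eta> (v k))"
    using W_sort_exists[OF K, of "\<lambda>x. - int (part \<eta> x)"] by blast
  show ?thesis
    using v W_bij[OF K v(1)]
    by (intro that[OF inv_in_W[OF K v(1)]]) (simp add: part_perm_exp bij_imp_bij_inv inv_inv_eq)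
qed

section \<open>Blocks of positions\<close>

text \<open>Stands for x and y lying in one W_K-orbit of positions. It is a pointwise equivalence
  relation that can be followed along words, which is harder with maximal runs.\<close>

definition connected_in :: "nat set \<Rightarrow> nat \<Rightarrow> nat \<Rightarrow> bool" where
  "connected_in K x y \<longleftrightarrow> (\<forall>q. min x y \<le> q \<and> q < max x y \<longrightarrow> q \<in> K)"

lemma connected_in_refl: "connected_in K x x"
  by (auto simp: connected_in_def)

lemma connected_in_sym: "connected_in K x y \<Longrightarrow> connected_in K y x"
  by (simp add: connected_in_def min.commute max.commute)

lemma connected_in_trans: "connected_in K x y \<Longrightarrow> connected_in K y z \<Longrightarrow> connected_in K x z"
  unfolding connected_in_def
proof (intro allI impI)
  fix q
  assume c: "\<forall>q. min x y \<le> q \<and> q < max x y \<longrightarrow> q \<in> K" "\<forall>q. min y z \<le> q \<and> q < max y z \<longrightarrow> q \<in> K"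
    and q: "min x z \<le> q \<and> q < max x z"
  from q have "min x y \<le> q \<and> q < max x y \<or> min y z \<le> q \<and> q < max y z" by linarith
  then show "q \<in> K" using c by blast
qed

lemma connected_in_simple: "k \<in> K \<Longrightarrow> connected_in K x (simple_transp k x)"
  by (auto simp: connected_in_def simple_transp_apply less_Suc_eq)

lemma connected_in_W: "K \<subseteq> {1..N - 1} \<Longrightarrow> w \<in> W_group N K \<Longrightarrow> connected_in K x (w x)"
  by (induction rule: W_group_induct)
     (simp_all only: id_apply o_apply connected_in_refl, blast intro: connected_in_trans connected_in_simple)

definition distinct_connected :: "nat set \<Rightarrow> exponents \<Rightarrow> bool" where
  "distinct_connected K \<eta> \<longleftrightarrow> (\<forall>x y. x \<noteq> y \<longrightarrow> connected_in K x y \<longrightarrow> part \<eta> x \<noteq> part \<eta> y)"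

text \<open>If x < y are connected, the interval \<open>{x..y - 1}\<close> lies in J and extends to
  a maximal run; it ends at y - 1 because a block has one position more than its run.\<close>

lemma distinct_on_blocks_iff:
  assumes "finite J"
  shows "distinct_on_blocks J \<eta> \<longleftrightarrow> distinct_connected J \<eta>"
proof
  assume d: "distinct_on_blocks J \<eta>"
  have "part \<eta> x \<noteq> part \<eta> y" if xy: "x < y" "connected_in J x y" for x y
  proof -
    let ?C = "{A. A \<subseteq> J \<and> consecutive A}"
    have sub: "{x..y - 1} \<subseteq> J" using xy unfolding connected_in_def by auto
    have mem: "{x..y - 1} \<in> ?C" using sub xy by (auto simp: consecutive_def)
    have "finite ?C" using assms by simp
    from finite_has_maximal2[OF this mem]
    obtain A where A: "A \<in> ?C" "{x..y - 1} \<subseteq> A" "\<forall>B\<in>?C. A \<subseteq> B \<longrightarrow> A = B"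
      by (elim bexE conjE)
    then have run: "A \<in> max_runs J" unfolding max_runs_def by auto
    have "x \<in> A" "y - 1 \<in> A" using A(2) xy by auto
    have finA: "finite A" using A(1) assms finite_subset by auto
    obtain a b where ab: "A = {a..b}" using A(1) by (auto simp: consecutive_def)
    have "A \<noteq> {}" using \<open>x \<in> A\<close> by auto
    then have "Max A = b" by (auto simp: ab intro!: Max_eqI)
    then have bl: "x \<in> block A" "y \<in> block A"
      using \<open>x \<in> A\<close> \<open>y - 1 \<in> A\<close> xy unfolding block_def by (auto simp: ab)
    from d[unfolded distinct_on_blocks_def, rule_format, OF run bl] show ?thesis using xy(1) by simp
  qed
  then show "distinct_connected J \<eta>"
    unfolding distinct_connected_def by (metis connected_in_sym linorder_neqE_nat)
next
  assume d: "distinct_connected J \<eta>"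
  show "distinct_on_blocks J \<eta>"
    unfolding distinct_on_blocks_def
  proof (intro ballI impI)
    fix A x y assume A: "A \<in> max_runs J" and xy: "x \<in> block A" "y \<in> block A" "x \<noteq> y"
    then obtain a b where ab: "A = {a..b}" "a \<le> b" "A \<subseteq> J"
      by (auto simp: max_runs_def consecutive_def)
    then have "Max A = b" by (auto intro!: Max_eqI)
    then have "x \<in> {a..Suc b}" "y \<in> {a..Suc b}" using xy ab by (auto simp: block_def)
    then have "q \<in> {a..b}" if "min x y \<le> q \<and> q < max x y" for q
      using that by auto
    then have "connected_in J x y" using ab unfolding connected_in_def by blast
    then show "part \<eta> x \<noteq> part \<eta> y" using d xy(3) unfolding distinct_connected_def by blast
  qed
qed

definition support :: "nat set \<Rightarrow> nat set" where
  "support K = K \<union> Suc ` K"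

lemma connected_in_support: "connected_in K x y \<Longrightarrow> x \<noteq> y \<Longrightarrow> x \<in> support K"
proof -
  assume c: "connected_in K x y" "x \<noteq> y"
  show ?thesis
  proof (cases "x < y")
    case True
    then have "x \<in> K" using c by (simp add: connected_in_def)
    then show ?thesis by (simp add: support_def)
  next
    case False
    then have "x - 1 \<in> K" "x = Suc (x - 1)" using c by (auto simp: connected_in_def)
    then show ?thesis unfolding support_def by blast
  qed
qed

lemma W_fixes: "K \<subseteq> {1..N - 1} \<Longrightarrow> w \<in> W_group N K \<Longrightarrow> x \<notin> support K \<Longrightarrow> w x = x"
  using connected_in_W connected_in_support by metis

text \<open>The conditions on i - 1 and j - 1 take the form of successor conditions for the other
  set, which avoids truncated subtraction. With disjointness they say that the two supports are
  disjoint.\<close>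

locale separated_subsets =
  fixes N :: nat and I J :: "nat set"
  assumes N_pos: "1 \<le> N" and I_sub: "I \<subseteq> {1..N - 1}" and J_sub: "J \<subseteq> {1..N - 1}"
    and disjoint: "I \<inter> J = {}"
    and separated: "\<And>i. i \<in> I \<Longrightarrow> Suc i \<notin> J" "\<And>j. j \<in> J \<Longrightarrow> Suc j \<notin> I"
begin

abbreviation "W \<equiv> W_group N (I \<union> J)"

lemma IJ_sub: "I \<union> J \<subseteq> {1..N - 1}"
  using I_sub J_sub by simp

lemma support_disjoint: "x \<in> support I \<Longrightarrow> x \<notin> support J"
  using separated disjoint by (auto simp: support_def)

lemma WI_in_W: "w \<in> W_group N I \<Longrightarrow> w \<in> W" and WJ_in_W: "w \<in> W_group N J \<Longrightarrow> w \<in> W"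
  using W_mono[OF _ IJ_sub] by blast+

lemma simple_fixes:
  "i \<in> I \<Longrightarrow> x \<in> support J \<Longrightarrow> simple_transp i x = x"
  "j \<in> J \<Longrightarrow> x \<in> support I \<Longrightarrow> simple_transp j x = x"
  using W_fixes[OF I_sub simple_in_W[OF I_sub]] W_fixes[OF J_sub simple_in_W[OF J_sub]] support_disjoint
  by blast+

lemma simple_support: "k \<in> K \<Longrightarrow> simple_transp k x \<in> support K \<longleftrightarrow> x \<in> support K"
  by (auto simp: simple_transp_apply support_def)

lemma simple_support_IJ:
  assumes "k \<in> I \<union> J"
  shows "simple_transp k x \<in> support I \<longleftrightarrow> x \<in> support I"
    and "simple_transp k x \<in> support J \<longleftrightarrow> x \<in> support J"
  using assms simple_support simple_fixes simple_transp_twice by (metis Un_iff)+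

lemma W_support:
  assumes "w \<in> W"
  shows "w x \<in> support I \<longleftrightarrow> x \<in> support I" and "w x \<in> support J \<longleftrightarrow> x \<in> support J"
proof -
  have "(w x \<in> support I \<longleftrightarrow> x \<in> support I) \<and> (w x \<in> support J \<longleftrightarrow> x \<in> support J)"
    using IJ_sub assms by (induction rule: W_group_induct) (simp_all only: simple_support_IJ o_apply id_apply simp_thms)
  then show "w x \<in> support I \<longleftrightarrow> x \<in> support I" "w x \<in> support J \<longleftrightarrow> x \<in> support J" by simp_all
qed

lemma simple_commute:
  assumes "i \<in> I" "j \<in> J"
  shows "simple_transp i \<circ> simple_transp j = simple_transp j \<circ> simple_transp i"
proof
  fix x
  show "(simple_transp i \<circ> simple_transp j) x = (simple_transp j \<circ> simple_transp i) x"
    using assms separated[of i] separated[of j] disjoint by (auto simp: simple_transp_apply)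
qed

section \<open>The sign character\<close>

text \<open>The parity of J-letters equals the sign of \<open>r w\<close>, the restriction of
  \<open>w\<close> to the support of J, and therefore depends on the permutation alone. This settles
  the choice of word in \<open>det_J\<close> without any appeal to braid relations.\<close>

lemma det_J_word:
  assumes "set ks \<subseteq> I \<union> J"
  shows "det_J I J (word_prod ks) = (-1) ^ length (filter (\<lambda>k. k \<in> J) ks)"
proof -
  define r where "r w = (\<lambda>x. if x \<in> support J then w x else (x::nat))" for w :: "nat \<Rightarrow> nat"
  have main: "permutation (r (word_prod as)) \<and> of_int (sign (r (word_prod as))) = ((-1) ^ length (filter (\<lambda>k. k \<in> J) as) :: real)"
    if "set as \<subseteq> I \<union> J" for as
    using that
  proof (induction as)
    case Nil
    then show ?case by (simp add: r_def sign_id[unfolded id_def] permutation_id[unfolded id_def])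
  next
    case (Cons k as)
    let ?w = "word_prod as"
    have k: "k \<in> I \<union> J" and w: "?w \<in> W"
      using Cons(2) W_group_iff_word[OF IJ_sub] by auto
    \<comment> \<open>Restriction is multiplicative because every element of W preserves the support
      of J.\<close>
    have rc: "r (simple_transp k \<circ> ?w) = r (simple_transp k) \<circ> r ?w"
      using W_support(2)[OF w] by (auto simp: r_def fun_eq_iff)
    have rk: "r (simple_transp k) = (if k \<in> J then simple_transp k else id)"
    proof (cases "k \<in> J")
      case True
      then show ?thesis using W_fixes[OF J_sub simple_in_W[OF J_sub True]] by (auto simp: r_def)
    next
      case False
      then show ?thesis using k simple_fixes(1) by (auto simp: r_def)
    qed
    have pk: "permutation (r (simple_transp k))"
      unfolding rk by (simp add: simple_transp_def permutation_swap_id)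
    have "of_int (sign (r (simple_transp k))) = (if k \<in> J then -1 else 1 :: real)"
      unfolding rk by (simp add: simple_transp_def sign_swap_id sign_id)
    then show "permutation (r (word_prod (k # as))) \<and>
        of_int (sign (r (word_prod (k # as)))) = ((-1) ^ length (filter (\<lambda>k. k \<in> J) (k # as)) :: real)"
      using Cons pk by (simp add: rc permutation_compose sign_compose)
  qed
  define as where "as = (SOME as. set as \<subseteq> I \<union> J \<and> word_prod as = word_prod ks)"
  have "set as \<subseteq> I \<union> J \<and> word_prod as = word_prod ks"
    unfolding as_def by (rule someI[of _ ks]) (simp add: assms)
  then show ?thesis
    using main[of as] main[OF assms] unfolding det_J_def as_def[symmetric] by simp
qed

lemma det_J_comp:
  assumes "v \<in> W" "w \<in> W"
  shows "det_J I J (v \<circ> w) = det_J I J v * det_J I J w"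
proof -
  obtain as bs where "set as \<subseteq> I \<union> J" "v = word_prod as" "set bs \<subseteq> I \<union> J" "w = word_prod bs"
    using assms W_group_iff_word[OF IJ_sub] by metis
  then show ?thesis
    using det_J_word[of "as @ bs"] by (simp add: word_prod_append det_J_word power_add)
qed

lemma det_J_id [simp]: "det_J I J id = 1"
  using det_J_word[of "[]"] by simp

lemma det_J_simple: "k \<in> I \<union> J \<Longrightarrow> det_J I J (simple_transp k) = (if k \<in> J then -1 else 1)"
  using det_J_word[of "[k]"] by simp

lemma det_J_WI: "w \<in> W_group N I \<Longrightarrow> det_J I J w = 1"
  using I_sub
proof (induction rule: W_group_induct)
  case (step k w)
  then show "det_J I J (simple_transp k \<circ> w) = 1"
    using disjoint det_J_comp[OF WI_in_W[OF simple_in_W[OF I_sub step(1)]] WI_in_W[OF step(2)]]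
    by (auto simp: det_J_simple)
qed (rule det_J_id)

lemma det_J_square:
  assumes "w \<in> W"
  shows "det_J I J w * det_J I J w = 1"
proof -
  obtain ks where "set ks \<subseteq> I \<union> J" "w = word_prod ks" using assms W_group_iff_word[OF IJ_sub] by metis
  then show ?thesis by (simp add: det_J_word flip: power_add mult_2)
qed

lemma det_J_inv:
  assumes "w \<in> W"
  shows "det_J I J (inv' w) = det_J I J w"
proof -
  have "det_J I J (inv' w) * det_J I J w = 1"
    using det_J_comp[OF inv_in_W[OF IJ_sub assms] assms] W_bij[OF IJ_sub assms]
    by (simp add: bij_is_inj)
  then show ?thesis using det_J_square[OF assms] by (metis mult.assoc mult_1 mult_1_right)
qed

lemma distinct_simple:
  assumes "k \<in> I \<union> J" "distinct_connected J \<eta>"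
  shows "distinct_connected J (perm_exp (simple_transp k) \<eta>)"
  unfolding distinct_connected_def
proof (intro allI impI)
  fix x y assume xy: "x \<noteq> y" "connected_in J x y"
  let ?s = "simple_transp k"
  have "connected_in J (?s x) (?s y)"
  proof (cases "k \<in> J")
    case True
    then show ?thesis
      using xy(2) connected_in_simple connected_in_sym connected_in_trans by metis
  next
    case False
    then have "?s x = x" "?s y = y"
      using assms(1) xy connected_in_support connected_in_sym simple_fixes(1) by (metis Un_iff)+
    then show ?thesis using xy(2) by simp
  qed
  moreover have "?s x \<noteq> ?s y" using xy(1) by (metis simple_transp_twice)
  ultimately show "part (perm_exp ?s \<eta>) x \<noteq> part (perm_exp ?s \<eta>) y"
    using assms(2) unfolding distinct_connected_def part_simple by blast
qed

lemma distinct_W: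
  assumes "w \<in> W" "distinct_connected J \<eta>"
  shows "distinct_connected J (perm_exp w \<eta>)"
  using IJ_sub assms(1)
proof (induction rule: W_group_induct)
  case id
  show "distinct_connected J (perm_exp id \<eta>)" using assms(2) by simp
next
  case (step k w)
  then show "distinct_connected J (perm_exp (simple_transp k \<circ> w) \<eta>)"
    using distinct_simple[OF step(1,3)] W_bij[OF IJ_sub step(2)] by (simp add: perm_exp_comp)
qed

lemma distinct_adjacent: "distinct_connected J \<eta> \<Longrightarrow> j \<in> J \<Longrightarrow> part \<eta> j \<noteq> part \<eta> (Suc j)"
  unfolding distinct_connected_def using connected_in_simple[of j J j] by force

text \<open>
  The twist turns any combination of ascending, descending or ignored order on the two supports into
  descending order, so that one uniqueness statement serves all choices of \<open>\<epsilon>\<^sub>I\<close> and \<open>\<epsilon>\<^sub>J\<close>.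
\<close>
definition twist :: "int \<Rightarrow> int \<Rightarrow> exponents \<Rightarrow> nat \<Rightarrow> int" where
  "twist c d \<mu> x = (if x \<in> support I then c else d) * int (part \<mu> x)"

lemma twist_unique:
  assumes w: "w \<in> W"
    and "\<And>i. i \<in> I \<Longrightarrow> c * int (part \<mu> (Suc i)) \<le> c * int (part \<mu> i)"
    and "\<And>j. j \<in> J \<Longrightarrow> d * int (part \<mu> (Suc j)) \<le> d * int (part \<mu> j)"
    and "\<And>i. i \<in> I \<Longrightarrow> c * int (part (perm_exp w \<mu>) (Suc i)) \<le> c * int (part (perm_exp w \<mu>) i)"
    and "\<And>j. j \<in> J \<Longrightarrow> d * int (part (perm_exp w \<mu>) (Suc j)) \<le> d * int (part (perm_exp w \<mu>) j)"
  shows "twist c d (perm_exp w \<mu>) x = twist c d \<mu> x"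
proof -
  have v: "inv' w \<in> W" by (rule inv_in_W[OF IJ_sub w])
  have tw: "twist c d (perm_exp w \<mu>) x = twist c d \<mu> (inv' w x)" for x
    using W_support(1)[OF v] W_bij[OF IJ_sub w] by (simp add: twist_def part_perm_exp)
  have sI: "i \<in> support I" "Suc i \<in> support I" if "i \<in> I" for i
    using that by (auto simp: support_def)
  have sJ: "j \<notin> support I" "Suc j \<notin> support I" if "j \<in> J" for j
    using that support_disjoint by (auto simp: support_def)
  have "twist c d \<mu> (Suc k) \<le> twist c d \<mu> k" if "k \<in> I \<union> J" for k
    using that assms(2,3) sI sJ by (auto simp: twist_def)
  moreover have "twist c d \<mu> (inv' w (Suc k)) \<le> twist c d \<mu> (inv' w k)" if "k \<in> I \<union> J" for k
    unfolding tw[symmetric] using that assms(4,5) sI sJ by (auto simp: twist_def)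
  ultimately show ?thesis
    unfolding tw by (intro W_sorted_unique[OF IJ_sub v]) auto
qed

lemma twist_unique_eq:
  assumes "w \<in> W" "c \<noteq> 0" "d \<noteq> 0"
    and "\<And>i. i \<in> I \<Longrightarrow> c * int (part \<mu> (Suc i)) \<le> c * int (part \<mu> i)"
    and "\<And>j. j \<in> J \<Longrightarrow> d * int (part \<mu> (Suc j)) \<le> d * int (part \<mu> j)"
    and "\<And>i. i \<in> I \<Longrightarrow> c * int (part (perm_exp w \<mu>) (Suc i)) \<le> c * int (part (perm_exp w \<mu>) i)"
    and "\<And>j. j \<in> J \<Longrightarrow> d * int (part (perm_exp w \<mu>) (Suc j)) \<le> d * int (part (perm_exp w \<mu>) j)"
  shows "perm_exp w \<mu> = \<mu>"
proof (rule poly_mapping_eqI)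
  fix x
  show "part (perm_exp w \<mu>) x = part \<mu> x"
    using twist_unique[OF assms(1,4-7), of x] assms(2,3) by (simp add: twist_def split: if_splits)
qed

lemma orbit_perm_exp:
  assumes "w \<in> W"
  shows "orbit N (I \<union> J) (perm_exp w \<eta>) = orbit N (I \<union> J) \<eta>"
proof -
  have b: "bij v" if "v \<in> W" for v using W_bij[OF IJ_sub that] .
  have "perm_exp v (perm_exp w \<eta>) \<in> orbit N (I \<union> J) \<eta>" if "v \<in> W" for v
    using comp_in_W[OF IJ_sub that assms] by (auto simp: orbit_def perm_exp_comp b that assms)
  moreover have "perm_exp v \<eta> \<in> orbit N (I \<union> J) (perm_exp w \<eta>)" if v: "v \<in> W" for v
  proof -
    have iw: "inv' w \<in> W" by (rule inv_in_W[OF IJ_sub assms])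
    have "perm_exp v \<eta> = perm_exp (v \<circ> inv' w) (perm_exp w \<eta>)"
      using perm_exp_inv_cancel[OF b[OF assms], of \<eta>]
      by (simp add: perm_exp_comp[symmetric] b v iw)
    then show ?thesis using comp_in_W[OF IJ_sub v iw] unfolding orbit_def by blast
  qed
  ultimately show ?thesis unfolding orbit_def by auto
qed

lemma orbit_pair:
  assumes "\<mu> \<in> orbit N (I \<union> J) \<eta>" "\<nu> \<in> orbit N (I \<union> J) \<eta>"
  obtains w where "w \<in> W" "\<nu> = perm_exp w \<mu>"
proof -
  obtain v where "v \<in> W" "\<mu> = perm_exp v \<eta>" using assms(1) unfolding orbit_def by blast
  then have "\<nu> \<in> orbit N (I \<union> J) \<mu>" using assms(2) orbit_perm_exp by simp
  then show ?thesis using that unfolding orbit_def by blast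
qed

lemma rearr_Minus_Plus:
  assumes "\<mu> \<in> orbit N (I \<union> J) \<eta>"
    "\<And>i. i \<in> I \<Longrightarrow> part \<mu> i \<le> part \<mu> (Suc i)" "\<And>j. j \<in> J \<Longrightarrow> part \<mu> (Suc j) < part \<mu> j"
  shows "rearr N I J Minus Plus \<eta> = \<mu>"
  unfolding rearr_def epsilon.case
proof (rule the_equality)
  fix \<nu> assume \<nu>: "\<nu> \<in> orbit N (I \<union> J) \<eta> \<and> (\<forall>i\<in>I. part \<nu> i \<le> part \<nu> (i + 1)) \<and> (\<forall>j\<in>J. part \<nu> (j + 1) < part \<nu> j)"
  then obtain w where w: "w \<in> W" "\<nu> = perm_exp w \<mu>" using orbit_pair[OF assms(1)] by blast
  show "\<nu> = \<mu>"
    unfolding w(2) by (rule twist_unique_eq[OF w(1), of "-1" 1]) (use \<nu> w(2) assms in \<open>auto simp: less_imp_le\<close>)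
qed (use assms in simp)

lemma rearr_Minus_Minus:
  assumes "\<mu> \<in> orbit N (I \<union> J) \<eta>"
    "\<And>i. i \<in> I \<Longrightarrow> part \<mu> i \<le> part \<mu> (Suc i)" "\<And>j. j \<in> J \<Longrightarrow> part \<mu> j < part \<mu> (Suc j)"
  shows "rearr N I J Minus Minus \<eta> = \<mu>"
  unfolding rearr_def epsilon.case
proof (rule the_equality)
  fix \<nu> assume \<nu>: "\<nu> \<in> orbit N (I \<union> J) \<eta> \<and> (\<forall>i\<in>I. part \<nu> i \<le> part \<nu> (i + 1)) \<and> (\<forall>j\<in>J. part \<nu> j < part \<nu> (j + 1))"
  then obtain w where w: "w \<in> W" "\<nu> = perm_exp w \<mu>" using orbit_pair[OF assms(1)] by blast
  show "\<nu> = \<mu>"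
    unfolding w(2) by (rule twist_unique_eq[OF w(1), of "-1" "-1"]) (use \<nu> w(2) assms in \<open>auto simp: less_imp_le\<close>)
qed (use assms in simp)

lemma eta_star_eqI:
  assumes "\<mu> \<in> orbit N (I \<union> J) \<eta>"
    "\<And>i. i \<in> I \<Longrightarrow> part \<mu> (Suc i) \<le> part \<mu> i" "\<And>j. j \<in> J \<Longrightarrow> part \<mu> (Suc j) < part \<mu> j"
  shows "eta_star N I J \<eta> = \<mu>"
  unfolding eta_star_def
proof (rule the_equality)
  fix \<nu> assume \<nu>: "\<nu> \<in> orbit N (I \<union> J) \<eta> \<and> (\<forall>i\<in>I. part \<nu> (i + 1) \<le> part \<nu> i) \<and> (\<forall>j\<in>J. part \<nu> (j + 1) < part \<nu> j)"
  then obtain w where w: "w \<in> W" "\<nu> = perm_exp w \<mu>" using orbit_pair[OF assms(1)] by blast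
  show "\<nu> = \<mu>"
    unfolding w(2) by (rule twist_unique_eq[OF w(1), of 1 1]) (use \<nu> w(2) assms in \<open>auto simp: less_imp_le\<close>)
qed (use assms in simp)

lemma rearr_Zero_Plus:
  assumes "\<mu> \<in> orbit N (I \<union> J) \<eta>"
    "\<And>i. i \<in> support I \<Longrightarrow> part \<mu> i = part \<eta> i" "\<And>j. j \<in> J \<Longrightarrow> part \<mu> (Suc j) < part \<mu> j"
  shows "rearr N I J Zero Plus \<eta> = \<mu>"
  unfolding rearr_def epsilon.case
proof (rule the_equality)
  fix \<nu> assume \<nu>: "\<nu> \<in> orbit N (I \<union> J) \<eta> \<and>
    (\<forall>i\<in>I. part \<nu> i = part \<eta> i \<and> part \<nu> (i + 1) = part \<eta> (i + 1)) \<and> (\<forall>j\<in>J. part \<nu> (j + 1) < part \<nu> j)"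
  then obtain w where w: "w \<in> W" "\<nu> = perm_exp w \<mu>" using orbit_pair[OF assms(1)] by blast
  \<comment> \<open>Weight 0 makes the order conditions on the support of I trivial; there both
    candidates are compared with \<eta> directly.\<close>
  have tw: "twist 0 1 \<nu> x = twist 0 1 \<mu> x" for x
    unfolding w(2) by (rule twist_unique[OF w(1)]) (use \<nu> w(2) assms(3) in \<open>auto simp: less_imp_le\<close>)
  show "\<nu> = \<mu>"
  proof (rule poly_mapping_eqI)
    fix x
    show "part \<nu> x = part \<mu> x"
    proof (cases "x \<in> support I")
      case True
      then show ?thesis using \<nu> assms(2)[OF True] by (auto simp: support_def)
    next
      case False
      then show ?thesis using tw[of x] by (simp add: twist_def)
    qed
  qed
qed (use assms in \<open>auto simp: support_def\<close>)

section \<open>Decomposition of the group and stabilizers\<close>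

text \<open>Letters from I commute with letters from J, so the latter can be moved to the right end
  of a word.\<close>

lemma W_decompose:
  assumes "w \<in> W"
  obtains u v where "u \<in> W_group N I" "v \<in> W_group N J" "w = u \<circ> v"
proof -
  have "\<exists>u\<in>W_group N I. \<exists>v\<in>W_group N J. w = u \<circ> v"
    using IJ_sub assms
  proof (induction rule: W_group_induct)
    case id
    then show ?case using id_in_W[OF I_sub] id_in_W[OF J_sub] by (metis comp_id)
  next
    case (step k w)
    then obtain u v where uv: "u \<in> W_group N I" "v \<in> W_group N J" "w = u \<circ> v" by blast
    show ?case
    proof (cases "k \<in> I")
      case True
      have "simple_transp k \<circ> w = (simple_transp k \<circ> u) \<circ> v" by (simp add: uv(3) comp_assoc)
      then show ?thesis using uv comp_in_W[OF I_sub simple_in_W[OF I_sub True] uv(1)] by blast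
    next
      case False
      then have k: "k \<in> J" using step(1) by simp
      have "simple_transp k \<circ> u = u \<circ> simple_transp k"
        using I_sub uv(1)
      proof (induction rule: W_group_induct)
        case (step i u)
        then show ?case using simple_commute[OF step(1) k] by (metis comp_assoc)
      qed simp
      then have "simple_transp k \<circ> w = u \<circ> (simple_transp k \<circ> v)" by (simp add: uv(3) comp_assoc[symmetric])
      then show ?thesis using uv comp_in_W[OF J_sub simple_in_W[OF J_sub k] uv(2)] by blast
    qed
  qed
  then show ?thesis using that by blast
qed

text \<open>On the support of J the factor from W_I is the identity, so the factor from W_J must
  preserve the entries there; distinctness within blocks makes it trivial. Stabilizers therefore
  have sign 1 and cannot cause cancellation.\<close>

lemma stabilizer_in_WI:
  assumes "w \<in> W" "perm_exp w \<mu> = \<mu>" "distinct_connected J \<mu>"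
  shows "w \<in> W_group N I"
proof -
  obtain u v where uv: "u \<in> W_group N I" "v \<in> W_group N J" "w = u \<circ> v"
    using W_decompose[OF assms(1)] by blast
  have bu: "bij u" and bv: "bij v" using uv W_bij I_sub J_sub by auto
  have iv: "inv' v \<in> W_group N J" by (rule inv_in_W[OF J_sub uv(2)])
  have e: "perm_exp v \<mu> = perm_exp (inv' u) \<mu>"
    using assms(2) by (simp add: uv(3) perm_exp_comp[symmetric] bu bv perm_exp_eq_iff)
  have "part \<mu> (inv' v x) = part \<mu> x" for x
  proof (cases "x \<in> support J")
    case True
    then have "u x = x" using W_fixes[OF I_sub uv(1)] support_disjoint by blast
    moreover have "part \<mu> (inv' v x) = part \<mu> (u x)"
      using e part_perm_exp[OF bv, of \<mu> x] part_perm_exp[OF bij_imp_bij_inv[OF bu], of \<mu> x]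
      by (simp add: inv_inv_eq bu)
    ultimately show ?thesis by simp
  next
    case False
    then show ?thesis using W_fixes[OF J_sub iv] by simp
  qed
  then have "inv' v x = x" for x
    using assms(3) connected_in_W[OF J_sub iv, of x] unfolding distinct_connected_def by metis
  then have "v = id" by (metis bv bij_inv_eq_iff eq_id_iff)
  then show ?thesis using uv by simp
qed

text \<open>Conjugation by s_k exchanges the two stabilizers and preserves W_I, since s_k lies in
  W_I or commutes with it.\<close>

lemma stab_card_simple:
  assumes k: "k \<in> I \<union> J"
  shows "stab_card N I (perm_exp (simple_transp k) \<eta>) = stab_card N I \<eta>"
proof -
  let ?s = "simple_transp k"
  have conj: "?s \<circ> w \<circ> ?s \<in> W_group N I" if w: "w \<in> W_group N I" for w
  proof (cases "k \<in> I")
    case True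
    then show ?thesis using w comp_in_W[OF I_sub] simple_in_W[OF I_sub True] by blast
  next
    case False
    then have kJ: "k \<in> J" using k by simp
    have "?s \<circ> w = w \<circ> ?s"
      using I_sub w
    proof (induction rule: W_group_induct)
      case (step i u)
      then show ?case using simple_commute[OF step(1) kJ] by (metis comp_assoc)
    qed simp
    then show ?thesis using w by (simp add: comp_assoc)
  qed
  have stab: "perm_exp (?s \<circ> w \<circ> ?s) (perm_exp ?s \<mu>) = perm_exp ?s \<mu>"
    if "w \<in> W_group N I" "perm_exp w \<mu> = \<mu>" for w \<mu>
  proof -
    have "bij w" using W_bij[OF I_sub that(1)] .
    then have "perm_exp (?s \<circ> w \<circ> ?s) (perm_exp ?s \<mu>) = perm_exp ?s (perm_exp w \<mu>)"
      by (simp add: perm_exp_comp comp_assoc bij_comp)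
    then show ?thesis using that(2) by simp
  qed
  have inv: "?s \<circ> (?s \<circ> w \<circ> ?s) \<circ> ?s = w" for w :: "nat \<Rightarrow> nat"
    by (simp add: comp_assoc) (simp flip: comp_assoc)
  have ss: "perm_exp ?s (perm_exp ?s \<eta>) = \<eta>" by (simp add: perm_exp_comp)
  have "bij_betw (\<lambda>w. ?s \<circ> w \<circ> ?s) {w \<in> W_group N I. perm_exp w \<eta> = \<eta>}
      {w \<in> W_group N I. perm_exp w (perm_exp ?s \<eta>) = perm_exp ?s \<eta>}"
    using conj stab[of _ \<eta>] stab[of _ "perm_exp ?s \<eta>"] inv
    by (intro bij_betw_byWitness[where f' = "\<lambda>w. ?s \<circ> w \<circ> ?s"]) (auto simp: ss)
  then show ?thesis unfolding stab_card_def by (rule bij_betw_same_card[symmetric])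
qed

lemma stab_card_W:
  assumes "w \<in> W"
  shows "stab_card N I (perm_exp w \<eta>) = stab_card N I \<eta>"
  using IJ_sub assms
proof (induction rule: W_group_induct)
  case id
  show "stab_card N I (perm_exp id \<eta>) = stab_card N I \<eta>" by simp
next
  case (step k w)
  then show "stab_card N I (perm_exp (simple_transp k \<circ> w) \<eta>) = stab_card N I \<eta>"
    using stab_card_simple[OF step(1), of "perm_exp w \<eta>"] W_bij[OF IJ_sub step(2)] by (simp add: perm_exp_comp)
qed

section \<open>The symmetrizing operator as a signed group sum\<close>

lemma sym_op_eq: "sym_op N I J f = (\<Sum>w\<in>W. const_poly (det_J I J w) * perm_poly w f)"
proof -
  have a1: "additive (\<lambda>f. \<Sum>w\<in>W. const_poly (det_J I J w) * perm_poly w f)"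
    by (intro additive_sum additive_compose[OF additive_mult_left] additive_perm_poly)
  have a2: "additive (sym_op N I J)"
    unfolding sym_op_def by (rule additive_sum_keys) (simp add: const_poly_add distrib_right)
  show ?thesis
  proof (rule additive_eqI[OF a2 a1])
    fix \<nu> c
    have "sym_op N I J (term_poly \<nu> c) =
        const_poly c * (\<Sum>w\<in>W. const_poly (det_J I J w) * term_poly (perm_exp w \<nu>) 1)"
      unfolding sym_op_def by (rule sum_keys_term) simp
    then show "sym_op N I J (term_poly \<nu> c) = (\<Sum>w\<in>W. const_poly (det_J I J w) * perm_poly w (term_poly \<nu> c))"
      by (simp add: sum_distrib_left const_poly_term mult.commute)
  qed
qed

lemma sym_op_diff: "sym_op N I J (f - g) = sym_op N I J f - sym_op N I J g"
  unfolding sym_op_eq by (simp add: perm_poly_diff right_diff_distrib sum_subtractf)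

lemma sym_op_const_mult: "sym_op N I J (const_poly c * f) = const_poly c * sym_op N I J f"
  unfolding sym_op_eq
  by (auto simp: sum_distrib_left perm_poly_mult W_bij[OF IJ_sub] mult.left_commute intro!: sum.cong)

lemma sym_op_simple:
  assumes "k \<in> I \<union> J"
  shows "sym_op N I J (perm_poly (simple_transp k) f) = const_poly (if k \<in> J then -1 else 1) * sym_op N I J f"
proof -
  let ?s = "simple_transp k"
  have s: "?s \<in> W" by (rule simple_in_W[OF IJ_sub assms])
  have ss: "w \<circ> ?s \<circ> ?s = w" for w :: "nat \<Rightarrow> nat" by (simp add: comp_assoc)
  have "sym_op N I J (perm_poly ?s f) = (\<Sum>w\<in>W. const_poly (det_J I J w) * perm_poly (w \<circ> ?s) f)"
    unfolding sym_op_eq by (intro sum.cong) (simp_all add: perm_poly_comp W_bij[OF IJ_sub])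
  also have "\<dots> = (\<Sum>w\<in>W. const_poly (det_J I J (w \<circ> ?s)) * perm_poly w f)"
    by (rule sum.reindex_bij_witness[of _ "\<lambda>w. w \<circ> ?s" "\<lambda>w. w \<circ> ?s"])
       (auto simp: ss intro: comp_in_W[OF IJ_sub _ s])
  also have "\<dots> = const_poly (if k \<in> J then -1 else 1) * sym_op N I J f"
    unfolding sym_op_eq sum_distrib_left
    by (intro sum.cong) (simp_all add: det_J_comp s det_J_simple[OF assms] const_poly_uminus)
  finally show ?thesis .
qed

end

section \<open>Hook products under a transposition\<close>

definition leg_set :: "nat \<Rightarrow> exponents \<Rightarrow> nat \<Rightarrow> nat \<Rightarrow> nat set" where
  "leg_set N \<eta> i j = {m\<in>{1..N}. m < i \<and> j \<le> part \<eta> m + 1 \<and> part \<eta> m + 1 \<le> part \<eta> i \<or>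
     m > i \<and> j \<le> part \<eta> m \<and> part \<eta> m \<le> part \<eta> i}"

lemma finite_leg_set [simp]: "finite (leg_set N \<eta> i j)"
  by (simp add: leg_set_def)

lemma leg_eq_card: "leg N \<eta> i j = card (leg_set N \<eta> i j)"
proof -
  have eq: "leg_set N \<eta> i j =
      {k\<in>{1..N}. k < i \<and> j \<le> part \<eta> k + 1 \<and> part \<eta> k + 1 \<le> part \<eta> i} \<union>
      {k\<in>{1..N}. k > i \<and> j \<le> part \<eta> k \<and> part \<eta> k \<le> part \<eta> i}"
    by (auto simp: leg_set_def)
  show ?thesis unfolding leg_def eq by (rule card_Un_disjoint[symmetric]) auto
qed

section \<open>Exchange of an entry with a smaller right neighbour\<close>

context
  fixes N k :: nat and \<eta> :: exponents and a b :: nat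
  assumes k: "1 \<le> k" "k < N" and ab: "part \<eta> k = a" "part \<eta> (Suc k) = b" "b < a"
begin

private abbreviation "s \<equiv> simple_transp k"
private abbreviation "\<nu> \<equiv> perm_exp (simple_transp k) \<eta>"

lemma part_swap: "part \<nu> (s i) = part \<eta> i"
  by (simp add: part_simple)

lemma simple_in: "s m \<in> {1..N} \<longleftrightarrow> m \<in> {1..N}"
  using permutes_in_image[OF simple_transp_permutes[OF k]] .

text \<open>Only the relative position of the two exchanged rows changes, and the shorter of them
  never counts the longer one, before or after.\<close>

lemma leg_set_swap: "i \<noteq> k \<Longrightarrow> leg_set N \<nu> (s i) j = s ` leg_set N \<eta> i j"
proof -
  assume i: "i \<noteq> k"
  have "s m \<in> leg_set N \<nu> (s i) j \<longleftrightarrow> m \<in> leg_set N \<eta> i j" for m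
    unfolding leg_set_def mem_Collect_eq simple_in part_swap
    using i ab by (auto simp: simple_transp_apply)
  then show ?thesis by (auto simp: image_iff) (metis simple_transp_twice)
qed

text \<open>The shorter row is counted for j \<le> b while it stands to the right of the longer row,
  and for j \<le> b + 1 once it stands to the left.\<close>

lemma leg_set_swap_big:
  assumes "j \<le> a"
  shows "leg_set N \<nu> (Suc k) j = s ` leg_set N \<eta> k j \<union> (if j = Suc b then {k} else {})"
proof -
  have "s m \<in> leg_set N \<nu> (s k) j \<longleftrightarrow> m \<in> leg_set N \<eta> k j \<or> m = Suc k \<and> j = Suc b" for m
    unfolding leg_set_def mem_Collect_eq simple_in part_swap
    using k ab by (auto simp: simple_transp_apply)
  moreover have "x \<in> s ` A \<longleftrightarrow> s x \<in> A" for x A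
    by (auto simp: image_iff) (metis simple_transp_twice)
  ultimately have "x \<in> leg_set N \<nu> (Suc k) j \<longleftrightarrow> x \<in> s ` leg_set N \<eta> k j \<or> s x = Suc k \<and> j = Suc b" for x
    by (metis simple_transp_simps(1) simple_transp_twice)
  moreover have "s x = Suc k \<longleftrightarrow> x = k" for x by (simp add: simple_transp_apply)
  ultimately show ?thesis by (simp add: set_eq_iff)
qed

lemma inj_swap: "inj_on s A"
  by (metis inj_on_inverseI simple_transp_twice)

lemma leg_swap: "i \<noteq> k \<Longrightarrow> leg N \<nu> (s i) j = leg N \<eta> i j"
  unfolding leg_eq_card by (simp add: leg_set_swap card_image inj_swap)

lemma leg_swap_big:
  assumes "j \<le> a"
  shows "leg N \<nu> (Suc k) j = leg N \<eta> k j + (if j = Suc b then 1 else 0)"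
proof -
  have "k \<notin> s ` leg_set N \<eta> k j" if "j = Suc b"
    using that ab by (auto simp: leg_set_def simple_transp_apply)
  then show ?thesis
    unfolding leg_eq_card leg_set_swap_big[OF assms] by (auto simp: card_image inj_swap)
qed

text \<open>The leg set of column b + 1 consists of the positions ranked strictly between k and k +
  1. As the arm there is a - b - 1, the eigenvalue difference is the factor of this box in
  \<open>d_prod\<close>.\<close>

lemma eigenval_diff_leg:
  "eigenval N \<alpha> \<eta> k - eigenval N \<alpha> \<eta> (Suc k) = \<alpha> * (real a - real b) + 1 + real (leg N \<eta> k (Suc b))"
proof -
  have eq: "preceding N \<eta> (Suc k) = insert k (preceding N \<eta> k \<union> leg_set N \<eta> k (Suc b))"
    using k ab unfolding preceding_def leg_set_def by (auto simp: less_Suc_eq)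
  have "k \<notin> preceding N \<eta> k \<union> leg_set N \<eta> k (Suc b)" "preceding N \<eta> k \<inter> leg_set N \<eta> k (Suc b) = {}"
    unfolding preceding_def leg_set_def by auto
  then have "card (preceding N \<eta> (Suc k)) = Suc (card (preceding N \<eta> k) + leg N \<eta> k (Suc b))"
    unfolding eq leg_eq_card by (simp add: card_Un_disjoint)
  then show ?thesis by (simp add: eigenval_preceding ab algebra_simps)
qed

text \<open>The constant c treats both hook products at once: c = 1 gives \<open>d_prod\<close> and
  c = 0 gives \<open>d'_prod\<close>.\<close>

definition row :: "real \<Rightarrow> real \<Rightarrow> exponents \<Rightarrow> nat \<Rightarrow> real" where
  "row \<alpha> c \<mu> i = (\<Prod>j=1..part \<mu> i. \<alpha> * (real (arm \<mu> i j) + 1) + real (leg N \<mu> i j) + c)"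

lemma row_swap: "i \<noteq> k \<Longrightarrow> row \<alpha> c \<nu> (s i) = row \<alpha> c \<eta> i"
  unfolding row_def arm_def part_swap by (simp add: leg_swap)

text \<open>Only the factor of column b + 1 changes, from \<delta> - 1 + c to \<delta> + c. The
  relation is cross-multiplied since no sign of \<alpha> is fixed here.\<close>

lemma row_swap_big:
  defines "\<delta> \<equiv> \<lambda>\<alpha>. eigenval N \<alpha> \<eta> k - eigenval N \<alpha> \<eta> (Suc k)"
  shows "row \<alpha> c \<nu> (Suc k) * (\<delta> \<alpha> - 1 + c) = row \<alpha> c \<eta> k * (\<delta> \<alpha> + c)"
proof -
  define f where "f j = \<alpha> * (real (arm \<eta> k j) + 1) + real (leg N \<eta> k j) + c" for j
  define g where "g j = \<alpha> * (real (arm \<nu> (Suc k) j) + 1) + real (leg N \<nu> (Suc k) j) + c" for j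
  have p: "part \<nu> (Suc k) = a" using part_swap[of k] ab by simp
  have g: "g j = f j + (if j = Suc b then 1 else 0)" if "j \<le> a" for j
    unfolding g_def f_def arm_def p ab(1) leg_swap_big[OF that] by simp
  have sb: "Suc b \<in> {1..a}" using ab by simp
  have fb: "f (Suc b) = \<delta> \<alpha> - 1 + c"
    unfolding \<delta>_def eigenval_diff_leg f_def arm_def ab(1) using ab(3) by (simp add: of_nat_diff algebra_simps)
  have gb: "g (Suc b) = \<delta> \<alpha> + c" using g[of "Suc b"] ab(3) fb by simp
  have rest: "prod g ({1..a} - {Suc b}) = prod f ({1..a} - {Suc b})"
    using g by (intro prod.cong) auto
  have "row \<alpha> c \<nu> (Suc k) = prod g {1..a}" "row \<alpha> c \<eta> k = prod f {1..a}"
    by (simp_all add: row_def f_def g_def p ab)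
  then show ?thesis
    unfolding prod.remove[OF finite_atLeastAtMost sb] rest gb fb by simp
qed

lemma prod_row_swap:
  defines "\<delta> \<equiv> \<lambda>\<alpha>. eigenval N \<alpha> \<eta> k - eigenval N \<alpha> \<eta> (Suc k)"
  shows "(\<Prod>i=1..N. row \<alpha> c \<nu> i) * (\<delta> \<alpha> - 1 + c) = (\<Prod>i=1..N. row \<alpha> c \<eta> i) * (\<delta> \<alpha> + c)"
proof -
  have kN: "k \<in> {1..N}" using k by simp
  have "(\<Prod>i=1..N. row \<alpha> c \<nu> i) = (\<Prod>i=1..N. row \<alpha> c \<nu> (s i))"
    using prod.permute[OF simple_transp_permutes[OF k], of "row \<alpha> c \<nu>"] by (simp add: o_def)
  also have "\<dots> = row \<alpha> c \<nu> (s k) * (\<Prod>i\<in>{1..N} - {k}. row \<alpha> c \<nu> (s i))"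
    by (rule prod.remove[OF finite_atLeastAtMost kN])
  also have "(\<Prod>i\<in>{1..N} - {k}. row \<alpha> c \<nu> (s i)) = (\<Prod>i\<in>{1..N} - {k}. row \<alpha> c \<eta> i)"
    by (rule prod.cong) (simp_all add: row_swap)
  finally show ?thesis
    using row_swap_big[of \<alpha> c] prod.remove[OF _ kN, of "row \<alpha> c \<eta>"] by (simp add: \<delta>_def ac_simps)
qed

lemma d_prod_swap:
  defines "\<delta> \<equiv> \<lambda>\<alpha>. eigenval N \<alpha> \<eta> k - eigenval N \<alpha> \<eta> (Suc k)"
  shows "d_prod N \<alpha> \<nu> * \<delta> \<alpha> = d_prod N \<alpha> \<eta> * (\<delta> \<alpha> + 1)"
    and "d'_prod N \<alpha> \<nu> * (\<delta> \<alpha> - 1) = d'_prod N \<alpha> \<eta> * \<delta> \<alpha>"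
  using prod_row_swap[of \<alpha> 1] prod_row_swap[of \<alpha> 0]
  by (simp_all add: d_prod_def d'_prod_def row_def \<delta>_def)

end

section \<open>Symmetrization\<close>

lemma hook_factor_pos: "\<alpha> > 0 \<Longrightarrow> 0 < \<alpha> * (real m + 1) + real n"
  by (rule add_pos_nonneg, rule mult_pos_pos) auto

lemma d_prod_pos: "\<alpha> > 0 \<Longrightarrow> d_prod N \<alpha> \<eta> > 0"
  unfolding d_prod_def by (intro prod_pos ballI add_pos_pos[OF hook_factor_pos zero_less_one])

lemma d'_prod_pos: "\<alpha> > 0 \<Longrightarrow> d'_prod N \<alpha> \<eta> > 0"
  unfolding d'_prod_def by (intro prod_pos ballI hook_factor_pos)

lemma const_poly_solve:
  assumes "const_poly a * X = const_poly b * Y" "a \<noteq> 0"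
  shows "X = const_poly (b / a) * Y"
proof -
  have "const_poly (1 / a) * (const_poly a * X) = const_poly (1 / a) * (const_poly b * Y)"
    using assms(1) by simp
  then show ?thesis using assms(2) by (simp add: mult.assoc[symmetric] const_poly_mult[symmetric])
qed

text \<open>
  Sorting within the blocks of \<open>W\<^bsub>I \<union> J\<^esub>\<close> does not preserve the dominance order either, so the leading term
  of \<open>\<O> E\<^sub>\<mu>\<close> is read off from its expansion in the \<open>E\<^sub>\<nu>\<close> with \<open>\<nu>\<close> in the orbit.
\<close>
inductive jack_span :: "nat \<Rightarrow> real \<Rightarrow> exponents set \<Rightarrow> polynomial \<Rightarrow> bool" for N \<alpha> A where
  zero: "jack_span N \<alpha> A 0"
| add: "jack_span N \<alpha> A f \<Longrightarrow> \<mu> \<in> A \<Longrightarrow> jack_span N \<alpha> A (f + const_poly c * nonsym_jack N \<alpha> \<mu>)"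

lemma jack_span_add: "jack_span N \<alpha> A g \<Longrightarrow> jack_span N \<alpha> A f \<Longrightarrow> jack_span N \<alpha> A (f + g)"
proof (induction rule: jack_span.induct)
  case (add g \<mu> c)
  then show ?case using jack_span.add[of N \<alpha> A "f + g" \<mu> c] by (simp add: add.assoc)
qed simp

lemma jack_span_const: "jack_span N \<alpha> A f \<Longrightarrow> jack_span N \<alpha> A (const_poly c * f)"
proof (induction rule: jack_span.induct)
  case (add f \<mu> d)
  then show ?case
    using jack_span.add[of N \<alpha> A "const_poly c * f" \<mu> "c * d"]
    by (simp add: distrib_left const_poly_mult mult.assoc)
qed (simp add: jack_span.zero)

lemma jack_span_base: "\<mu> \<in> A \<Longrightarrow> jack_span N \<alpha> A (nonsym_jack N \<alpha> \<mu>)"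
  using jack_span.add[OF jack_span.zero, of \<mu> A N \<alpha> 1] by simp

lemma jack_span_sum: "(\<And>x. x \<in> X \<Longrightarrow> jack_span N \<alpha> A (F x)) \<Longrightarrow> jack_span N \<alpha> A (sum F X)"
  by (induction X rule: infinite_finite_induct) (auto simp: jack_span.zero intro: jack_span_add)

lemma nonsym_jack_simple:
  assumes "\<alpha> > 0" "\<eta> \<in> compositions N" "1 \<le> k" "k < N" "part \<eta> k < part \<eta> (Suc k)"
  shows "perm_poly (simple_transp k) (nonsym_jack N \<alpha> \<eta>) =
    const_poly (1 / (eigenval N \<alpha> \<eta> k - eigenval N \<alpha> \<eta> (Suc k))) * nonsym_jack N \<alpha> \<eta> +
    nonsym_jack N \<alpha> (perm_exp (simple_transp k) \<eta>)"
proof -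
  have "1 \<le> N" using assms by simp
  from jack_poly_simple[OF assms jack_poly_nonsym_jack[OF this assms(1,2)]]
  have "nonsym_jack N \<alpha> (perm_exp (simple_transp k) \<eta>) =
      perm_poly (simple_transp k) (nonsym_jack N \<alpha> \<eta>) -
      const_poly (1 / (eigenval N \<alpha> \<eta> k - eigenval N \<alpha> \<eta> (Suc k))) * nonsym_jack N \<alpha> \<eta>"
    by (rule nonsym_jack_eq[OF assms(1) perm_exp_compositions[OF simple_transp_permutes[OF assms(3,4)] assms(2)]])
  then show ?thesis by simp
qed

context separated_subsets
begin

lemma simple_perm: "k \<in> I \<union> J \<Longrightarrow> 1 \<le> k \<and> k < N"
  using subsetD[OF IJ_sub, of k] by auto

lemma part_perm_exp_fixed:
  assumes "K \<subseteq> {1..N - 1}" "w \<in> W_group N K" "x \<notin> support K"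
  shows "part (perm_exp w \<eta>) x = part \<eta> x"
  using W_fixes[OF assms(1) inv_in_W[OF assms(1,2)] assms(3)] W_bij[OF assms(1,2)] by (simp add: part_perm_exp)

lemma orbit_compositions: "\<eta> \<in> compositions N \<Longrightarrow> \<mu> \<in> orbit N (I \<union> J) \<eta> \<Longrightarrow> \<mu> \<in> compositions N"
  unfolding orbit_def using perm_exp_compositions W_permutes[OF IJ_sub] by blast

lemma jack_span_simple:
  assumes "\<alpha> > 0" "\<eta> \<in> compositions N" "k \<in> I \<union> J"
  shows "jack_span N \<alpha> (orbit N (I \<union> J) \<eta>) f \<Longrightarrow>
    jack_span N \<alpha> (orbit N (I \<union> J) \<eta>) (perm_poly (simple_transp k) f)"
proof (induction rule: jack_span.induct)
  case zero
  show ?case by (simp add: jack_span.zero)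
next
  case (add f \<mu> c)
  let ?A = "orbit N (I \<union> J) \<eta>" and ?s = "simple_transp k" and ?E = "nonsym_jack N \<alpha>"
  have k: "1 \<le> k" "k < N" using simple_perm[OF assms(3)] by auto
  have \<mu>: "\<mu> \<in> compositions N" by (rule orbit_compositions[OF assms(2) add(2)])
  have s\<mu>: "perm_exp ?s \<mu> \<in> ?A"
    using add(2) orbit_perm_exp[OF simple_in_W[OF IJ_sub assms(3)], of \<mu>]
      comp_in_W[OF IJ_sub simple_in_W[OF IJ_sub assms(3)]] W_bij[OF IJ_sub]
    unfolding orbit_def by (auto simp: perm_exp_comp)
  note sc = perm_exp_compositions[OF simple_transp_permutes[OF k] \<mu>]
  have "jack_span N \<alpha> ?A (perm_poly ?s (?E \<mu>))"
  proof (cases "part \<mu> k" "part \<mu> (Suc k)" rule: linorder_cases)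
    case less
    show ?thesis
      unfolding nonsym_jack_simple[OF assms(1) \<mu> k less]
      by (intro jack_span_add jack_span_const jack_span_base add(2) s\<mu>)
  next
    case equal
    have "1 \<le> N" using k by simp
    then have "perm_poly ?s (?E \<mu>) = ?E \<mu>"
      by (intro jack_poly_simple_equal[OF assms(1) \<mu> k equal] jack_poly_nonsym_jack assms(1) \<mu>)
    then show ?thesis using jack_span_base[OF add(2)] by simp
  next
    case greater
    \<comment> \<open>Here the exchanged composition has the ascent. Its rule expresses E_\<mu>
      through s_k E, and a second application of s_k, an involution, gives s_k E_\<mu>.\<close>
    let ?c = "1 / (eigenval N \<alpha> (perm_exp ?s \<mu>) k - eigenval N \<alpha> (perm_exp ?s \<mu>) (Suc k))"
    have e: "perm_poly ?s (?E (perm_exp ?s \<mu>)) = const_poly ?c * ?E (perm_exp ?s \<mu>) + ?E \<mu>"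
      using nonsym_jack_simple[OF assms(1) sc k] greater by (simp add: part_simple perm_exp_comp)
    have "perm_poly ?s (perm_poly ?s (?E (perm_exp ?s \<mu>))) =
        const_poly ?c * perm_poly ?s (?E (perm_exp ?s \<mu>)) + perm_poly ?s (?E \<mu>)"
      by (subst e) (simp only: perm_poly_add perm_poly_mult perm_poly_const simple_transp_simps)
    then have "perm_poly ?s (?E \<mu>) =
        ?E (perm_exp ?s \<mu>) + const_poly (- ?c) * perm_poly ?s (?E (perm_exp ?s \<mu>))"
      unfolding perm_poly_simple_transp_twice const_poly_uminus by (simp add: algebra_simps)
    also have "\<dots> = ?E (perm_exp ?s \<mu>) + const_poly (- ?c) * (const_poly ?c * ?E (perm_exp ?s \<mu>) + ?E \<mu>)"
      unfolding e ..
    also have "jack_span N \<alpha> ?A \<dots>"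
      by (intro jack_span_add jack_span_const jack_span_base add(2) s\<mu>)
    finally show ?thesis .
  qed
  then show ?case
    using add(3) by (simp add: perm_poly_add perm_poly_mult jack_span_add jack_span_const)
qed

lemma jack_span_perm:
  assumes "\<alpha> > 0" "\<eta> \<in> compositions N" "w \<in> W" "jack_span N \<alpha> (orbit N (I \<union> J) \<eta>) f"
  shows "jack_span N \<alpha> (orbit N (I \<union> J) \<eta>) (perm_poly w f)"
  using IJ_sub assms(3)
proof (induction rule: W_group_induct)
  case id
  show "jack_span N \<alpha> (orbit N (I \<union> J) \<eta>) (perm_poly id f)" using assms(4) by simp
next
  case (step k w)
  then show "jack_span N \<alpha> (orbit N (I \<union> J) \<eta>) (perm_poly (simple_transp k \<circ> w) f)"
    using jack_span_simple[OF assms(1,2) step(1,3)] W_bij[OF IJ_sub step(2)] by (simp add: perm_poly_comp)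
qed

lemma jack_span_sym_op:
  assumes "\<alpha> > 0" "\<eta> \<in> compositions N" "\<mu> \<in> orbit N (I \<union> J) \<eta>"
  shows "jack_span N \<alpha> (orbit N (I \<union> J) \<eta>) (sym_op N I J (nonsym_jack N \<alpha> \<mu>))"
  unfolding sym_op_eq
  by (intro jack_span_sum jack_span_const jack_span_perm assms jack_span_base)

lemma prec_of_partial_sums:
  assumes "w permutes {1..N}" "perm_exp w \<mu> \<noteq> \<mu>"
    and "\<And>p. (\<Sum>j=1..p. part (perm_exp w \<mu>) j) \<le> (\<Sum>j=1..p. part \<mu> j)"
  shows "prec N (perm_exp w \<mu>) \<mu>"
  using assms sorted_desc_perm_exp[OF assms(1)] weight_perm_exp[OF assms(1)]
  unfolding prec_def dom_less_def by auto

lemma orbit_le_sorted: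
  assumes "w \<in> W" "\<And>k. k \<in> I \<union> J \<Longrightarrow> part \<kappa> (Suc k) \<le> part \<kappa> k"
  shows "perm_exp w \<kappa> = \<kappa> \<or> prec N (perm_exp w \<kappa>) \<kappa>"
proof -
  have "(\<Sum>j=1..p. part (perm_exp w \<kappa>) j) \<le> (\<Sum>j=1..p. part \<kappa> j)" for p
    using W_partial_sum_le[OF IJ_sub inv_in_W[OF IJ_sub assms(1)], of "part \<kappa>" p] assms(2) W_bij[OF IJ_sub assms(1)]
    by (simp add: part_perm_exp)
  then show ?thesis using prec_of_partial_sums[OF W_permutes[OF IJ_sub assms(1)]] by blast
qed

text \<open>Each member of the orbit is at most the decreasing one by
  \<open>orbit_le_sorted\<close>, and each E_\<mu> is supported at or below \<mu>; no knowledge of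
  the expansion coefficients is required.\<close>

lemma jack_span_keys:
  assumes "\<alpha> > 0" "\<kappa> \<in> compositions N" "\<And>k. k \<in> I \<union> J \<Longrightarrow> part \<kappa> (Suc k) \<le> part \<kappa> k"
  shows "jack_span N \<alpha> (orbit N (I \<union> J) \<kappa>) f \<Longrightarrow>
    \<forall>\<nu>\<in>Poly_Mapping.keys f. \<nu> = \<kappa> \<or> \<nu> \<in> compositions N \<and> prec N \<nu> \<kappa>"
proof (induction rule: jack_span.induct)
  case (add f \<mu> c)
  have \<mu>: "\<mu> \<in> compositions N" by (rule orbit_compositions[OF assms(2) add(2)])
  have \<mu>\<kappa>: "\<mu> = \<kappa> \<or> prec N \<mu> \<kappa>"
    using add(2) orbit_le_sorted assms(3) unfolding orbit_def by blast
  have jp: "joint_eigen N \<alpha> (eigenval N \<alpha> \<mu>) (nonsym_jack N \<alpha> \<mu>)"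
    using jack_poly_nonsym_jack[OF N_pos assms(1) \<mu>] by (simp add: jack_poly_def)
  have "\<nu> = \<kappa> \<or> \<nu> \<in> compositions N \<and> prec N \<nu> \<kappa>" if "\<nu> \<in> Poly_Mapping.keys (nonsym_jack N \<alpha> \<mu>)" for \<nu>
  proof -
    have "\<nu> \<in> compositions N" using that jp by (auto simp: joint_eigen_def)
    then show ?thesis
      using joint_eigen_support(2)[OF assms(1) \<mu> jp that] \<mu>\<kappa> prec_trans[of N \<nu> \<mu> \<kappa>] \<mu> by blast
  qed
  then show ?case
    using add(3) Poly_Mapping.keys_add[of f "const_poly c * nonsym_jack N \<alpha> \<mu>"]
      keys_const_mult[of c "nonsym_jack N \<alpha> \<mu>"] by blast
qed simp

section \<open>Proportionality along W_I and W_J\<close>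

lemma sym_op_jack_less:
  assumes "\<alpha> > 0" "\<eta> \<in> compositions N" "k \<in> I \<union> J" "part \<eta> k < part \<eta> (Suc k)"
  shows "sym_op N I J (nonsym_jack N \<alpha> (perm_exp (simple_transp k) \<eta>)) =
    const_poly ((if k \<in> J then -1 else 1) - 1 / (eigenval N \<alpha> \<eta> k - eigenval N \<alpha> \<eta> (Suc k))) *
    sym_op N I J (nonsym_jack N \<alpha> \<eta>)"
proof -
  let ?c = "1 / (eigenval N \<alpha> \<eta> k - eigenval N \<alpha> \<eta> (Suc k))"
  have k: "1 \<le> k" "k < N" using simple_perm[OF assms(3)] by auto
  have "nonsym_jack N \<alpha> (perm_exp (simple_transp k) \<eta>) =
      perm_poly (simple_transp k) (nonsym_jack N \<alpha> \<eta>) - const_poly ?c * nonsym_jack N \<alpha> \<eta>"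
    using nonsym_jack_simple[OF assms(1,2) k assms(4)] by simp
  then show ?thesis
    by (simp only: sym_op_diff sym_op_const_mult sym_op_simple[OF assms(3)] const_poly_diff left_diff_distrib)
qed

lemma sym_op_jack_I_less:
  assumes "\<alpha> > 0" "\<eta> \<in> compositions N" "i \<in> I" "part \<eta> i < part \<eta> (Suc i)"
  defines "\<kappa> \<equiv> perm_exp (simple_transp i) \<eta>"
  shows "const_poly (d_prod N \<alpha> \<kappa>) * sym_op N I J (nonsym_jack N \<alpha> \<kappa>) =
    const_poly (d_prod N \<alpha> \<eta>) * sym_op N I J (nonsym_jack N \<alpha> \<eta>)"
proof -
  have i: "1 \<le> i" "i < N" using simple_perm[of i] assms(3) by auto
  define e where "e = eigenval N \<alpha> \<eta> i - eigenval N \<alpha> \<eta> (Suc i)"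
  have e: "e < 0" using eigenval_gap[OF assms(1) _ assms(4), of N] i assms(1) by (simp add: e_def)
  have ek: "eigenval N \<alpha> \<kappa> i - eigenval N \<alpha> \<kappa> (Suc i) = - e"
    using i assms(4) by (simp add: \<kappa>_def eigenval_simple e_def)
  have "perm_exp (simple_transp i) \<kappa> = \<eta>" by (simp add: \<kappa>_def perm_exp_comp)
  \<comment> \<open>The hook relation is used at \<kappa>, where the larger entry comes first and
    the eigenvalue difference is -e. It identifies the scalar 1 - 1/e as the ratio of d at \<eta> to
    d at \<kappa>.\<close>
  then have "d_prod N \<alpha> \<eta> * (- e) = d_prod N \<alpha> \<kappa> * (- e + 1)"
    using d_prod_swap(1)[OF i refl refl, of \<kappa> \<alpha>] assms(4) ek by (simp add: \<kappa>_def part_simple)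
  then have "d_prod N \<alpha> \<kappa> * (1 - 1 / e) = d_prod N \<alpha> \<eta>" using e by (simp add: field_simps)
  moreover have "i \<notin> J" using assms(3) disjoint by auto
  ultimately show ?thesis
    unfolding \<kappa>_def using sym_op_jack_less[OF assms(1,2) _ assms(4)] assms(3)
    by (simp add: e_def mult.assoc[symmetric] const_poly_mult[symmetric])
qed

lemma sym_op_jack_I:
  assumes "\<alpha> > 0" "\<eta> \<in> compositions N" "i \<in> I"
  shows "const_poly (d_prod N \<alpha> (perm_exp (simple_transp i) \<eta>)) *
      sym_op N I J (nonsym_jack N \<alpha> (perm_exp (simple_transp i) \<eta>)) =
    const_poly (d_prod N \<alpha> \<eta>) * sym_op N I J (nonsym_jack N \<alpha> \<eta>)"
proof (cases "part \<eta> i" "part \<eta> (Suc i)" rule: linorder_cases)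
  case less
  then show ?thesis by (rule sym_op_jack_I_less[OF assms])
next
  case equal
  have "perm_exp (simple_transp i) \<eta> = \<eta>"
    by (rule poly_mapping_eqI) (simp add: part_simple simple_transp_apply equal)
  then show ?thesis by simp
next
  case greater
  have "perm_exp (simple_transp i) \<eta> \<in> compositions N"
    using simple_perm[of i] assms(3) by (intro perm_exp_compositions[OF simple_transp_permutes assms(2)]) auto
  from sym_op_jack_I_less[OF assms(1) this assms(3)] greater show ?thesis
    by (simp add: part_simple perm_exp_comp)
qed

text \<open>Symmetrization absorbs s_j with sign -1, so the scalar is -(1 + 1/e); by the hook
  relation 1 + 1/e is the ratio of d' at \<kappa> to d' at \<eta>, upside down compared with the
  ratio for I.\<close>

lemma sym_op_jack_J_less:
  assumes "\<alpha> > 0" "\<eta> \<in> compositions N" "j \<in> J" "part \<eta> j < part \<eta> (Suc j)"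
  defines "\<kappa> \<equiv> perm_exp (simple_transp j) \<eta>"
  shows "const_poly (d'_prod N \<alpha> \<eta>) * sym_op N I J (nonsym_jack N \<alpha> \<kappa>) =
    const_poly (- d'_prod N \<alpha> \<kappa>) * sym_op N I J (nonsym_jack N \<alpha> \<eta>)"
proof -
  have j: "1 \<le> j" "j < N" using simple_perm[of j] assms(3) by auto
  define e where "e = eigenval N \<alpha> \<eta> j - eigenval N \<alpha> \<eta> (Suc j)"
  have e: "e < 0" using eigenval_gap[OF assms(1) _ assms(4), of N] j assms(1) by (simp add: e_def)
  have ek: "eigenval N \<alpha> \<kappa> j - eigenval N \<alpha> \<kappa> (Suc j) = - e"
    using j assms(4) by (simp add: \<kappa>_def eigenval_simple e_def)
  have "perm_exp (simple_transp j) \<kappa> = \<eta>" by (simp add: \<kappa>_def perm_exp_comp)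
  then have "d'_prod N \<alpha> \<eta> * (- e - 1) = d'_prod N \<alpha> \<kappa> * (- e)"
    using d_prod_swap(2)[OF j refl refl, of \<kappa> \<alpha>] assms(4) ek by (simp add: \<kappa>_def part_simple)
  then have "d'_prod N \<alpha> \<eta> * (- 1 - 1 / e) = - d'_prod N \<alpha> \<kappa>" using e by (simp add: field_simps)
  then show ?thesis
    using sym_op_jack_less[OF assms(1,2) _ assms(4)] assms(3)
    by (simp add: e_def \<kappa>_def mult.assoc[symmetric] const_poly_mult[symmetric])
qed

lemma sym_op_jack_J:
  assumes "\<alpha> > 0" "\<eta> \<in> compositions N" "j \<in> J" "part \<eta> j \<noteq> part \<eta> (Suc j)"
  shows "const_poly (d'_prod N \<alpha> \<eta>) * sym_op N I J (nonsym_jack N \<alpha> (perm_exp (simple_transp j) \<eta>)) =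
    const_poly (- d'_prod N \<alpha> (perm_exp (simple_transp j) \<eta>)) * sym_op N I J (nonsym_jack N \<alpha> \<eta>)"
proof (cases "part \<eta> j < part \<eta> (Suc j)")
  case True
  then show ?thesis by (rule sym_op_jack_J_less[OF assms(1-3)])
next
  case False
  then have gr: "part \<eta> (Suc j) < part \<eta> j" using assms(4) by simp
  have "perm_exp (simple_transp j) \<eta> \<in> compositions N"
    using simple_perm[of j] assms(3) by (intro perm_exp_compositions[OF simple_transp_permutes assms(2)]) auto
  from sym_op_jack_J_less[OF assms(1) this assms(3)] gr show ?thesis
    by (simp add: part_simple perm_exp_comp const_poly_uminus)
qed

lemma sym_op_jack_WI:
  assumes "\<alpha> > 0" "\<eta> \<in> compositions N" "w \<in> W_group N I"
  shows "sym_op N I J (nonsym_jack N \<alpha> \<eta>) =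
    const_poly (d_prod N \<alpha> (perm_exp w \<eta>) / d_prod N \<alpha> \<eta>) * sym_op N I J (nonsym_jack N \<alpha> (perm_exp w \<eta>))"
proof -
  have "const_poly (d_prod N \<alpha> \<eta>) * sym_op N I J (nonsym_jack N \<alpha> \<eta>) =
      const_poly (d_prod N \<alpha> (perm_exp w \<eta>)) * sym_op N I J (nonsym_jack N \<alpha> (perm_exp w \<eta>))"
    using I_sub assms(3)
  proof (induction rule: W_group_induct)
    case id
    show "const_poly (d_prod N \<alpha> \<eta>) * sym_op N I J (nonsym_jack N \<alpha> \<eta>) =
      const_poly (d_prod N \<alpha> (perm_exp id \<eta>)) * sym_op N I J (nonsym_jack N \<alpha> (perm_exp id \<eta>))" by simp
  next
    case (step i w)
    have "perm_exp w \<eta> \<in> compositions N"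
      by (rule perm_exp_compositions[OF W_permutes[OF I_sub step(2)] assms(2)])
    from sym_op_jack_I[OF assms(1) this step(1)] step(3)
    show "const_poly (d_prod N \<alpha> \<eta>) * sym_op N I J (nonsym_jack N \<alpha> \<eta>) =
      const_poly (d_prod N \<alpha> (perm_exp (simple_transp i \<circ> w) \<eta>)) *
      sym_op N I J (nonsym_jack N \<alpha> (perm_exp (simple_transp i \<circ> w) \<eta>))"
      using W_bij[OF I_sub step(2)] by (simp add: perm_exp_comp)
  qed
  then show ?thesis using d_prod_pos[OF assms(1), of N \<eta>] by (intro const_poly_solve) auto
qed

lemma sym_op_jack_WJ:
  assumes "\<alpha> > 0" "\<eta> \<in> compositions N" "distinct_connected J \<eta>" "w \<in> W_group N J"
  shows "sym_op N I J (nonsym_jack N \<alpha> \<eta>) =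
    const_poly (det_J I J w * d'_prod N \<alpha> \<eta> / d'_prod N \<alpha> (perm_exp w \<eta>)) *
    sym_op N I J (nonsym_jack N \<alpha> (perm_exp w \<eta>))"
proof -
  \<comment> \<open>The single step expresses the symmetrization at s_j \<mu> by the one at \<mu>,
    so the induction runs in this direction; it is inverted afterwards because the sign squares to
    1.\<close>
  have "sym_op N I J (nonsym_jack N \<alpha> (perm_exp w \<eta>)) =
      const_poly (det_J I J w * d'_prod N \<alpha> (perm_exp w \<eta>) / d'_prod N \<alpha> \<eta>) * sym_op N I J (nonsym_jack N \<alpha> \<eta>)"
    using J_sub assms(4)
  proof (induction rule: W_group_induct)
    case id
    show "sym_op N I J (nonsym_jack N \<alpha> (perm_exp id \<eta>)) =
      const_poly (det_J I J id * d'_prod N \<alpha> (perm_exp id \<eta>) / d'_prod N \<alpha> \<eta>) * sym_op N I J (nonsym_jack N \<alpha> \<eta>)"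
      using d'_prod_pos[OF assms(1), of N \<eta>] by simp
  next
    case (step j w)
    let ?\<mu> = "perm_exp w \<eta>" and ?s = "simple_transp j"
    have c: "?\<mu> \<in> compositions N"
      by (rule perm_exp_compositions[OF W_permutes[OF J_sub step(2)] assms(2)])
    have "part ?\<mu> j \<noteq> part ?\<mu> (Suc j)"
      by (rule distinct_adjacent[OF distinct_W[OF WJ_in_W[OF step(2)] assms(3)] step(1)])
    from const_poly_solve[OF sym_op_jack_J[OF assms(1) c step(1) this]] d'_prod_pos[OF assms(1), of N ?\<mu>]
    have "sym_op N I J (nonsym_jack N \<alpha> (perm_exp ?s ?\<mu>)) =
        const_poly (- d'_prod N \<alpha> (perm_exp ?s ?\<mu>) / d'_prod N \<alpha> ?\<mu>) * sym_op N I J (nonsym_jack N \<alpha> ?\<mu>)"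
      by simp
    also have "\<dots> = const_poly (- d'_prod N \<alpha> (perm_exp ?s ?\<mu>) / d'_prod N \<alpha> ?\<mu> *
        (det_J I J w * d'_prod N \<alpha> ?\<mu> / d'_prod N \<alpha> \<eta>)) * sym_op N I J (nonsym_jack N \<alpha> \<eta>)"
      unfolding step(3) by (simp only: const_poly_mult mult.assoc)
    also have "- d'_prod N \<alpha> (perm_exp ?s ?\<mu>) / d'_prod N \<alpha> ?\<mu> * (det_J I J w * d'_prod N \<alpha> ?\<mu> / d'_prod N \<alpha> \<eta>) =
        det_J I J (?s \<circ> w) * d'_prod N \<alpha> (perm_exp ?s ?\<mu>) / d'_prod N \<alpha> \<eta>"
      using d'_prod_pos[OF assms(1), of N ?\<mu>] step(1,2)
      by (simp add: det_J_comp WJ_in_W simple_in_W[OF J_sub] det_J_simple)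
    finally show "sym_op N I J (nonsym_jack N \<alpha> (perm_exp (?s \<circ> w) \<eta>)) =
      const_poly (det_J I J (?s \<circ> w) * d'_prod N \<alpha> (perm_exp (?s \<circ> w) \<eta>) / d'_prod N \<alpha> \<eta>) *
      sym_op N I J (nonsym_jack N \<alpha> \<eta>)"
      using W_bij[OF J_sub step(2)] by (simp add: perm_exp_comp)
  qed
  moreover have "det_J I J w * det_J I J w = 1" by (rule det_J_square[OF WJ_in_W[OF assms(4)]])
  ultimately show ?thesis
    using d'_prod_pos[OF assms(1), of N \<eta>] d'_prod_pos[OF assms(1), of N "perm_exp w \<eta>"]
    by (simp add: mult.assoc[symmetric] const_poly_mult[symmetric])
qed

section \<open>The leading coefficient and the normalized polynomial\<close>

text \<open>E_\<mu> contains no other monomial of the orbit, so only a coset of the stabilizer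
  contributes. The stabilizer lies in W_I, hence all contributions have the sign of
  \<open>w0\<close> and add up.\<close>

lemma coef_sym_op_antisorted:
  assumes "\<alpha> > 0" "\<mu> \<in> compositions N" "distinct_connected J \<mu>"
    and up: "\<And>k. k \<in> I \<union> J \<Longrightarrow> part \<mu> k \<le> part \<mu> (Suc k)" and w0: "w0 \<in> W"
  shows "coef (sym_op N I J (nonsym_jack N \<alpha> \<mu>)) (perm_exp w0 \<mu>) = det_J I J w0 * real (stab_card N I \<mu>)"
proof -
  let ?E = "nonsym_jack N \<alpha> \<mu>" and ?\<kappa> = "perm_exp w0 \<mu>"
  have jp: "joint_eigen N \<alpha> (eigenval N \<alpha> \<mu>) ?E" "coef ?E \<mu> = 1"
    using jack_poly_nonsym_jack[OF N_pos assms(1,2)] by (auto simp: jack_poly_def)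
  have E: "coef ?E (perm_exp v \<mu>) = (if perm_exp v \<mu> = \<mu> then 1 else 0)" if v: "v \<in> W" for v
  proof (cases "perm_exp v \<mu> = \<mu>")
    case True
    then show ?thesis using jp(2) by simp
  next
    case False
    have vp: "v permutes {1..N}" by (rule W_permutes[OF IJ_sub v])
    have vc: "perm_exp v \<mu> \<in> compositions N" by (rule perm_exp_compositions[OF vp assms(2)])
    have "coef ?E (perm_exp v \<mu>) = 0"
    proof (rule ccontr)
      assume "coef ?E (perm_exp v \<mu>) \<noteq> 0"
      then have pr: "prec N (perm_exp v \<mu>) \<mu>"
        using joint_eigen_support(2)[OF assms(1,2) jp(1), of "perm_exp v \<mu>"] False by (simp add: in_keys_iff)
      \<comment> \<open>Negation turns the increasing entries into decreasing ones, so the partial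
        sum bound applies with reversed effect and \<mu> is the smallest in its orbit.\<close>
      have "(\<Sum>j=1..p. - int (part (perm_exp v \<mu>) j)) \<le> (\<Sum>j=1..p. - int (part \<mu> j))" for p
        using W_partial_sum_le[OF IJ_sub inv_in_W[OF IJ_sub v], of "\<lambda>j. - int (part \<mu> j)" p] up permutes_bij[OF vp]
        by (simp add: part_perm_exp)
      then have le: "(\<Sum>j=1..p. part \<mu> j) \<le> (\<Sum>j=1..p. part (perm_exp v \<mu>) j)" for p
        by (simp add: sum_negf flip: of_nat_sum)
      have "perm_exp (inv' v) (perm_exp v \<mu>) = \<mu>" by (rule perm_exp_inv_cancel[OF permutes_bij[OF vp]])
      then have "prec N \<mu> (perm_exp v \<mu>)"
        using prec_of_partial_sums[OF permutes_inv[OF vp], of "perm_exp v \<mu>"] False le by metis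
      then show False using pr prec_trans[OF _ _ assms(2) vc] not_prec_self by blast
    qed
    then show ?thesis using False by simp
  qed
  have "coef (sym_op N I J ?E) ?\<kappa> = (\<Sum>w\<in>W. det_J I J w * coef ?E (perm_exp (inv' w \<circ> w0) \<mu>))"
    unfolding sym_op_eq lookup_sum
    by (intro sum.cong) (simp_all add: coef_perm_poly W_bij[OF IJ_sub] perm_exp_comp bij_imp_bij_inv w0)
  \<comment> \<open>The substitution of \<open>w0 \<circ> w\<close> for \<open>w\<close> moves the
    sum from the coset to the stabilizer.\<close>
  also have "\<dots> = (\<Sum>w\<in>W. det_J I J (w0 \<circ> w) * coef ?E (perm_exp (inv' w) \<mu>))"
  proof (rule sum.reindex_bij_witness[of _ "\<lambda>w. w0 \<circ> w" "\<lambda>w. inv' w0 \<circ> w"])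
    fix w assume w: "w \<in> W"
    have b: "bij w0" "bij w" using W_bij[OF IJ_sub] w w0 by auto
    show "w0 \<circ> (inv' w0 \<circ> w) = w" "inv' w0 \<circ> (w0 \<circ> w) = w"
      using b by (simp_all add: fun_eq_iff bij_is_inj bij_is_surj surj_f_inv_f)
    then show "det_J I J (w0 \<circ> (inv' w0 \<circ> w)) * coef ?E (perm_exp (inv' (inv' w0 \<circ> w)) \<mu>) =
        det_J I J w * coef ?E (perm_exp (inv' w \<circ> w0) \<mu>)"
      using b by (simp add: o_inv_distrib bij_imp_bij_inv inv_inv_eq)
  qed (simp_all add: comp_in_W[OF IJ_sub] inv_in_W[OF IJ_sub] w0)
  also have "\<dots> = (\<Sum>w\<in>W. if perm_exp w \<mu> = \<mu> then det_J I J (w0 \<circ> w) else 0)"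
  proof (rule sum.cong)
    fix w assume w: "w \<in> W"
    have "perm_exp (inv' w) \<mu> = \<mu> \<longleftrightarrow> perm_exp w \<mu> = \<mu>"
      using perm_exp_eq_iff[OF W_bij[OF IJ_sub w], of \<mu> \<mu>] by metis
    then show "det_J I J (w0 \<circ> w) * coef ?E (perm_exp (inv' w) \<mu>) =
        (if perm_exp w \<mu> = \<mu> then det_J I J (w0 \<circ> w) else 0)"
      using E[OF inv_in_W[OF IJ_sub w]] by simp
  qed simp
  also have "\<dots> = (\<Sum>w | w \<in> W \<and> perm_exp w \<mu> = \<mu>. det_J I J (w0 \<circ> w))"
    using finite_W[OF IJ_sub] by (simp add: sum.inter_filter)
  also have "{w. w \<in> W \<and> perm_exp w \<mu> = \<mu>} = {w \<in> W_group N I. perm_exp w \<mu> = \<mu>}"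
    using stabilizer_in_WI[OF _ _ assms(3)] WI_in_W by blast
  also have "(\<Sum>w\<in>{w \<in> W_group N I. perm_exp w \<mu> = \<mu>}. det_J I J (w0 \<circ> w)) =
      (\<Sum>w\<in>{w \<in> W_group N I. perm_exp w \<mu> = \<mu>}. det_J I J w0)"
    by (intro sum.cong) (auto simp: det_J_comp w0 WI_in_W det_J_WI)
  finally show ?thesis by (simp add: stab_card_def mult.commute)
qed

text \<open>The symmetrization at the increasing arrangement has leading coefficient C, nonzero as a
  sign times a stabilizer order; divided by C it satisfies the description of S. Any other candidate
  T has \<O> E_\<mu> = c T, and comparing leading coefficients forces c = C, hence equality.\<close>

lemma sym_jack_eq:
  assumes "\<alpha> > 0" "\<mu> \<in> compositions N" "distinct_connected J \<mu>"
    and up: "\<And>k. k \<in> I \<union> J \<Longrightarrow> part \<mu> k \<le> part \<mu> (Suc k)" and w0: "w0 \<in> W"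
    and down: "\<And>k. k \<in> I \<union> J \<Longrightarrow> part (perm_exp w0 \<mu>) (Suc k) \<le> part (perm_exp w0 \<mu>) k"
  defines "C \<equiv> det_J I J w0 * real (stab_card N I \<mu>)"
  shows "sym_op N I J (nonsym_jack N \<alpha> \<mu>) = const_poly C * sym_jack N \<alpha> I J (perm_exp w0 \<mu>)"
    and "coef (sym_jack N \<alpha> I J (perm_exp w0 \<mu>)) (perm_exp w0 \<mu>) = 1"
proof -
  let ?\<kappa> = "perm_exp w0 \<mu>" and ?G = "sym_op N I J (nonsym_jack N \<alpha> \<mu>)"
  have G: "coef ?G ?\<kappa> = C"
    unfolding C_def by (rule coef_sym_op_antisorted[OF assms(1-3) up w0])
  have "stab_card N I \<mu> > 0"
    unfolding stab_card_def card_gt_0_iff using finite_W[OF I_sub] id_in_W[OF I_sub] perm_exp_id by fastforce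
  then have C: "C \<noteq> 0" using det_J_square[OF w0] by (auto simp: C_def)
  have orb: "orbit N (I \<union> J) ?\<kappa> = orbit N (I \<union> J) \<mu>" by (rule orbit_perm_exp[OF w0])
  have \<kappa>: "?\<kappa> \<in> compositions N" by (rule perm_exp_compositions[OF W_permutes[OF IJ_sub w0] assms(2)])
  have \<mu>_orb: "\<mu> \<in> orbit N (I \<union> J) \<mu>"
    unfolding orbit_def using id_in_W[OF IJ_sub] perm_exp_id by (metis image_eqI)
  have finJ: "finite J" using J_sub finite_subset by blast
  define S where "S = const_poly (1 / C) * ?G"
  have GS: "?G = const_poly C * S" using C by (simp add: S_def mult.assoc[symmetric] const_poly_mult[symmetric])
  have S1: "coef S ?\<kappa> = 1" using C G by (simp add: S_def)
  have "jack_span N \<alpha> (orbit N (I \<union> J) ?\<kappa>) S"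
    unfolding S_def using \<mu>_orb by (intro jack_span_const jack_span_sym_op[OF assms(1) \<kappa>]) (simp add: orb)
  from jack_span_keys[OF assms(1) \<kappa> down this] S1
  have mono: "monic_triangular N ?\<kappa> S" unfolding monic_triangular_iff by blast
  \<comment> \<open>From any composition of the orbit the increasing one is reached by an element of
    W_J followed by one of W_I, and each of the two steps only contributes a scalar.\<close>
  have multiples: "\<exists>c. sym_op N I J (nonsym_jack N \<alpha> \<mu>') = const_poly c * S" if mem: "\<mu>' \<in> orbit N (I \<union> J) ?\<kappa>" for \<mu>'
  proof -
    obtain w where w: "w \<in> W" "\<mu> = perm_exp w \<mu>'" using orbit_pair[OF mem[unfolded orb] \<mu>_orb] by blast
    obtain u v where uv: "u \<in> W_group N I" "v \<in> W_group N J" "w = u \<circ> v" using W_decompose[OF w(1)] by blast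
    have \<mu>': "\<mu>' \<in> compositions N" by (rule orbit_compositions[OF \<kappa> mem])
    have bw: "bij u" "bij v" "bij w"
      using W_bij[OF I_sub uv(1)] W_bij[OF J_sub uv(2)] W_bij[OF IJ_sub w(1)] by simp_all
    have "\<mu>' = perm_exp (inv' w) \<mu>" using perm_exp_eq_iff[OF bw(3), of \<mu>' \<mu>] w(2) by simp
    then have d: "distinct_connected J \<mu>'"
      using distinct_W[OF inv_in_W[OF IJ_sub w(1)] assms(3)] by simp
    have v\<mu>': "perm_exp v \<mu>' \<in> compositions N"
      by (rule perm_exp_compositions[OF W_permutes[OF J_sub uv(2)] \<mu>'])
    have "perm_exp u (perm_exp v \<mu>') = \<mu>" by (simp add: perm_exp_comp bw w(2) uv(3))
    then show ?thesis
      using sym_op_jack_WJ[OF assms(1) \<mu>' d uv(2)] sym_op_jack_WI[OF assms(1) v\<mu>' uv(1)] GS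
      by (metis const_poly_mult mult.assoc)
  qed
  have "sym_jack N \<alpha> I J ?\<kappa> = S"
    unfolding sym_jack_def
  proof (rule the_equality)
    fix T assume T: "monic_triangular N ?\<kappa> T \<and> (\<forall>\<mu>'\<in>orbit N (I \<union> J) ?\<kappa>. distinct_on_blocks J \<mu>' \<longrightarrow>
        (\<exists>c. sym_op N I J (nonsym_jack N \<alpha> \<mu>') = const_poly c * T))"
    then obtain c where c: "?G = const_poly c * T"
      using \<mu>_orb assms(3) orb distinct_on_blocks_iff[OF finJ] by blast
    have "coef T ?\<kappa> = 1" using T by (simp add: monic_triangular_iff)
    then have "c = C" using G c by simp
    then have "const_poly C * T = const_poly C * S" using c GS by metis
    from const_poly_solve[OF this C] show "T = S" using C by simp
  qed (use mono multiples in blast)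
  then show "?G = const_poly C * sym_jack N \<alpha> I J ?\<kappa>" "coef (sym_jack N \<alpha> I J ?\<kappa>) ?\<kappa> = 1"
    using GS S1 by simp_all
qed

lemma a_const_formula:
  assumes "\<alpha> > 0" "\<eta> \<in> compositions N" "distinct_connected J \<eta>"
    and wJ: "w\<^sub>J \<in> W_group N J" "perm_exp w\<^sub>J \<eta> = rearr N I J Zero Plus \<eta>"
  shows "a_const N \<alpha> I J \<eta> =
    det_J I J w\<^sub>J * real (stab_card N I \<eta>) *
    (d'_prod N \<alpha> \<eta> * d'_prod N \<alpha> (rearr N I J Minus Plus \<eta>) * d_prod N \<alpha> (rearr N I J Minus Plus \<eta>)) /
    (d'_prod N \<alpha> (rearr N I J Zero Plus \<eta>) * d_prod N \<alpha> (rearr N I J Zero Plus \<eta>) *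
     d'_prod N \<alpha> (rearr N I J Minus Minus \<eta>))"
proof -
  have orb: "perm_exp w \<eta> \<in> orbit N (I \<union> J) \<eta>" if "w \<in> W" for w
    using that by (simp add: orbit_def)
  have strict: "part (perm_exp w \<eta>) j \<noteq> part (perm_exp w \<eta>) (Suc j)" if "w \<in> W" "j \<in> J" for w j
    by (rule distinct_adjacent[OF distinct_W[OF that(1) assms(3)] that(2)])
  have sI: "i \<notin> support J" "Suc i \<notin> support J" if "i \<in> I" for i
    using that support_disjoint[of i] support_disjoint[of "Suc i"] by (auto simp: support_def)
  have sJ: "j \<notin> support I" "Suc j \<notin> support I" if "j \<in> J" for j
    using that support_disjoint[of j] support_disjoint[of "Suc j"] by (auto simp: support_def)
  define \<zeta> where "\<zeta> = perm_exp w\<^sub>J \<eta>"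
  obtain v0 where v0: "v0 \<in> W_group N J" "\<And>j. j \<in> J \<Longrightarrow> part (perm_exp v0 \<eta>) (Suc j) \<le> part (perm_exp v0 \<eta>) j"
    using W_perm_exp_sort[OF J_sub] by blast
  have v0s: "part (perm_exp v0 \<eta>) (Suc j) < part (perm_exp v0 \<eta>) j" if "j \<in> J" for j
    using v0(2)[OF that] strict[OF WJ_in_W[OF v0(1)] that] by simp
  have "rearr N I J Zero Plus \<eta> = perm_exp v0 \<eta>"
    by (intro rearr_Zero_Plus orb WJ_in_W v0(1) v0s part_perm_exp_fixed[OF J_sub] support_disjoint)
  then have \<zeta>: "rearr N I J Zero Plus \<eta> = \<zeta>" "\<And>j. j \<in> J \<Longrightarrow> part \<zeta> (Suc j) < part \<zeta> j"
    using wJ(2) v0s by (simp_all add: \<zeta>_def)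
  obtain u where u: "u \<in> W_group N I" "\<And>i. i \<in> I \<Longrightarrow> part (perm_exp u \<zeta>) i \<le> part (perm_exp u \<zeta>) (Suc i)"
    using W_perm_exp_sort_up[OF I_sub] by blast
  define \<xi> where "\<xi> = perm_exp u \<zeta>"
  have b: "bij w" if "w \<in> W" for w using W_bij[OF IJ_sub that] .
  have bij: "bij u" "bij w\<^sub>J" using b WI_in_W[OF u(1)] WJ_in_W[OF wJ(1)] by auto
  have wu: "u \<circ> w\<^sub>J \<in> W" by (rule comp_in_W[OF IJ_sub WI_in_W[OF u(1)] WJ_in_W[OF wJ(1)]])
  have \<xi>\<eta>: "\<xi> = perm_exp (u \<circ> w\<^sub>J) \<eta>" by (simp add: \<xi>_def \<zeta>_def perm_exp_comp bij)
  have \<xi>J: "part \<xi> (Suc j) < part \<xi> j" if "j \<in> J" for j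
    using \<zeta>(2)[OF that] sJ[OF that] part_perm_exp_fixed[OF I_sub u(1)] by (simp add: \<xi>_def)
  have \<xi>: "rearr N I J Minus Plus \<eta> = \<xi>"
    by (rule rearr_Minus_Plus) (use u(2) \<xi>J orb[OF wu] in \<open>auto simp: \<xi>_def[symmetric] \<xi>\<eta>[symmetric]\<close>)
  obtain v where v: "v \<in> W_group N J" "\<And>j. j \<in> J \<Longrightarrow> part (perm_exp v \<xi>) j \<le> part (perm_exp v \<xi>) (Suc j)"
    using W_perm_exp_sort_up[OF J_sub] by blast
  define \<mu> where "\<mu> = perm_exp v \<xi>"
  have bv: "bij v" "bij (u \<circ> w\<^sub>J)" using b WJ_in_W[OF v(1)] wu by auto
  have wv: "v \<circ> (u \<circ> w\<^sub>J) \<in> W" by (rule comp_in_W[OF IJ_sub WJ_in_W[OF v(1)] wu])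
  have \<mu>\<eta>: "\<mu> = perm_exp (v \<circ> (u \<circ> w\<^sub>J)) \<eta>" by (simp only: \<mu>_def \<xi>\<eta> perm_exp_comp bv)
  have \<mu>J: "part \<mu> j < part \<mu> (Suc j)" if "j \<in> J" for j
    using v(2)[OF that] strict[OF wv that] by (simp add: \<mu>_def[symmetric] \<mu>\<eta>[symmetric])
  have \<mu>I: "part \<mu> i \<le> part \<mu> (Suc i)" if "i \<in> I" for i
    using u(2)[OF that] sI[OF that] part_perm_exp_fixed[OF J_sub v(1)] by (simp add: \<mu>_def \<xi>_def)
  have \<mu>: "rearr N I J Minus Minus \<eta> = \<mu>"
    by (rule rearr_Minus_Minus) (use \<mu>I \<mu>J orb[OF wv] in \<open>auto simp: \<mu>\<eta>[symmetric]\<close>)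
  obtain u2 where u2: "u2 \<in> W_group N I" "\<And>i. i \<in> I \<Longrightarrow> part (perm_exp u2 \<xi>) (Suc i) \<le> part (perm_exp u2 \<xi>) i"
    using W_perm_exp_sort[OF I_sub] by blast
  \<comment> \<open>This leads from the increasing arrangement to the leading exponent: the inverse
    of \<open>v\<close> restores decreasing order on the J-blocks, then \<open>u2\<close> makes the
    I-blocks decrease. Only \<open>v\<close> affects the sign.\<close>
  define w0 where "w0 = u2 \<circ> inv' v"
  have iv: "inv' v \<in> W" by (rule inv_in_W[OF IJ_sub WJ_in_W[OF v(1)]])
  have w0: "w0 \<in> W" unfolding w0_def by (rule comp_in_W[OF IJ_sub WI_in_W[OF u2(1)] iv])
  have bu2: "bij u2" using b WI_in_W[OF u2(1)] .
  have \<kappa>: "perm_exp w0 \<mu> = perm_exp u2 \<xi>"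
    using perm_exp_inv_cancel[OF bv(1), of \<xi>]
    by (simp add: w0_def \<mu>_def perm_exp_comp[symmetric] bu2 bij_imp_bij_inv bv)
  have det0: "det_J I J w0 = det_J I J v"
    unfolding w0_def det_J_comp[OF WI_in_W[OF u2(1)] iv] det_J_WI[OF u2(1)] det_J_inv[OF WJ_in_W[OF v(1)]] by simp
  have \<kappa>J: "part (perm_exp w0 \<mu>) (Suc j) < part (perm_exp w0 \<mu>) j" if "j \<in> J" for j
    using \<xi>J[OF that] sJ[OF that] part_perm_exp_fixed[OF I_sub u2(1)] by (simp add: \<kappa>)
  have star: "eta_star N I J \<eta> = perm_exp w0 \<mu>"
  proof (rule eta_star_eqI)
    show "perm_exp w0 \<mu> \<in> orbit N (I \<union> J) \<eta>"
      using orb[OF comp_in_W[OF IJ_sub w0 wv]] unfolding \<mu>\<eta> by (simp only: perm_exp_comp b w0 wv)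
  qed (use u2(2) \<kappa> \<kappa>J in auto)
  have cp: "perm_exp w \<eta> \<in> compositions N" if "w \<in> W" for w
    by (rule perm_exp_compositions[OF W_permutes[OF IJ_sub that] assms(2)])
  have comps: "\<zeta> \<in> compositions N" "\<xi> \<in> compositions N" "\<mu> \<in> compositions N"
    using cp[OF WJ_in_W[OF wJ(1)]] cp[OF wu] cp[OF wv] by (simp_all only: \<zeta>_def \<xi>\<eta> \<mu>\<eta>)
  have dist: "distinct_connected J \<xi>" "distinct_connected J \<mu>"
    using distinct_W[OF wu assms(3)] distinct_W[OF wv assms(3)] by (simp_all only: \<xi>\<eta> \<mu>\<eta>)
  let ?O = "\<lambda>\<nu>. sym_op N I J (nonsym_jack N \<alpha> \<nu>)" and ?S = "sym_jack N \<alpha> I J (eta_star N I J \<eta>)"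
  let ?M = "real (stab_card N I \<eta>)"
  have st: "stab_card N I \<mu> = stab_card N I \<eta>" unfolding \<mu>\<eta> by (rule stab_card_W[OF wv])
  have up: "part \<mu> k \<le> part \<mu> (Suc k)" if "k \<in> I \<union> J" for k
    using that \<mu>I \<mu>J by (auto intro: less_imp_le)
  have down: "part (perm_exp w0 \<mu>) (Suc k) \<le> part (perm_exp w0 \<mu>) k" if "k \<in> I \<union> J" for k
    using that u2(2) \<kappa> \<kappa>J by (auto intro: less_imp_le)
  note S = sym_jack_eq[OF assms(1) comps(3) dist(2) up w0 down]
  have O\<mu>: "?O \<mu> = const_poly (det_J I J v * ?M) * ?S"
    using S(1) by (simp add: star det0 st)
  have S1: "coef ?S (eta_star N I J \<eta>) = 1" using S(2) by (simp add: star)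
  define A where "A = det_J I J w\<^sub>J * ?M * (d'_prod N \<alpha> \<eta> * d'_prod N \<alpha> \<xi> * d_prod N \<alpha> \<xi>) /
    (d'_prod N \<alpha> \<zeta> * d_prod N \<alpha> \<zeta> * d'_prod N \<alpha> \<mu>)"
  have "?O \<eta> = const_poly (det_J I J w\<^sub>J * d'_prod N \<alpha> \<eta> / d'_prod N \<alpha> \<zeta>) * ?O \<zeta>"
    unfolding \<zeta>_def by (rule sym_op_jack_WJ[OF assms(1-3) wJ(1)])
  also have "?O \<zeta> = const_poly (d_prod N \<alpha> \<xi> / d_prod N \<alpha> \<zeta>) * ?O \<xi>"
    unfolding \<xi>_def by (rule sym_op_jack_WI[OF assms(1) comps(1) u(1)])
  also have "?O \<xi> = const_poly (det_J I J v * d'_prod N \<alpha> \<xi> / d'_prod N \<alpha> \<mu>) * ?O \<mu>"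
    unfolding \<mu>_def by (rule sym_op_jack_WJ[OF assms(1) comps(2) dist(1) v(1)])
  also have "?O \<mu> = const_poly (det_J I J v * ?M) * ?S" by (rule O\<mu>)
  also have "const_poly (det_J I J w\<^sub>J * d'_prod N \<alpha> \<eta> / d'_prod N \<alpha> \<zeta>) *
      (const_poly (d_prod N \<alpha> \<xi> / d_prod N \<alpha> \<zeta>) *
       (const_poly (det_J I J v * d'_prod N \<alpha> \<xi> / d'_prod N \<alpha> \<mu>) * (const_poly (det_J I J v * ?M) * ?S))) =
      const_poly ((det_J I J v * det_J I J v) * A) * ?S"
    by (simp add: A_def mult.assoc[symmetric] const_poly_mult[symmetric]) (simp add: ac_simps)
  \<comment> \<open>One factor comes from the walk along \<open>v\<close>, the other from the
    leading coefficient at \<mu>, whose \<open>w0\<close> has the same sign as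
    \<open>v\<close>.\<close>
  also have "(det_J I J v * det_J I J v) * A = A"
    using det_J_square[OF WJ_in_W[OF v(1)]] by simp
  finally have O\<eta>: "?O \<eta> = const_poly A * ?S" .
  have "a_const N \<alpha> I J \<eta> = A"
    unfolding a_const_def
  proof (rule the_equality)
    fix x assume "?O \<eta> = const_poly x * ?S"
    with O\<eta> have "const_poly A * ?S = const_poly x * ?S" by (rule trans[OF sym])
    from arg_cong[OF this, of "\<lambda>f. coef f (eta_star N I J \<eta>)"] show "x = A"
      unfolding coef_const_mult S1 by simp
  qed (rule O\<eta>)
  then show ?thesis unfolding A_def \<zeta>(1) \<xi> \<mu> .
qed

end

theorem proposition2p2:
  fixes N :: nat and \<alpha> :: real and I J :: "nat set" and \<eta> :: exponents and w\<^sub>J :: "nat \<Rightarrow> nat"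
  assumes "N \<ge> 1" and "\<alpha> > 0"
    and "I \<subseteq> {1..N - 1}" and "J \<subseteq> {1..N - 1}" and "I \<inter> J = {}"
    and "\<forall>i\<in>I. i - 1 \<notin> J \<and> i + 1 \<notin> J"
    and "\<forall>j\<in>J. j - 1 \<notin> I \<and> j + 1 \<notin> I"
    and "\<eta> \<in> compositions N"
    and "distinct_on_blocks J \<eta>"
    and "w\<^sub>J \<in> W_group N J" and "perm_exp w\<^sub>J \<eta> = rearr N I J Zero Plus \<eta>"
  shows "a_const N \<alpha> I J \<eta> =
    det_J I J w\<^sub>J * real (stab_card N I \<eta>) *
    (d'_prod N \<alpha> \<eta> * d'_prod N \<alpha> (rearr N I J Minus Plus \<eta>) * d_prod N \<alpha> (rearr N I J Minus Plus \<eta>)) /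
    (d'_prod N \<alpha> (rearr N I J Zero Plus \<eta>) * d_prod N \<alpha> (rearr N I J Zero Plus \<eta>) *
     d'_prod N \<alpha> (rearr N I J Minus Minus \<eta>))"
proof -
  interpret separated_subsets N I J
    using assms(1,3-7) by unfold_locales auto
  have "distinct_connected J \<eta>"
    using assms(9) distinct_on_blocks_iff[OF finite_subset[OF assms(4) finite_atLeastAtMost]] by simp
  then show ?thesis by (rule a_const_formula[OF assms(2,8) _ assms(10,11)])
qed

end
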